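(* Let $p$ be an odd prime, $P$ a finite $p$-group of class $2$ and exponent $p$, and $\mathcal{H}$ a fully refined central decomposition of $P$. Let $Z(\mathcal{H})=\{H\in\mathcal{H}: H\le Z(P)\}$, $\mathcal{K}=\mathcal{H}-Z(\mathcal{H})$, $Q=\langle\mathcal{K}\rangle$, $b=\mathsf{Bi}(Q)$ and $A=\operatorname{Adj}(b)$. For each maximal $*$-ideal $I$ of $A$ let $\mathcal{K}_I=\{H\in\mathcal{K}: e_H\notin I\}$. Then $\mathcal{H}$ is partitioned into $Z(\mathcal{H})$ together with the sets $\mathcal{K}_I$, $I$ ranging over the maximal $*$-ideals of $A$. Furthermore $|Z(\mathcal{H})|$, $|\mathcal{K}|$ and $|\mathcal{H}|$ are uniquely determined by $P$ (i.e. are the same for all fully refined central decompositions of $P$).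
   Context: A central decomposition of $P$ is a set of subgroups, pairwise commuting elementwise, generating $P$, with no proper subset generating $P$; fully refined means each member is centrally indecomposable (has only the trivial central decomposition). $\mathsf{Bi}(Q)$ is the alternating $\mathbb{Z}_p$-bilinear map $Q/Q'\times Q/Q'\to Q'$, $(Q'x,Q'y)\mapsto[x,y]$ (here $Q'=Z(Q)$, so it is non-degenerate). $\operatorname{Adj}(b)$ is the $*$-algebra of $f\in\operatorname{End}(Q/Q')$ having an adjoint $f^*$ with $b(uf,v)=b(u,vf^* )$ for all $u,v$. A $*$-ideal is a two-sided ideal $I$ with $I^*=I$; maximal $*$-ideals are maximal among proper $*$-ideals. The subspaces $HQ'/Q'$ ($H\in\mathcal{K}$) form a direct decomposition of $Q/Q'$, and $e_H\in\operatorname{End}(Q/Q')$ is the projection onto $HQ'/Q'$ along the sum of the other $KQ'/Q'$, $K\in\mathcal{K}$; each $e_H$ lies in $\operatorname{Adj}(b)$. *)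

theory Defs
  imports "HOL-Algebra.Algebra" "HOL-Library.Disjoint_Sets"
begin

definition grp_center :: "('a, 'b) monoid_scheme \<Rightarrow> 'a set" where
  "grp_center G = {z \<in> carrier G. \<forall>x \<in> carrier G. z \<otimes>\<^bsub>G\<^esub> x = x \<otimes>\<^bsub>G\<^esub> z}"

definition comm :: "('a, 'b) monoid_scheme \<Rightarrow> 'a \<Rightarrow> 'a \<Rightarrow> 'a" where
  "comm G x y = inv\<^bsub>G\<^esub> x \<otimes>\<^bsub>G\<^esub> inv\<^bsub>G\<^esub> y \<otimes>\<^bsub>G\<^esub> x \<otimes>\<^bsub>G\<^esub> y"

definition p_group :: "('a, 'b) monoid_scheme \<Rightarrow> nat \<Rightarrow> bool" where
  "p_group G p \<longleftrightarrow> finite (carrier G) \<and> (\<exists>n. card (carrier G) = p ^ n)"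

definition class_two :: "('a, 'b) monoid_scheme \<Rightarrow> bool" where
  "class_two G \<longleftrightarrow> derived G (carrier G) \<subseteq> grp_center G \<and> grp_center G \<noteq> carrier G"

definition has_exponent :: "('a, 'b) monoid_scheme \<Rightarrow> nat \<Rightarrow> bool" where
  "has_exponent G e \<longleftrightarrow> (\<forall>x \<in> carrier G. x [^]\<^bsub>G\<^esub> e = \<one>\<^bsub>G\<^esub>) \<and>
      (\<forall>d. 0 < d \<longrightarrow> (\<forall>x \<in> carrier G. x [^]\<^bsub>G\<^esub> d = \<one>\<^bsub>G\<^esub>) \<longrightarrow> e \<le> d)"

definition central_decomp :: "('a, 'b) monoid_scheme \<Rightarrow> 'a set set \<Rightarrow> bool" where
  "central_decomp G \<H> \<longleftrightarrow>
     (\<forall>H \<in> \<H>. subgroup H G) \<and>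
     (\<forall>H \<in> \<H>. \<forall>K \<in> \<H>. H \<noteq> K \<longrightarrow> (\<forall>h \<in> H. \<forall>k \<in> K. h \<otimes>\<^bsub>G\<^esub> k = k \<otimes>\<^bsub>G\<^esub> h)) \<and>
     generate G (\<Union>\<H>) = carrier G \<and>
     (\<forall>\<H>'. \<H>' \<subset> \<H> \<longrightarrow> generate G (\<Union>\<H>') \<noteq> carrier G)"

definition centrally_indecomposable :: "('a, 'b) monoid_scheme \<Rightarrow> bool" where
  "centrally_indecomposable G \<longleftrightarrow> (\<forall>\<H>. central_decomp G \<H> \<longrightarrow> \<H> = {carrier G})"

definition fully_refined :: "('a, 'b) monoid_scheme \<Rightarrow> 'a set set \<Rightarrow> bool" where
  "fully_refined G \<H> \<longleftrightarrow> central_decomp G \<H> \<and>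
     (\<forall>H \<in> \<H>. centrally_indecomposable (G\<lparr>carrier := H\<rparr>))"

definition central_part :: "('a, 'b) monoid_scheme \<Rightarrow> 'a set set \<Rightarrow> 'a set set" where
  "central_part G \<H> = {H \<in> \<H>. H \<subseteq> grp_center G}"

abbreviation subgrp :: "('a, 'b) monoid_scheme \<Rightarrow> 'a set \<Rightarrow> ('a, 'b) monoid_scheme" where
  "subgrp G Q \<equiv> G\<lparr>carrier := Q\<rparr>"

definition Qder :: "('a, 'b) monoid_scheme \<Rightarrow> 'a set \<Rightarrow> 'a set" where
  "Qder G Q = derived (subgrp G Q) Q"

definition Vq :: "('a, 'b) monoid_scheme \<Rightarrow> 'a set \<Rightarrow> 'a set monoid" where
  "Vq G Q = (subgrp G Q) Mod (Qder G Q)"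

definition Bi :: "('a, 'b) monoid_scheme \<Rightarrow> 'a set \<Rightarrow> 'a set \<Rightarrow> 'a set \<Rightarrow> 'a" where
  "Bi G Q u v = comm G (SOME x. x \<in> u) (SOME y. y \<in> v)"

text \<open>End(Q/Q') as extensional group endomorphisms of V (automatically Z_p-linear).\<close>
definition EndV :: "('a, 'b) monoid_scheme \<Rightarrow> 'a set \<Rightarrow> ('a set \<Rightarrow> 'a set) set" where
  "EndV G Q = hom (Vq G Q) (Vq G Q) \<inter> extensional (carrier (Vq G Q))"

definition is_adjoint :: "('a, 'b) monoid_scheme \<Rightarrow> 'a set \<Rightarrow> ('a set \<Rightarrow> 'a set) \<Rightarrow> ('a set \<Rightarrow> 'a set) \<Rightarrow> bool" where
  "is_adjoint G Q f g \<longleftrightarrow> g \<in> EndV G Q \<and>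
     (\<forall>u \<in> carrier (Vq G Q). \<forall>v \<in> carrier (Vq G Q). Bi G Q (f u) v = Bi G Q u (g v))"

definition Adj :: "('a, 'b) monoid_scheme \<Rightarrow> 'a set \<Rightarrow> ('a set \<Rightarrow> 'a set) set" where
  "Adj G Q = {f \<in> EndV G Q. \<exists>g. is_adjoint G Q f g}"

definition adj_star :: "('a, 'b) monoid_scheme \<Rightarrow> 'a set \<Rightarrow> ('a set \<Rightarrow> 'a set) \<Rightarrow> ('a set \<Rightarrow> 'a set)" where
  "adj_star G Q f = (THE g. is_adjoint G Q f g)"

text \<open>Ring operations on End(V): pointwise sum, negation, zero, composition (u(fg) = (uf)g).\<close>
definition end_add :: "('a, 'b) monoid_scheme \<Rightarrow> 'a set \<Rightarrow> ('a set \<Rightarrow> 'a set) \<Rightarrow> ('a set \<Rightarrow> 'a set) \<Rightarrow> ('a set \<Rightarrow> 'a set)" where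
  "end_add G Q f g = (\<lambda>u \<in> carrier (Vq G Q). f u \<otimes>\<^bsub>Vq G Q\<^esub> g u)"

definition end_neg :: "('a, 'b) monoid_scheme \<Rightarrow> 'a set \<Rightarrow> ('a set \<Rightarrow> 'a set) \<Rightarrow> ('a set \<Rightarrow> 'a set)" where
  "end_neg G Q f = (\<lambda>u \<in> carrier (Vq G Q). inv\<^bsub>Vq G Q\<^esub> (f u))"

definition end_zero :: "('a, 'b) monoid_scheme \<Rightarrow> 'a set \<Rightarrow> ('a set \<Rightarrow> 'a set)" where
  "end_zero G Q = (\<lambda>u \<in> carrier (Vq G Q). \<one>\<^bsub>Vq G Q\<^esub>)"

definition end_mult :: "('a, 'b) monoid_scheme \<Rightarrow> 'a set \<Rightarrow> ('a set \<Rightarrow> 'a set) \<Rightarrow> ('a set \<Rightarrow> 'a set) \<Rightarrow> ('a set \<Rightarrow> 'a set)" where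
  "end_mult G Q f g = (\<lambda>u \<in> carrier (Vq G Q). g (f u))"

definition star_ideal :: "('a, 'b) monoid_scheme \<Rightarrow> 'a set \<Rightarrow> ('a set \<Rightarrow> 'a set) set \<Rightarrow> bool" where
  "star_ideal G Q I \<longleftrightarrow> I \<subseteq> Adj G Q \<and> end_zero G Q \<in> I \<and>
     (\<forall>f \<in> I. \<forall>g \<in> I. end_add G Q f g \<in> I) \<and>
     (\<forall>f \<in> I. end_neg G Q f \<in> I) \<and>
     (\<forall>f \<in> I. \<forall>a \<in> Adj G Q. end_mult G Q a f \<in> I \<and> end_mult G Q f a \<in> I) \<and>
     adj_star G Q ` I = I"

definition max_star_ideal :: "('a, 'b) monoid_scheme \<Rightarrow> 'a set \<Rightarrow> ('a set \<Rightarrow> 'a set) set \<Rightarrow> bool" where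
  "max_star_ideal G Q I \<longleftrightarrow> star_ideal G Q I \<and> I \<noteq> Adj G Q \<and>
     (\<forall>J. star_ideal G Q J \<and> J \<noteq> Adj G Q \<and> I \<subseteq> J \<longrightarrow> J = I)"

definition img_V :: "('a, 'b) monoid_scheme \<Rightarrow> 'a set \<Rightarrow> 'a set \<Rightarrow> 'a set set" where
  "img_V G Q H = (\<lambda>h. Qder G Q #>\<^bsub>subgrp G Q\<^esub> h) ` H"

definition proj_e :: "('a, 'b) monoid_scheme \<Rightarrow> 'a set \<Rightarrow> 'a set set \<Rightarrow> 'a set \<Rightarrow> ('a set \<Rightarrow> 'a set)" where
  "proj_e G Q \<K> H = (\<lambda>u \<in> carrier (Vq G Q).
     THE w. w \<in> img_V G Q H \<and>
       (\<exists>v \<in> generate (Vq G Q) (\<Union>K \<in> \<K> - {H}. img_V G Q K). u = w \<otimes>\<^bsub>Vq G Q\<^esub> v))"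

end

theory Submission
  imports Defs
begin

text \<open>
  The form \<open>b\<close> lives on \<open>Q / Q' \<cong> P / Z(P)\<close>, so every fully refined central decomposition of \<open>P\<close>
  induces a decomposition of the same space into pairwise orthogonal indecomposable subspaces, that
  is, a frame (a set of orthogonal self-adjoint idempotents with sum \<open>1\<close>, none of which is a sum of
  two such) of the same finite ring with involution \<open>A\<close>.

  Let \<open>e\<close> be a primitive self-adjoint idempotent. A self-adjoint element of \<open>eAe\<close> is nilpotent or has
  a power equal to \<open>e\<close>. Hence \<open>e \<in> I + J\<close> forces \<open>e \<in> I\<close> or \<open>e \<in> J\<close> for *-ideals, so at most one maximal
  *-ideal misses \<open>e\<close>. In odd characteristic \<open>-e\<close> is not a sum of self-adjoint nilpotents of \<open>eAe\<close>:
  adding such a nilpotent to \<open>z z\<^sup>*\<close> with \<open>z\<close> a unit yields again an element of this form, because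
  \<open>1 + n\<close> has a self-adjoint square root. By polarisation, \<open>e \<in> AfA\<close> then gives \<open>x \<in> eAf\<close>
  such that \<open>x x\<^sup>*\<close> and \<open>x\<^sup>* x\<close> have powers \<open>e\<close> and \<open>f\<close>. So \<open>f \<in> AeA\<close>, which makes the *-ideals missing \<open>e\<close>
  lie in a maximal one, and left multiplication by \<open>x\<close> identifies \<open>fI\<close> with \<open>eI\<close>. Counting \<open>A\<close> and a
  maximal *-ideal \<open>I\<close> through the Peirce components of a frame, the number of its members outside
  \<open>I\<close> does not depend on the frame.

  The central members have order \<open>p\<close> and are independent modulo \<open>P'\<close>, so \<open>|Z(P)| = |P'| p\<^sup>m\<close> for their
  number \<open>m\<close>.
\<close>

section \<open>Self-adjoint nilpotents in finite rings with involution\<close>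

text \<open>Two frame members that miss the same maximal *-ideal need not be conjugate by a
  \<open>u\<close> with \<open>u star u = 1\<close>: for an involution of orthogonal type their
  norms may differ by a non-square. Hence they are compared only through powers of
  \<open>x star x\<close>, which do not see this class, and frames are compared by a count. Let
  \<open>n\<close> members of a frame miss \<open>I\<close>. Each contributes the same size
  \<open>a\<close> to \<open>A\<close> and the same size \<open>d < a\<close> to \<open>I\<close>,
  while a member inside \<open>I\<close> contributes equally to both. So
  \<open>|A| / |I| = (a / d)^n\<close>, which fixes \<open>n\<close>.

  Finiteness takes the place of structure theory: every element has an idempotent power, so neither
  the radical nor a classification of simple quotients enters.

  The ring \<open>A\<close> is built from \<open>Q\<close>, which depends on the chosen
  decomposition. Other decompositions act on the same ring because \<open>Q\<close> meets
  \<open>Z(P)\<close> exactly in \<open>P'\<close>. This is where central indecomposability of the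
  members is used on the group side: a central element of \<open>H\<close> outside \<open>H'\<close>
  splits off as a central factor, so it generates \<open>H\<close>.\<close>

inductive_set add_span :: "('a, 'b) ring_scheme \<Rightarrow> 'a set \<Rightarrow> 'a set" for R S where
  zero: "\<zero>\<^bsub>R\<^esub> \<in> add_span R S"
| add: "x \<in> add_span R S \<Longrightarrow> s \<in> S \<Longrightarrow> x \<oplus>\<^bsub>R\<^esub> s \<in> add_span R S"

text \<open>By finiteness the powers of \<open>s\<close> become periodic, and an exponent that is
  both a multiple of the period and past the preperiod gives an idempotent.\<close>

lemma (in monoid) finite_idempotent_power:
  assumes "finite (carrier G)" "s \<in> carrier G"
  obtains m :: nat where "m > 0" "s [^] m \<otimes> s [^] m = s [^] m"
proof -
  have "\<not> inj (\<lambda>i::nat. s [^] i)"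
  proof
    assume "inj (\<lambda>i::nat. s [^] i)"
    moreover have "range (\<lambda>i::nat. s [^] i) \<subseteq> carrier G" using assms by auto
    ultimately show False
      using assms(1) finite_subset finite_imageD infinite_UNIV_nat by blast
  qed
  then obtain i k :: nat where "i < k" "s [^] i = s [^] k"
    unfolding inj_def by (metis linorder_neqE_nat)
  then obtain j where j: "j > 0" "s [^] i = s [^] (i + j)"
    using less_imp_add_positive by metis
  have step: "s [^] a = s [^] (a + j)" if "a \<ge> i" for a
  proof -
    obtain c where "a = c + i" by (metis \<open>i \<le> a\<close> le_add_diff_inverse2)
    then have "s [^] a = s [^] c \<otimes> s [^] (i + j)"
      using nat_pow_mult[OF assms(2), of c i] j(2) by simp
    also have "\<dots> = s [^] (a + j)"
      using nat_pow_mult[OF assms(2), of c "i + j"] \<open>a = c + i\<close> by (simp add: add.assoc)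
    finally show ?thesis .
  qed
  have "s [^] a = s [^] (a + j * t)" if "a \<ge> i" for a t
  proof (induction t)
    case (Suc t)
    have "a + j * Suc t = (a + j * t) + j" by simp
    then show ?case using Suc step[of "a + j * t"] that by (metis trans_le_add1)
  qed simp
  \<comment> \<open>The exponent \<open>j * Suc i\<close> is a positive multiple of the period
    \<open>j\<close> and at least \<open>i\<close>, so doubling it changes nothing.\<close>
  from this[of "j * Suc i" "Suc i"] have "s [^] (j * Suc i + j * Suc i) = s [^] (j * Suc i)"
    using j(1) by (metis One_nat_def Suc_leI add_leD1 le_add2 mult_le_mono nat_mult_1 plus_1_eq_Suc)
  then show thesis using that[of "j * Suc i"] j(1) assms(2) by (simp add: nat_pow_mult)
qed

text \<open>\<open>odd_torsion\<close> expresses odd characteristic without a base field: it makes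
  doubling injective and passes directly to the rings \<open>e R e\<close>, which have another
  unit.\<close>

locale star_ring = ring R for R (structure) +
  fixes star :: "'a \<Rightarrow> 'a"
  assumes star_closed [simp, intro]: "x \<in> carrier R \<Longrightarrow> star x \<in> carrier R"
    and star_star [simp]: "x \<in> carrier R \<Longrightarrow> star (star x) = x"
    and star_add: "x \<in> carrier R \<Longrightarrow> y \<in> carrier R \<Longrightarrow> star (x \<oplus> y) = star x \<oplus> star y"
    and star_mult: "x \<in> carrier R \<Longrightarrow> y \<in> carrier R \<Longrightarrow> star (x \<otimes> y) = star y \<otimes> star x"
    and finite_carrier: "finite (carrier R)"
    and odd_torsion: "\<exists>n::nat. odd n \<and> (\<forall>x \<in> carrier R. [n] \<cdot> x = \<zero>)"
begin

lemma star_zero [simp]: "star \<zero> = \<zero>"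
  using star_add[of \<zero> \<zero>] add.r_cancel_one' star_closed zero_closed by (metis l_zero)

lemma star_one [simp]: "star \<one> = \<one>"
  using star_mult[of \<one> "star \<one>"] by auto

lemma star_minus: "x \<in> carrier R \<Longrightarrow> star (\<ominus> x) = \<ominus> star x"
  using star_add[of "\<ominus> x" x] by (simp add: l_neg minus_equality)

lemma star_pow: "x \<in> carrier R \<Longrightarrow> star (x [^] (k::nat)) = star x [^] k"
  by (induction k) (simp_all add: star_mult, metis nat_pow_Suc nat_pow_Suc2 star_closed)

lemma double_eq_zero:
  assumes "x \<in> carrier R" "x \<oplus> x = \<zero>" shows "x = \<zero>"
proof -
  obtain n :: nat where n: "odd n" "[n] \<cdot> x = \<zero>" using odd_torsion assms by blast
  then obtain k where k: "n = 2 * k + 1" by (elim oddE)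
  have 2: "[(2::nat)] \<cdot> x = \<zero>" using assms by (simp add: numeral_2_eq_2)
  have "[(2 * k)] \<cdot> x = [k] \<cdot> ([(2::nat)] \<cdot> x)"
    using assms add.nat_pow_pow[of x k 2] by simp
  then have "[n] \<cdot> x = x" using assms k 2 by simp
  then show ?thesis using n by simp
qed

lemma add_span_closed:
  assumes "x \<in> add_span R S" "S \<subseteq> carrier R"
  shows "x \<in> carrier R"
  using assms by induction auto

lemma add_span_mem: "S \<subseteq> carrier R \<Longrightarrow> s \<in> S \<Longrightarrow> s \<in> add_span R S"
  using add_span.add[OF add_span.zero, of s S R] by (auto simp: subset_iff)

lemma add_span_add:
  assumes "S \<subseteq> carrier R" "x \<in> add_span R S" "y \<in> add_span R S"
  shows "x \<oplus> y \<in> add_span R S"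
  using assms(3)
proof induction
  case zero then show ?case using add_span_closed assms by simp
next
  case (add y s)
  then have "x \<oplus> (y \<oplus> s) = (x \<oplus> y) \<oplus> s"
    using assms add_span_closed by (simp add: a_assoc subset_iff)
  then show ?case using add add_span.add by metis
qed

text \<open>Spans are formed by addition alone, but if \<open>2 k + 1\<close> annihilates
  \<open>x\<close>, then \<open>- x\<close> is the \<open>k\<close>-fold sum of
  \<open>x + x\<close>.\<close>

lemma minus_in_add_span_if_double:
  assumes "S \<subseteq> carrier R" "x \<in> carrier R" "x \<oplus> x \<in> add_span R S"
  shows "\<ominus> x \<in> add_span R S"
proof -
  obtain n :: nat where n: "odd n" "[n] \<cdot> x = \<zero>" using odd_torsion assms by blast
  then obtain k where k: "n = 2 * k + 1" by (elim oddE)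
  have 2: "[(2::nat)] \<cdot> x = x \<oplus> x" using assms by (simp add: numeral_2_eq_2)
  have "[(2 * k)] \<cdot> x = [k] \<cdot> ([(2::nat)] \<cdot> x)"
    using assms add.nat_pow_pow[of x k 2] by simp
  then have "[n] \<cdot> x = [k] \<cdot> (x \<oplus> x) \<oplus> x" using assms k 2 by simp
  then have "\<ominus> x = [k] \<cdot> (x \<oplus> x)"
    using n(2) assms(2) minus_equality by simp
  moreover have "[k] \<cdot> (x \<oplus> x) \<in> add_span R S"
    by (induction k) (simp_all add: add_span.zero add_span_add assms)
  ultimately show ?thesis by simp
qed

definition nilpotent :: "'a \<Rightarrow> bool" where
  "nilpotent x \<longleftrightarrow> (\<exists>k::nat. x [^] k = \<zero>)"

text \<open>Minimality is tested against self-adjoint idempotents only, so \<open>e\<close> may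
  still split as an ordinary idempotent. This is the notion that an orthogonally indecomposable
  summand provides.\<close>

definition primitive :: "'a \<Rightarrow> bool" where
  "primitive e \<longleftrightarrow> e \<in> carrier R \<and> e \<otimes> e = e \<and> star e = e \<and> e \<noteq> \<zero> \<and>
     (\<forall>d \<in> carrier R. d \<otimes> d = d \<and> star d = d \<and> e \<otimes> d = d \<and> d \<otimes> e = d \<longrightarrow> d = \<zero> \<or> d = e)"

lemma primitiveD:
  assumes "primitive e"
  shows "e \<in> carrier R" "e \<otimes> e = e" "star e = e" "e \<noteq> \<zero>"
  using assms unfolding primitive_def by auto

text \<open>The idempotent power of \<open>s\<close> is again self-adjoint and lies below
  \<open>e\<close>, so primitivity leaves only \<open>0\<close> and \<open>e\<close>. This dichotomy
  plays the part of a local ring, for self-adjoint elements.\<close>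

lemma nilpotent_or_power:
  assumes "primitive e" "s \<in> carrier R" "star s = s" "e \<otimes> s = s" "s \<otimes> e = s" "\<not> nilpotent s"
  obtains m :: nat where "m > 0" "s [^] m = e"
proof -
  obtain m :: nat where m: "m > 0" "s [^] m \<otimes> s [^] m = s [^] m"
    using finite_idempotent_power finite_carrier assms(2) by metis
  then obtain j where j: "m = Suc j" using gr0_implies_Suc by blast
  have "s [^] m \<otimes> e = s [^] m"
    using assms primitiveD(1)[OF assms(1)] by (simp add: j m_assoc)
  moreover have "e \<otimes> s [^] m = s [^] m"
    using assms primitiveD(1)[OF assms(1)] by (metis j nat_pow_Suc2 nat_pow_closed m_assoc)
  ultimately have "s [^] m = \<zero> \<or> s [^] m = e"
    using assms m star_pow[of s m] unfolding primitive_def by auto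
  then show thesis using that m(1) assms(6) unfolding nilpotent_def by metis
qed

text \<open>The relation gives \<open>x^(k+2) = - 2 x^(k+1)\<close>, and cancelling the 2 lowers the
  exponent at which \<open>x\<close> vanishes.\<close>

lemma pow_minus_absorb:
  assumes "x \<in> carrier R" "x \<otimes> x = \<ominus> (x \<oplus> x)" "nilpotent x"
  shows "x = \<zero>"
proof -
  have dbl: "y = \<zero>" if "y \<in> carrier R" "\<ominus> (y \<oplus> y) = \<zero>" for y
    using that double_eq_zero by (metis add.inv_eq_1_iff a_closed)
  have "x [^] Suc k = \<zero> \<Longrightarrow> x = \<zero>" for k :: nat
  proof (induction k)
    case 0 then show ?case using assms by simp
  next
    case (Suc k)
    have "x [^] Suc (Suc k) = x [^] k \<otimes> (x \<otimes> x)"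
      using assms(1) by (simp add: m_assoc)
    also have "\<dots> = \<ominus> (x [^] Suc k \<oplus> x [^] Suc k)"
      using assms by (simp add: r_minus r_distr)
    finally have "x [^] Suc k = \<zero>" using dbl Suc.prems assms(1) nat_pow_closed by metis
    then show ?case using Suc.IH by simp
  qed
  moreover obtain k :: nat where "x [^] k = \<zero>" using assms unfolding nilpotent_def by auto
  then have "x [^] Suc k = \<zero>" using assms(1) by simp
  ultimately show ?thesis by blast
qed

text \<open>The order of \<open>1 + n\<close> is odd: if \<open>h = (1 + n)\<^sup>i\<close> has \<open>h\<^sup>2 = 1\<close>, then
  \<open>(h - 1)\<^sup>2 = - 2 (h - 1)\<close> while \<open>h - 1\<close> is nilpotent.\<close>
lemma sqrt_one_plus_nilpotent:
  assumes "primitive \<one>" "n \<in> carrier R" "star n = n" "nilpotent n"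
  obtains w where "w \<in> Units R" "star w = w" "w \<otimes> w = \<one> \<oplus> n"
proof -
  define g where "g = \<one> \<oplus> n"
  have g: "g \<in> carrier R" "star g = g" using assms by (auto simp: g_def star_add)
  have one: "\<one> \<noteq> \<zero>" using primitiveD(4)[OF assms(1)] .
  \<comment> \<open>Keeping a cofactor \<open>c\<close> that commutes with \<open>n\<close> makes
    every \<open>g^i - 1 = n c\<close> nilpotent.\<close>
  have form: "\<exists>c \<in> carrier R. n \<otimes> c = c \<otimes> n \<and> g [^] i = \<one> \<oplus> n \<otimes> c" for i :: nat
  proof (induction i)
    case 0 then show ?case using assms by (intro bexI[of _ \<zero>]) auto
  next
    case (Suc i)
    then obtain c where c: "c \<in> carrier R" "n \<otimes> c = c \<otimes> n" "g [^] i = \<one> \<oplus> n \<otimes> c" by blast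
    have nc: "c \<otimes> (n \<otimes> n) = n \<otimes> (c \<otimes> n)"
      using c assms(2) by (metis m_assoc)
    define c' where "c' = \<one> \<oplus> c \<oplus> c \<otimes> n"
    have "g [^] Suc i = (\<one> \<oplus> n \<otimes> c) \<otimes> (\<one> \<oplus> n)" using c g_def by simp
    also have "\<dots> = \<one> \<oplus> n \<otimes> c'"
      unfolding c'_def using c nc assms(2) by (simp add: l_distr r_distr m_assoc a_ac)
    finally have "g [^] Suc i = \<one> \<oplus> n \<otimes> c'" .
    moreover have "n \<otimes> c' = c' \<otimes> n"
      unfolding c'_def using c nc assms(2) by (simp add: l_distr r_distr m_assoc)
    ultimately show ?case using c assms(2) by (intro bexI[of _ c']) (auto simp: c'_def)
  qed
  obtain k :: nat where k: "n [^] k = \<zero>" using assms unfolding nilpotent_def by auto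
  have nil: "nilpotent (n \<otimes> c)" if "c \<in> carrier R" "n \<otimes> c = c \<otimes> n" for c
    unfolding nilpotent_def using that assms(2) k by (intro exI[of _ k]) (simp add: pow_mult_distrib)
  \<comment> \<open>If some power of \<open>g\<close> were zero, \<open>- 1\<close> would have the
    form \<open>n c\<close> and be nilpotent, although its powers square to
    \<open>1\<close>.\<close>
  have not_nil: "\<not> nilpotent g"
  proof
    assume "nilpotent g"
    then obtain i :: nat where i: "g [^] i = \<zero>" unfolding nilpotent_def by auto
    then obtain c where c: "c \<in> carrier R" "n \<otimes> c = c \<otimes> n" "\<one> \<oplus> n \<otimes> c = \<zero>" using form[of i] by metis
    then have "\<ominus> (n \<otimes> c) = \<one>" using assms(2) minus_equality by simp
    then have "n \<otimes> c = \<ominus> \<one>" using c(1) assms(2) by (metis m_closed minus_minus)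
    moreover obtain j :: nat where "(n \<otimes> c) [^] j = \<zero>" using nil[OF c(1,2)] unfolding nilpotent_def by auto
    moreover have "(\<ominus> \<one>) [^] j \<otimes> (\<ominus> \<one>) [^] j = \<one>" for j :: nat
      using pow_mult_distrib[of "\<ominus> \<one>" "\<ominus> \<one>" j] by (simp add: l_minus)
    ultimately show False using one by (metis l_null zero_closed)
  qed
  obtain m0 :: nat where m0: "m0 > 0" "g [^] m0 = \<one>"
    using nilpotent_or_power[OF assms(1) g _ _ not_nil] g by auto
  \<comment> \<open>Leastness is what an even order violates: half of it would already give
    \<open>1\<close>.\<close>
  define m where "m = (LEAST m::nat. m > 0 \<and> g [^] m = \<one>)"
  have m: "m > 0" "g [^] m = \<one>"
    using LeastI[of "\<lambda>m::nat. m > 0 \<and> g [^] m = \<one>" m0] m0 by (auto simp: m_def)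
  have "odd m"
  proof
    assume "even m"
    then obtain i where i: "m = i + i" by (metis evenE mult_2)
    obtain c where c: "c \<in> carrier R" "n \<otimes> c = c \<otimes> n" "g [^] i = \<one> \<oplus> n \<otimes> c" using form by blast
    define x where "x = n \<otimes> c"
    have x: "x \<in> carrier R" using c assms(2) by (simp add: x_def)
    have "(\<one> \<oplus> x) \<otimes> (\<one> \<oplus> x) = \<one>" using m(2) i c g by (simp add: x_def nat_pow_mult[symmetric])
    moreover have "(\<one> \<oplus> x) \<otimes> (\<one> \<oplus> x) = \<one> \<oplus> ((x \<oplus> x) \<oplus> x \<otimes> x)"
      using x by (simp add: l_distr r_distr a_ac)
    ultimately have "(x \<oplus> x) \<oplus> x \<otimes> x = \<zero>" using x by simp
    then have "x \<otimes> x \<oplus> (x \<oplus> x) = \<zero>" using x by (simp add: a_comm)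
    then have "x \<otimes> x = \<ominus> (x \<oplus> x)" using x minus_equality[of "x \<otimes> x" "x \<oplus> x"] by simp
    then have "x = \<zero>" using pow_minus_absorb x nil[OF c(1,2)] x_def by metis
    then have "g [^] i = \<one>" using c x_def by simp
    moreover have "i > 0" "i < m" using i m by auto
    ultimately show False unfolding m_def using not_less_Least by blast
  qed
  then obtain l where l: "m = 2 * l + 1" by (elim oddE)
  \<comment> \<open>As \<open>m = 2 l + 1\<close>, the square of \<open>g^(l+1)\<close> is
    \<open>g^(m+1) = g\<close>. A power of the self-adjoint \<open>g\<close> is self-adjoint, and
    \<open>g^l\<close> inverts \<open>w\<close>.\<close>
  define w where "w = g [^] Suc l"
  have w: "w \<in> carrier R" "star w = w"
    using g star_pow[OF g(1), of "Suc l"] unfolding w_def by (auto simp del: nat_pow_Suc)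
  have ww: "w \<otimes> w = g"
    using nat_pow_mult[OF g(1), of "Suc l" "Suc l"] nat_pow_mult[OF g(1), of m 1] m g l
    unfolding w_def by (simp add: mult_2 del: nat_pow_Suc)
  have "w \<otimes> g [^] l = \<one>" "g [^] l \<otimes> w = \<one>"
    using nat_pow_mult[OF g(1), of "Suc l" l] nat_pow_mult[OF g(1), of l "Suc l"] m l
    unfolding w_def by (simp_all add: mult_2 del: nat_pow_Suc)
  then have "w \<in> Units R" using w g unfolding Units_def by auto
  then show thesis using that w ww g_def by metis
qed

text \<open>Factor \<open>z star z + n = z (1 + c) star z\<close> and take a self-adjoint square
  root \<open>w\<close> of \<open>1 + c\<close>; then \<open>z w\<close> is the new unit. The
  passage from \<open>n\<close> to \<open>c\<close> is a congruence, not a conjugation, so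
  nilpotency of \<open>c\<close> needs an argument: otherwise primitivity of \<open>1\<close> makes
  \<open>c\<close>, and hence \<open>n\<close>, invertible.\<close>

lemma norm_plus_nilpotent:
  assumes "primitive \<one>" "z \<in> Units R" "n \<in> carrier R" "star n = n" "nilpotent n"
  obtains w where "w \<in> Units R" "z \<otimes> star z \<oplus> n = w \<otimes> star w"
proof -
  have z: "z \<in> carrier R" "inv z \<in> carrier R" "z \<otimes> inv z = \<one>" "inv z \<otimes> z = \<one>"
    using assms(2) by auto
  have sz: "star (inv z) \<otimes> star z = \<one>" "star z \<otimes> star (inv z) = \<one>"
    using z star_mult by (metis star_one)+
  define c where "c = inv z \<otimes> n \<otimes> star (inv z)"
  have c: "c \<in> carrier R" "star c = c"
    using z assms by (auto simp: c_def star_mult m_assoc)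
  have n_c: "n = z \<otimes> c \<otimes> star z"
  proof -
    have "z \<otimes> c \<otimes> star z = (z \<otimes> inv z) \<otimes> n \<otimes> (star (inv z) \<otimes> star z)"
      unfolding c_def using z(1,2) assms(3) by (simp add: m_assoc del: Units_r_inv)
    then show ?thesis using z sz assms by simp
  qed
  have "nilpotent c"
  proof (rule ccontr)
    assume "\<not> nilpotent c"
    then obtain m :: nat where "m > 0" "c [^] m = \<one>"
      using nilpotent_or_power[OF assms(1) c] c by auto
    then obtain j :: nat where j: "c \<otimes> c [^] j = \<one>" using nat_pow_Suc2[OF c(1)] by (metis gr0_implies_Suc)
    \<comment> \<open>This is the inverse of \<open>z c star z\<close>, since \<open>c^j\<close>
      inverts \<open>c\<close>; a nilpotent \<open>n\<close> has no right inverse.\<close>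
    define q where "q = star (inv z) \<otimes> c [^] j \<otimes> inv z"
    have q: "q \<in> carrier R" using z c by (simp add: q_def)
    have "n \<otimes> q = z \<otimes> c \<otimes> (star z \<otimes> star (inv z)) \<otimes> c [^] j \<otimes> inv z"
      unfolding q_def by (subst n_c) (use z c in \<open>simp add: m_assoc\<close>)
    also have "\<dots> = z \<otimes> (c \<otimes> c [^] j) \<otimes> inv z" using z c sz by (simp add: m_assoc)
    also have "\<dots> = \<one>" using z c j by simp
    finally have nq: "n \<otimes> q = \<one>" .
    have "n [^] k \<otimes> q [^] k = \<one>" for k :: nat
    proof (induction k)
      case (Suc k)
      have "n [^] Suc k \<otimes> q [^] Suc k = n [^] k \<otimes> (n \<otimes> q) \<otimes> q [^] k"
        using q assms nat_pow_Suc2[OF q, of k] by (simp add: m_assoc)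
      then show ?case using nq Suc q assms by simp
    qed simp
    moreover obtain k :: nat where "n [^] k = \<zero>" using assms unfolding nilpotent_def by auto
    ultimately have "\<one> = \<zero>" using q by (metis l_null nat_pow_closed)
    then show False using primitiveD(4)[OF assms(1)] by simp
  qed
  then obtain w where w: "w \<in> Units R" "star w = w" "w \<otimes> w = \<one> \<oplus> c"
    using sqrt_one_plus_nilpotent[OF assms(1) c] by metis
  have "(z \<otimes> w) \<otimes> star (z \<otimes> w) = z \<otimes> (w \<otimes> w) \<otimes> star z"
    using w(1,2) z by (simp add: star_mult m_assoc Units_closed)
  also have "\<dots> = z \<otimes> star z \<oplus> z \<otimes> c \<otimes> star z" unfolding w(3) using z c by (simp add: r_distr l_distr)
  finally have "z \<otimes> star z \<oplus> n = (z \<otimes> w) \<otimes> star (z \<otimes> w)" using n_c by simp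
  then show thesis using that[of "z \<otimes> w"] assms(2) w(1) by simp
qed

text \<open>Adding self-adjoint nilpotents to \<open>1\<close> one at a time never leaves the
  elements \<open>w star w\<close> with \<open>w\<close> a unit, and \<open>0\<close> is not one of
  them.\<close>

lemma minus_one_not_sum_of_nilpotents:
  assumes "primitive \<one>"
  shows "\<ominus> \<one> \<notin> add_span R {n \<in> carrier R. star n = n \<and> nilpotent n}"
proof
  define N where "N = {n \<in> carrier R. star n = n \<and> nilpotent n}"
  assume "\<ominus> \<one> \<in> add_span R {n \<in> carrier R. star n = n \<and> nilpotent n}"
  then have *: "\<ominus> \<one> \<in> add_span R N" unfolding N_def .
  have "x \<in> carrier R \<and> (\<exists>w \<in> Units R. \<one> \<oplus> x = w \<otimes> star w)" if "x \<in> add_span R N" for x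
    using that
  proof induction
    case zero show ?case by (rule conjI, simp, rule bexI[of _ \<one>]) simp_all
  next
    case (add x n)
    then obtain w where w: "w \<in> Units R" "\<one> \<oplus> x = w \<otimes> star w" and x: "x \<in> carrier R" by blast
    have n: "n \<in> carrier R" "star n = n" "nilpotent n" using add.hyps by (auto simp: N_def)
    obtain w' where w': "w' \<in> Units R" "w \<otimes> star w \<oplus> n = w' \<otimes> star w'"
      using norm_plus_nilpotent[OF assms w(1) n] .
    have "\<one> \<oplus> (x \<oplus> n) = (\<one> \<oplus> x) \<oplus> n" using x n by (simp add: a_assoc)
    then have "\<one> \<oplus> (x \<oplus> n) = w' \<otimes> star w'" unfolding w(2) w'(2) .
    moreover have "x \<oplus> n \<in> carrier R" using x n by simp
    ultimately show ?case using w'(1) by metis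
  qed
  from this[OF *] obtain w where w: "w \<in> Units R" "\<one> \<oplus> \<ominus> \<one> = w \<otimes> star w" by (elim conjE bexE)
  have w0: "w \<otimes> star w = \<zero>" using w(2) r_neg[OF one_closed] by argo
  have c: "w \<in> carrier R" "inv w \<in> carrier R" "inv w \<otimes> w = \<one>" using w(1) by auto
  have "star w = inv w \<otimes> (w \<otimes> star w)"
    using c m_assoc[of "inv w" w "star w"] by simp
  then have "star w = \<zero>" unfolding w0 using c by simp
  then have "w = \<zero>" using c(1) star_star star_zero by metis
  then have "\<one> = \<zero>" using c by simp
  then show False using primitiveD(4)[OF assms] by simp
qed

section \<open>Primitive idempotents and ideals stable under the involution\<close>

text \<open>The ring \<open>e R e\<close>. Only carrier and unit change, so sums, products and
  \<open>star\<close> are literally those of \<open>R\<close>.\<close>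

definition corner :: "'a \<Rightarrow> ('a, 'b) ring_scheme" where
  "corner e = R\<lparr>carrier := {x \<in> carrier R. e \<otimes> x = x \<and> x \<otimes> e = x}, one := e\<rparr>"

lemma star_ring_corner:
  assumes "e \<in> carrier R" "e \<otimes> e = e" "star e = e"
  shows "star_ring (corner e) star"
proof -
  have star_c: "star x \<in> carrier (corner e)" if "x \<in> carrier (corner e)" for x
    using that assms star_mult[of e x] star_mult[of x e] by (auto simp: corner_def)
  have inv: "\<ominus> x \<in> carrier (corner e)" if "x \<in> carrier (corner e)" for x
    using that assms by (auto simp: corner_def l_minus r_minus)
  have ring: "ring (corner e)"
  proof (rule ringI)
    show "abelian_group (corner e)"
    proof (rule abelian_groupI)
      fix x assume "x \<in> carrier (corner e)"
      then show "\<exists>y\<in>carrier (corner e). y \<oplus>\<^bsub>corner e\<^esub> x = \<zero>\<^bsub>corner e\<^esub>"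
        using inv[of x] by (intro bexI[of _ "\<ominus> x"]) (auto simp: corner_def l_neg)
    qed (use assms in \<open>auto simp: corner_def l_distr r_distr a_ac\<close>)
    show "monoid (corner e)"
      by (rule monoidI) (use assms in \<open>auto simp: corner_def m_assoc, metis m_assoc\<close>)
  qed (use assms in \<open>auto simp: corner_def l_distr r_distr\<close>)
  have tor: "\<exists>n::nat. odd n \<and> (\<forall>x\<in>carrier (corner e). [n] \<cdot>\<^bsub>corner e\<^esub> x = \<zero>\<^bsub>corner e\<^esub>)"
  proof -
    obtain n :: nat where n: "odd n" "\<forall>x\<in>carrier R. [n] \<cdot> x = \<zero>" using odd_torsion by blast
    have "[k] \<cdot>\<^bsub>corner e\<^esub> x = [k] \<cdot> x" for k :: nat and x
      by (simp add: corner_def add_pow_def nat_pow_def)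
    then show ?thesis using n by (intro exI[of _ n]) (auto simp: corner_def)
  qed
  show ?thesis
    by (intro star_ring.intro ring star_ring_axioms.intro star_c tor)
      (use finite_carrier in \<open>auto simp: corner_def star_add star_mult\<close>)
qed

text \<open>Self-adjoint nilpotents of \<open>e R e\<close>, with powers taken in
  \<open>R\<close>.\<close>

definition nilpotent_in :: "'a \<Rightarrow> 'a set" where
  "nilpotent_in e = {n \<in> carrier R. star n = n \<and> e \<otimes> n = n \<and> n \<otimes> e = n \<and> nilpotent n}"

text \<open>In \<open>e R e\<close> the idempotent \<open>e\<close> is the unit, so the statement
  for a primitive unit applies there.\<close>

lemma minus_primitive_not_sum_of_nilpotents:
  assumes e: "primitive e"
  shows "\<ominus> e \<notin> add_span R (nilpotent_in e)"
proof
  assume *: "\<ominus> e \<in> add_span R (nilpotent_in e)"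
  interpret C: star_ring "corner e" star
    using star_ring_corner primitiveD[OF e] by blast
  have "C.primitive \<one>\<^bsub>corner e\<^esub>"
    using e unfolding C.primitive_def primitive_def by (auto simp: corner_def)
  from C.minus_one_not_sum_of_nilpotents[OF this]
  have "\<ominus>\<^bsub>corner e\<^esub> e \<notin> add_span (corner e)
      {n \<in> carrier (corner e). star n = n \<and> C.nilpotent n}" (is "_ \<notin> add_span _ ?N")
    by (simp add: corner_def)
  moreover have "\<ominus>\<^bsub>corner e\<^esub> e = \<ominus> e"
  proof (rule C.minus_equality)
    show "\<ominus> e \<oplus>\<^bsub>corner e\<^esub> e = \<zero>\<^bsub>corner e\<^esub>"
      using primitiveD[OF e] by (simp add: corner_def l_neg)
  qed (use primitiveD[OF e] in \<open>auto simp: corner_def l_minus r_minus\<close>)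
  \<comment> \<open>The exponent is a successor because the zeroth powers are the two different
    units.\<close>
  moreover have pow: "x [^]\<^bsub>corner e\<^esub> Suc k = x [^] Suc k"
    if "x \<in> carrier R" "e \<otimes> x = x" for k :: nat and x
  proof (induction k)
    case (Suc k)
    then show ?case using C.nat_pow_Suc[of x "Suc k"] by (simp add: corner_def)
  qed (use that in \<open>auto simp: corner_def nat_pow_def\<close>)
  have N: "n \<in> ?N" if n: "n \<in> nilpotent_in e" for n
  proof -
    obtain k :: nat where "n [^] k = \<zero>" using n unfolding nilpotent_in_def nilpotent_def by auto
    then have "n [^] Suc k = \<zero>" using n by (simp add: nilpotent_in_def)
    then have "n [^]\<^bsub>corner e\<^esub> Suc k = \<zero>\<^bsub>corner e\<^esub>"
      using n pow[of n k] by (simp add: nilpotent_in_def corner_def)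
    then have "C.nilpotent n" unfolding C.nilpotent_def by blast
    then show ?thesis using n by (simp add: nilpotent_in_def corner_def)
  qed
  have "x \<in> add_span (corner e) ?N" if "x \<in> add_span R (nilpotent_in e)" for x
    using that
  proof induction
    case zero show ?case using add_span.zero[of "corner e"] by (simp add: corner_def)
  next
    case (add x s)
    then show ?case using add_span.add[OF add.IH N[OF add.hyps(2)]] by (simp add: corner_def)
  qed
  ultimately show False using * by simp
qed

text \<open>The clauses follow those of \<open>star_ideal\<close> one by one, so that the two
  notions can be matched directly for the adjoint ring.\<close>

definition invol_ideal :: "'a set \<Rightarrow> bool" where
  "invol_ideal I \<longleftrightarrow> I \<subseteq> carrier R \<and> \<zero> \<in> I \<and> (\<forall>x \<in> I. \<forall>y \<in> I. x \<oplus> y \<in> I) \<and>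
     (\<forall>x \<in> I. \<ominus> x \<in> I) \<and> (\<forall>x \<in> I. \<forall>a \<in> carrier R. a \<otimes> x \<in> I \<and> x \<otimes> a \<in> I) \<and> star ` I = I"

definition max_invol_ideal :: "'a set \<Rightarrow> bool" where
  "max_invol_ideal I \<longleftrightarrow> invol_ideal I \<and> I \<noteq> carrier R \<and>
     (\<forall>J. invol_ideal J \<and> J \<noteq> carrier R \<and> I \<subseteq> J \<longrightarrow> J = I)"

lemma invol_idealI:
  assumes "I \<subseteq> carrier R" "\<zero> \<in> I" "\<And>x y. x \<in> I \<Longrightarrow> y \<in> I \<Longrightarrow> x \<oplus> y \<in> I"
    "\<And>x. x \<in> I \<Longrightarrow> \<ominus> x \<in> I"
    "\<And>x a. x \<in> I \<Longrightarrow> a \<in> carrier R \<Longrightarrow> a \<otimes> x \<in> I"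
    "\<And>x a. x \<in> I \<Longrightarrow> a \<in> carrier R \<Longrightarrow> x \<otimes> a \<in> I"
    "\<And>x. x \<in> I \<Longrightarrow> star x \<in> I"
  shows "invol_ideal I"
proof -
  have "x \<in> star ` I" if "x \<in> I" for x
    using assms(1) assms(7)[OF that] star_star[of x] that by (metis image_eqI subsetD)
  then have "I \<subseteq> star ` I" by blast
  moreover have "star ` I \<subseteq> I" using assms(7) by blast
  ultimately have "star ` I = I" by (rule antisym[rotated])
  then show ?thesis unfolding invol_ideal_def using assms(1-6) by simp
qed

lemma invol_idealD:
  assumes "invol_ideal I"
  shows "x \<in> I \<Longrightarrow> x \<in> carrier R" "\<zero> \<in> I" "x \<in> I \<Longrightarrow> y \<in> I \<Longrightarrow> x \<oplus> y \<in> I"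
    "x \<in> I \<Longrightarrow> \<ominus> x \<in> I" "x \<in> I \<Longrightarrow> a \<in> carrier R \<Longrightarrow> a \<otimes> x \<in> I"
    "x \<in> I \<Longrightarrow> a \<in> carrier R \<Longrightarrow> x \<otimes> a \<in> I" "x \<in> I \<Longrightarrow> star x \<in> I"
  using assms unfolding invol_ideal_def by auto

lemma invol_ideal_carrier: "invol_ideal (carrier R)"
  by (rule invol_idealI) auto

lemma invol_ideal_pow:
  assumes "invol_ideal I" "x \<in> I" "(m::nat) > 0" shows "x [^] m \<in> I"
proof -
  obtain k where "m = Suc k" using assms(3) gr0_implies_Suc by blast
  then show ?thesis using invol_idealD[OF assms(1)] assms(2) by simp
qed

lemma invol_ideal_sum:
  assumes "invol_ideal I" "invol_ideal J"
  shows "invol_ideal (I <+>\<^bsub>R\<^esub> J)"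
proof -
  note I = invol_idealD[OF assms(1)] and J = invol_idealD[OF assms(2)]
  have mem: "x \<in> I <+>\<^bsub>R\<^esub> J \<longleftrightarrow> (\<exists>i\<in>I. \<exists>j\<in>J. x = i \<oplus> j)" for x
    by (auto simp: set_add_def set_mult_def)
  show ?thesis
  proof (rule invol_idealI)
    show "I <+>\<^bsub>R\<^esub> J \<subseteq> carrier R" using I(1) J(1) by (auto simp: mem)
    show "\<zero> \<in> I <+>\<^bsub>R\<^esub> J" unfolding mem using I(2) J(2) by force
  next
    fix x y assume "x \<in> I <+>\<^bsub>R\<^esub> J" "y \<in> I <+>\<^bsub>R\<^esub> J"
    then obtain i j i' j' where *: "i \<in> I" "j \<in> J" "x = i \<oplus> j" "i' \<in> I" "j' \<in> J" "y = i' \<oplus> j'"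
      unfolding mem by blast
    have "x \<oplus> y = (i \<oplus> i') \<oplus> (j \<oplus> j')" using * I(1) J(1) by (simp add: a_ac)
    then show "x \<oplus> y \<in> I <+>\<^bsub>R\<^esub> J" unfolding mem using * I(3) J(3) by blast
  next
    fix x assume "x \<in> I <+>\<^bsub>R\<^esub> J"
    then obtain i j where *: "i \<in> I" "j \<in> J" "x = i \<oplus> j" unfolding mem by blast
    note ij = *(1,2) I(1)[OF *(1)] J(1)[OF *(2)]
    have "\<ominus> x = \<ominus> i \<oplus> \<ominus> j" using * ij by (simp add: minus_add)
    then show "\<ominus> x \<in> I <+>\<^bsub>R\<^esub> J" unfolding mem using ij I(4) J(4) by blast
    have "star x = star i \<oplus> star j" using * ij by (simp add: star_add)
    then show "star x \<in> I <+>\<^bsub>R\<^esub> J" unfolding mem using ij I(7) J(7) by blast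
    fix a assume a: "a \<in> carrier R"
    have "a \<otimes> x = a \<otimes> i \<oplus> a \<otimes> j" using * ij a by (simp add: r_distr)
    then show "a \<otimes> x \<in> I <+>\<^bsub>R\<^esub> J" unfolding mem using ij I(5)[OF _ a] J(5)[OF _ a] by blast
    have "x \<otimes> a = i \<otimes> a \<oplus> j \<otimes> a" using * ij a by (simp add: l_distr)
    then show "x \<otimes> a \<in> I <+>\<^bsub>R\<^esub> J" unfolding mem using ij I(6)[OF _ a] J(6)[OF _ a] by blast
  qed
qed

lemma subset_ideal_sum:
  assumes "invol_ideal I" "invol_ideal J"
  shows "I \<subseteq> I <+>\<^bsub>R\<^esub> J" "J \<subseteq> I <+>\<^bsub>R\<^esub> J"
proof -
  note I = invol_idealD[OF assms(1)] and J = invol_idealD[OF assms(2)]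
  have mem: "x \<in> I <+>\<^bsub>R\<^esub> J \<longleftrightarrow> (\<exists>i\<in>I. \<exists>j\<in>J. x = i \<oplus> j)" for x
    by (auto simp: set_add_def set_mult_def)
  have "x = x \<oplus> \<zero>" "x = \<zero> \<oplus> x" if "x \<in> carrier R" for x using that by auto
  then show "I \<subseteq> I <+>\<^bsub>R\<^esub> J" "J \<subseteq> I <+>\<^bsub>R\<^esub> J"
    unfolding subset_iff mem using I(1,2) J(1,2) by metis+
qed

section \<open>Principal *-ideals and polarisation\<close>

definition principal :: "'a \<Rightarrow> 'a set" where
  "principal f = add_span R {a \<otimes> f \<otimes> b | a b. a \<in> carrier R \<and> b \<in> carrier R}"

text \<open>\<open>R f R\<close> is stable under the involution because
  \<open>star (a f b) = star b f star a\<close> for self-adjoint \<open>f\<close>.\<close>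

lemma principal_ideal:
  assumes f: "f \<in> carrier R" "star f = f"
  shows "invol_ideal (principal f)" "f \<in> principal f"
proof -
  define S where "S = {a \<otimes> f \<otimes> b | a b. a \<in> carrier R \<and> b \<in> carrier R}"
  have pS: "principal f = add_span R S" by (simp add: principal_def S_def)
  have S: "S \<subseteq> carrier R" using f by (auto simp: S_def)
  have SI: "a \<otimes> f \<otimes> b \<in> S" if "a \<in> carrier R" "b \<in> carrier R" for a b
    using that by (auto simp: S_def)
  show "f \<in> principal f" unfolding pS using add_span_mem[OF S SI[OF one_closed one_closed]] f by simp
  \<comment> \<open>An additive map that permutes or moves generators among themselves preserves
    their span. It is used for the involution, both multiplications and negation.\<close>
  have hom: "h x \<in> add_span R S"
    if "x \<in> add_span R S" "h \<zero> = \<zero>" "\<And>x y. x \<in> carrier R \<Longrightarrow> y \<in> carrier R \<Longrightarrow> h (x \<oplus> y) = h x \<oplus> h y"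
       "\<And>s. s \<in> S \<Longrightarrow> h s \<in> S" for x h
    using that(1)
  proof induction
    case zero then show ?case using that(2) by (simp add: add_span.zero)
  next
    case (add x s)
    then have "x \<in> carrier R" "s \<in> carrier R" using add_span_closed S by auto
    then show ?case using that(3,4) add add_span.add by metis
  qed
  show "invol_ideal (principal f)"
    unfolding pS
  proof (rule invol_idealI)
    show "add_span R S \<subseteq> carrier R" using add_span_closed S by auto
    show "\<zero> \<in> add_span R S" by (rule add_span.zero)
    show "x \<oplus> y \<in> add_span R S" if "x \<in> add_span R S" "y \<in> add_span R S" for x y
      using add_span_add S that by simp
    show "star x \<in> add_span R S" if "x \<in> add_span R S" for x
    proof (rule hom[OF that])
      fix s assume "s \<in> S"
      then obtain a b where ab: "a \<in> carrier R" "b \<in> carrier R" "s = a \<otimes> f \<otimes> b" by (auto simp: S_def)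
      then have "star s = star b \<otimes> f \<otimes> star a" using f by (simp add: star_mult m_assoc)
      then show "star s \<in> S" using SI ab by simp
    qed (auto simp: star_add)
    fix x a assume x: "x \<in> add_span R S" and a: "a \<in> carrier R"
    show "a \<otimes> x \<in> add_span R S"
    proof (rule hom[OF x])
      fix s assume "s \<in> S"
      then obtain c d where cd: "c \<in> carrier R" "d \<in> carrier R" "s = c \<otimes> f \<otimes> d" by (auto simp: S_def)
      then have "a \<otimes> s = (a \<otimes> c) \<otimes> f \<otimes> d" using f a by (simp add: m_assoc)
      then show "a \<otimes> s \<in> S" using SI cd a by simp
    qed (use a in \<open>auto simp: r_distr\<close>)
    show "x \<otimes> a \<in> add_span R S"
    proof (rule hom[OF x])
      fix s assume "s \<in> S"
      then obtain c d where cd: "c \<in> carrier R" "d \<in> carrier R" "s = c \<otimes> f \<otimes> d" by (auto simp: S_def)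
      then have "s \<otimes> a = c \<otimes> f \<otimes> (d \<otimes> a)" using f a by (simp add: m_assoc)
      then show "s \<otimes> a \<in> S" using SI cd a by simp
    qed (use a in \<open>auto simp: l_distr\<close>)
  next
    fix x assume x: "x \<in> add_span R S"
    show "\<ominus> x \<in> add_span R S"
    proof (rule hom[OF x])
      fix s assume "s \<in> S"
      then obtain c d where cd: "c \<in> carrier R" "d \<in> carrier R" "s = c \<otimes> f \<otimes> d" by (auto simp: S_def)
      then have "\<ominus> s = (\<ominus> c) \<otimes> f \<otimes> d" using f by (simp add: l_minus)
      then show "\<ominus> s \<in> S" using SI cd by simp
    qed (auto simp: minus_add)
  qed
qed

text \<open>Polarisation: if all \<open>x x\<^sup>*\<close> with \<open>x \<in> eRf\<close> were nilpotent, then \<open>2e\<close>, being a sum of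
  terms \<open>x y\<^sup>* + y x\<^sup>* = (x + y)(x + y)\<^sup>* - x x\<^sup>* - y y\<^sup>*\<close>, would be a sum of self-adjoint nilpotents
  of \<open>eRe\<close>.\<close>
lemma ex_non_nilpotent_norm:
  assumes e: "primitive e" and f: "primitive f" and ef: "e \<in> principal f"
  obtains x where "x \<in> carrier R" "e \<otimes> x = x" "x \<otimes> f = x" "\<not> nilpotent (x \<otimes> star x)"
proof (rule ccontr)
  note witness = that
  assume "\<not> thesis"
  then have nil: "nilpotent (x \<otimes> star x)" if "x \<in> carrier R" "e \<otimes> x = x" "x \<otimes> f = x" for x
    using that witness by blast
  define N where "N = nilpotent_in e"
  have N: "N \<subseteq> carrier R" by (auto simp: N_def nilpotent_in_def)
  note eD = primitiveD[OF e] and fD = primitiveD[OF f]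
  have norm: "x \<otimes> star x \<in> N" if x: "x \<in> carrier R" "e \<otimes> x = x" "x \<otimes> f = x" for x
  proof -
    have "star x \<otimes> e = star x" using star_mult[of e x] x eD by simp
    moreover have "e \<otimes> (x \<otimes> star x) = (e \<otimes> x) \<otimes> star x" using x(1) eD by (simp add: m_assoc)
    ultimately show ?thesis using x nil[OF x] eD by (simp add: N_def nilpotent_in_def star_mult m_assoc)
  qed
  have Nneg: "\<ominus> n \<in> N" if "n \<in> N" for n
  proof -
    have "nilpotent n" using that by (simp add: N_def nilpotent_in_def)
    then obtain k :: nat where k: "n [^] k = \<zero>" unfolding nilpotent_def by blast
    have n: "n \<in> carrier R" using that N by auto
    have "\<ominus> n = \<ominus> \<one> \<otimes> n" "\<ominus> \<one> \<otimes> n = n \<otimes> \<ominus> \<one>" using n by (simp_all add: l_minus r_minus)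
    then have "(\<ominus> n) [^] k = \<zero>" using pow_mult_distrib[of "\<ominus> \<one>" n k] k n by simp
    then have "nilpotent (\<ominus> n)" unfolding nilpotent_def by blast
    then show ?thesis using that eD by (auto simp: N_def nilpotent_in_def star_minus l_minus r_minus)
  qed
  have polar: "x \<otimes> star y \<oplus> y \<otimes> star x \<in> add_span R N"
    if x: "x \<in> carrier R" "e \<otimes> x = x" "x \<otimes> f = x" and y: "y \<in> carrier R" "e \<otimes> y = y" "y \<otimes> f = y" for x y
  proof -
    have xy: "x \<oplus> y \<in> carrier R" "e \<otimes> (x \<oplus> y) = x \<oplus> y" "(x \<oplus> y) \<otimes> f = x \<oplus> y"
      using x y eD fD by (simp_all add: l_distr r_distr)
    have "(x \<oplus> y) \<otimes> star (x \<oplus> y) \<oplus> (\<ominus> (x \<otimes> star x) \<oplus> \<ominus> (y \<otimes> star y))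
        = (x \<otimes> star x \<oplus> \<ominus> (x \<otimes> star x)) \<oplus> (y \<otimes> star y \<oplus> \<ominus> (y \<otimes> star y))
          \<oplus> (x \<otimes> star y \<oplus> y \<otimes> star x)"
      using x(1) y(1) by (simp add: star_add l_distr r_distr a_ac)
    also have "\<dots> = x \<otimes> star y \<oplus> y \<otimes> star x" using x(1) y(1) by (simp add: r_neg)
    finally show ?thesis
      using add_span_add[OF N add_span_mem[OF N norm[OF xy]]
          add_span_add[OF N add_span_mem[OF N Nneg[OF norm[OF x]]] add_span_mem[OF N Nneg[OF norm[OF y]]]]]
      by simp
  qed
  \<comment> \<open>Symmetrising \<open>e s e\<close> makes each term \<open>a f b\<close> of
    \<open>s\<close> contribute \<open>x star y + y star x\<close> with \<open>x = e a f\<close> and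
    \<open>y = e (star b) f\<close>; at \<open>s = e\<close> the value is
    \<open>e + e\<close>.\<close>
  have "s \<in> carrier R \<and> e \<otimes> s \<otimes> e \<oplus> star (e \<otimes> s \<otimes> e) \<in> add_span R N" if "s \<in> principal f" for s
    using that unfolding principal_def
  proof induction
    case zero then show ?case using eD by (simp add: add_span.zero)
  next
    case (add s t)
    then obtain a b where ab: "a \<in> carrier R" "b \<in> carrier R" "t = a \<otimes> f \<otimes> b" by blast
    have s: "s \<in> carrier R" using add.IH by simp
    define x where "x = e \<otimes> a \<otimes> f"
    define y where "y = e \<otimes> star b \<otimes> f"
    have x: "x \<in> carrier R" "e \<otimes> x = x" "x \<otimes> f = x"
      using eD fD ab unfolding x_def by (simp_all add: m_assoc[symmetric]) (simp add: m_assoc)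
    have y: "y \<in> carrier R" "e \<otimes> y = y" "y \<otimes> f = y"
      using eD fD ab unfolding y_def by (simp_all add: m_assoc[symmetric]) (simp add: m_assoc)
    have xy: "e \<otimes> t \<otimes> e = x \<otimes> star y"
    proof -
      have "x \<otimes> star y = e \<otimes> a \<otimes> (f \<otimes> f) \<otimes> b \<otimes> e"
        using eD(1,3) fD(1,3) ab(1,2) by (simp add: x_def y_def star_mult m_assoc)
      then show ?thesis using eD(1) fD(1,2) ab by (simp add: m_assoc)
    qed
    have t: "t \<in> carrier R" using ab fD by simp
    have yx: "star (e \<otimes> t \<otimes> e) = y \<otimes> star x" unfolding xy using x y by (simp add: star_mult)
    have "e \<otimes> (s \<oplus> t) \<otimes> e \<oplus> star (e \<otimes> (s \<oplus> t) \<otimes> e)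
        = (e \<otimes> s \<otimes> e \<oplus> star (e \<otimes> s \<otimes> e)) \<oplus> (e \<otimes> t \<otimes> e \<oplus> star (e \<otimes> t \<otimes> e))"
      using eD(1) s t by (simp add: l_distr r_distr star_add a_ac)
    then show ?case unfolding yx unfolding xy
      using s t add_span_add[OF N conjunct2[OF add.IH] polar[OF x y]] by simp
  qed
  from this[OF ef] have "e \<oplus> e \<in> add_span R N" using eD by simp
  then have "\<ominus> e \<in> add_span R N" using minus_in_add_span_if_double N eD by simp
  then show False using minus_primitive_not_sum_of_nilpotents[OF e] N_def by simp
qed

text \<open>A partial isometry from \<open>e\<close> to \<open>f\<close> up to powers. Exact
  equality with \<open>x star x\<close> would ask for norms in the right square class; a positive
  power suffices for ideal membership and for cancelling \<open>x\<close>.\<close>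

definition linked :: "'a \<Rightarrow> 'a \<Rightarrow> 'a \<Rightarrow> bool" where
  "linked x e f \<longleftrightarrow> x \<in> carrier R \<and> e \<otimes> x = x \<and> x \<otimes> f = x \<and>
     (\<exists>m::nat. m > 0 \<and> (x \<otimes> star x) [^] m = e) \<and> (\<exists>m::nat. m > 0 \<and> (star x \<otimes> x) [^] m = f)"

lemma pow_Suc_rotate:
  assumes "x \<in> carrier R" "y \<in> carrier R"
  shows "(x \<otimes> y) [^] Suc k = x \<otimes> (y \<otimes> x) [^] k \<otimes> y"
proof (induction k)
  case (Suc k)
  have "(x \<otimes> y) [^] Suc (Suc k) = (x \<otimes> (y \<otimes> x) [^] k \<otimes> y) \<otimes> (x \<otimes> y)"
    using Suc nat_pow_Suc[of "x \<otimes> y" "Suc k"] by simp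
  also have "\<dots> = x \<otimes> ((y \<otimes> x) [^] k \<otimes> (y \<otimes> x)) \<otimes> y" using assms by (simp add: m_assoc)
  finally show ?case by simp
qed (use assms in simp)

text \<open>Polarisation makes \<open>x star x\<close> non-nilpotent, so a power of it is
  \<open>e\<close>. Nilpotency passes between \<open>x star x\<close> and \<open>star x x\<close>,
  so a power of the latter is \<open>f\<close>.\<close>

lemma ex_linked:
  assumes e: "primitive e" and f: "primitive f" and "e \<in> principal f"
  obtains x where "linked x e f"
proof -
  obtain x where x: "x \<in> carrier R" "e \<otimes> x = x" "x \<otimes> f = x" "\<not> nilpotent (x \<otimes> star x)"
    using ex_non_nilpotent_norm[OF assms] .
  note eD = primitiveD[OF e] and fD = primitiveD[OF f]
  have sx: "star x \<otimes> e = star x" "f \<otimes> star x = star x"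
    using star_mult[of e x] star_mult[of x f] x eD fD by auto
  obtain m :: nat where m: "m > 0" "(x \<otimes> star x) [^] m = e"
  proof (rule nilpotent_or_power[OF e _ _ _ _ x(4)])
    show "e \<otimes> (x \<otimes> star x) = x \<otimes> star x" using x eD by (simp add: m_assoc[symmetric])
    show "x \<otimes> star x \<otimes> e = x \<otimes> star x" using x eD sx by (simp add: m_assoc)
  qed (use x star_mult in auto)
  have "\<not> nilpotent (star x \<otimes> x)"
  proof
    assume "nilpotent (star x \<otimes> x)"
    then obtain k :: nat where "(star x \<otimes> x) [^] k = \<zero>" unfolding nilpotent_def by auto
    then have "(x \<otimes> star x) [^] Suc k = \<zero>"
      using pow_Suc_rotate[OF x(1) star_closed[OF x(1)], of k] x(1) by simp
    then show False using x(4) unfolding nilpotent_def by blast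
  qed
  then obtain k :: nat where k: "k > 0" "(star x \<otimes> x) [^] k = f"
  proof (rule nilpotent_or_power[OF f, rotated 4])
    show "f \<otimes> (star x \<otimes> x) = star x \<otimes> x" using x fD sx by (simp add: m_assoc[symmetric])
    show "star x \<otimes> x \<otimes> f = star x \<otimes> x" using x fD by (simp add: m_assoc)
  qed (use x star_mult in auto)
  show thesis using that[of x] x m k unfolding linked_def by blast
qed

lemma linked_star:
  assumes "linked x e f" "star e = e" "star f = f" "e \<in> carrier R" "f \<in> carrier R"
  shows "linked (star x) f e"
  using assms star_mult[of e x] star_mult[of x f] unfolding linked_def by auto

text \<open>From \<open>e\<close> in \<open>I\<close> follows \<open>x = e x\<close> in
  \<open>I\<close>, and \<open>f\<close> is a positive power of \<open>star x x\<close>.\<close>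

lemma linked_mem:
  assumes "linked x e f" "invol_ideal I" "e \<in> I"
  shows "f \<in> I"
proof -
  obtain k :: nat where x: "x \<in> carrier R" "e \<otimes> x = x" "k > 0" "(star x \<otimes> x) [^] k = f"
    using assms(1) unfolding linked_def by blast
  have "x \<in> I" using invol_idealD(6)[OF assms(2,3) x(1)] x(2) by simp
  then have "star x \<otimes> x \<in> I" using invol_idealD(5)[OF assms(2)] x(1) by simp
  from invol_ideal_pow[OF assms(2) this x(3)] show ?thesis using x(4) by simp
qed

text \<open>The one-sided Peirce component \<open>e I\<close>, described by fixed points of left
  multiplication by an idempotent \<open>e\<close>.\<close>

definition peirce :: "'a \<Rightarrow> 'a set \<Rightarrow> 'a set" where
  "peirce e I = {y \<in> I. e \<otimes> y = y}"

text \<open>Left multiplication by \<open>x\<close> sends \<open>f I\<close> into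
  \<open>e I\<close>, and it is injective there because \<open>f\<close> is a left multiple of
  \<open>x\<close>.\<close>

lemma linked_card_le:
  assumes "linked x e f" "invol_ideal I" "e \<in> carrier R"
  shows "card (peirce f I) \<le> card (peirce e I)"
proof (rule card_inj_on_le)
  note I = invol_idealD[OF assms(2)]
  obtain k :: nat where x: "x \<in> carrier R" "e \<otimes> x = x" "k > 0" "(star x \<otimes> x) [^] k = f"
    using assms(1) unfolding linked_def by blast
  \<comment> \<open>Splitting off the last factor of the positive power exhibits
    \<open>(star x x)^j star x\<close> as a left inverse of \<open>x\<close> on
    \<open>f I\<close>.\<close>
  then obtain j :: nat where j: "f = (star x \<otimes> x) [^] j \<otimes> star x \<otimes> x"
    by (metis gr0_implies_Suc m_assoc nat_pow_Suc nat_pow_closed star_closed m_closed)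
  show "finite (peirce e I)"
    using finite_carrier I(1) by (auto simp: peirce_def intro: finite_subset[of _ "carrier R"])
  show "(\<lambda>y. x \<otimes> y) ` peirce f I \<subseteq> peirce e I"
    using x I(1,5) assms(3) by (auto simp: peirce_def m_assoc[symmetric])
  show "inj_on (\<lambda>y. x \<otimes> y) (peirce f I)"
  proof (rule inj_onI)
    fix y z assume y: "y \<in> peirce f I" and z: "z \<in> peirce f I" and eq: "x \<otimes> y = x \<otimes> z"
    have *: "u = (star x \<otimes> x) [^] j \<otimes> star x \<otimes> (x \<otimes> u)" if "u \<in> peirce f I" for u
    proof -
      have "u = (star x \<otimes> x) [^] j \<otimes> star x \<otimes> x \<otimes> u" using that j by (simp add: peirce_def)
      also have "\<dots> = (star x \<otimes> x) [^] j \<otimes> star x \<otimes> (x \<otimes> u)"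
        using that I(1) x(1) by (simp add: peirce_def m_assoc)
      finally show ?thesis .
    qed
    show "y = z" using *[OF y] *[OF z] eq by simp
  qed
qed

text \<open>A primeness property. Compressing to \<open>e R e\<close> gives \<open>e = s + t\<close>
  with \<open>s\<close> in \<open>I\<close> and \<open>t\<close> in \<open>J\<close>. As
  \<open>s\<close> need not be self-adjoint, expand \<open>e = e star e\<close> and use
  \<open>p = s star s\<close>, so that \<open>e\<close> is congruent to \<open>p\<close> modulo
  \<open>J\<close>, hence to every positive power of \<open>p\<close>. Such a power can be taken to
  be \<open>0\<close> or \<open>e\<close>.\<close>

lemma primitive_mem_sum:
  assumes e: "primitive e" and I: "invol_ideal I" and J: "invol_ideal J" and "e \<in> I <+>\<^bsub>R\<^esub> J"
  shows "e \<in> I \<or> e \<in> J"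
proof -
  note eD = primitiveD[OF e] and I = I invol_idealD[OF I] and J = J invol_idealD[OF J]
  obtain i j where ij: "i \<in> I" "j \<in> J" "e = i \<oplus> j"
    using assms(4) by (auto simp: set_add_def set_mult_def)
  define s where "s = e \<otimes> i \<otimes> e"
  define t where "t = e \<otimes> j \<otimes> e"
  have s: "s \<in> I" "s \<in> carrier R" "e \<otimes> s = s" using ij I eD by (auto simp: s_def m_assoc[symmetric])
  have t: "t \<in> J" "t \<in> carrier R" using ij J eD by (auto simp: t_def)
  have st: "e = s \<oplus> t"
  proof -
    have "s \<oplus> t = e \<otimes> (i \<oplus> j) \<otimes> e" using ij(1,2) I(2) J(2) eD(1) by (simp add: s_def t_def l_distr r_distr)
    also have "\<dots> = e" using eD unfolding ij(3)[symmetric] by simp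
    finally show ?thesis ..
  qed
  define p where "p = s \<otimes> star s"
  have se: "star s \<otimes> e = star s" using star_mult[of e s] s eD by simp
  have p: "p \<in> I" "p \<in> carrier R" "star p = p" "e \<otimes> p = p" "p \<otimes> e = p"
    using s se I eD by (auto simp: p_def star_mult m_assoc) (auto simp: m_assoc[symmetric])
  define r where "r = s \<otimes> star t \<oplus> (t \<otimes> star s \<oplus> t \<otimes> star t)"
  have r: "r \<in> J" "r \<in> carrier R" using s t J by (auto simp: r_def)
  have pr: "e = p \<oplus> r"
  proof -
    have "e = e \<otimes> star e" using eD by simp
    also have "\<dots> = (s \<oplus> t) \<otimes> star (s \<oplus> t)" using st by simp
    also have "\<dots> = p \<oplus> r" using s t by (simp add: p_def r_def star_add l_distr r_distr a_ac)
    finally show ?thesis .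
  qed
  have "\<exists>r' \<in> J. e = p [^] Suc k \<oplus> r'" for k :: nat
  proof (induction k)
    case 0 show ?case using pr r p by auto
  next
    case (Suc k)
    then obtain r' where r': "r' \<in> J" "e = p [^] Suc k \<oplus> r'" by blast
    \<comment> \<open>Multiplying \<open>e = p + r\<close> by the current power of \<open>p\<close>
      raises the exponent at the cost of another element of \<open>J\<close>.\<close>
    have "p [^] Suc k = p [^] Suc k \<otimes> e" using p eD by (simp add: m_assoc)
    also have "\<dots> = p [^] Suc k \<otimes> (p \<oplus> r)" using pr by simp
    also have "\<dots> = p [^] Suc (Suc k) \<oplus> p [^] Suc k \<otimes> r"
      using r_distr[OF p(2) r(2) nat_pow_closed[OF p(2), of "Suc k"]]
        nat_pow_Suc[of p "Suc k"] by argo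
    finally have "p [^] Suc k = p [^] Suc (Suc k) \<oplus> p [^] Suc k \<otimes> r" .
    with r'(2) have "e = p [^] Suc (Suc k) \<oplus> p [^] Suc k \<otimes> r \<oplus> r'" by argo
    then have "e = p [^] Suc (Suc k) \<oplus> (p [^] Suc k \<otimes> r \<oplus> r')"
      using a_assoc[OF nat_pow_closed[OF p(2)] m_closed[OF nat_pow_closed[OF p(2)] r(2)] J(2)[OF r'(1)]]
      by metis
    moreover have "p [^] Suc k \<otimes> r \<oplus> r' \<in> J" using r r' p J by auto
    ultimately show ?case by blast
  qed
  note * = this
  show ?thesis
  proof (cases "nilpotent p")
    case True
    then obtain k :: nat where "p [^] k = \<zero>" unfolding nilpotent_def by auto
    then have "p [^] Suc k = \<zero>" using p by simp
    then show ?thesis using *[of k] J(2) by auto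
  next
    case False
    then obtain m :: nat where "m > 0" "p [^] m = e" using nilpotent_or_power[OF e p(2-5)] by blast
    then show ?thesis using invol_ideal_pow[OF I(1) p(1)] by metis
  qed
qed

section \<open>Frames\<close>

definition frame :: "'a set \<Rightarrow> bool" where
  "frame E \<longleftrightarrow> finite E \<and> (\<forall>e \<in> E. primitive e) \<and>
     (\<forall>e \<in> E. \<forall>f \<in> E. e \<noteq> f \<longrightarrow> e \<otimes> f = \<zero>) \<and> (\<Oplus>e\<in>E. e) = \<one>"

lemma invol_ideal_one:
  assumes "invol_ideal I" "\<one> \<in> I" shows "I = carrier R"
  using invol_idealD(1)[OF assms(1)] invol_idealD(5)[OF assms] by force

lemma invol_ideal_finsum:
  assumes I: "invol_ideal I" and "finite E" "\<And>e. e \<in> E \<Longrightarrow> g e \<in> I"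
  shows "(\<Oplus>e\<in>E. g e) \<in> I"
  using assms(2,3)
proof (induction E rule: finite_induct)
  case (insert e E)
  then have "g \<in> E \<rightarrow> carrier R" "g e \<in> carrier R" using invol_idealD(1)[OF I] by auto
  then show ?case using insert invol_idealD(3)[OF I] by simp
qed (simp add: invol_idealD(2)[OF I])

lemma frame_not_subset_ideal:
  assumes "frame E" "invol_ideal I" "I \<noteq> carrier R"
  obtains e where "e \<in> E" "e \<notin> I"
proof -
  have "(\<Oplus>e\<in>E. e) \<in> I" if "E \<subseteq> I"
    using that assms(1) invol_ideal_finsum[OF assms(2), of E "\<lambda>e. e"] by (auto simp: frame_def)
  then show thesis using that assms invol_ideal_one[OF assms(2)] unfolding frame_def by auto
qed

lemma finite_ideals: "finite {I. invol_ideal I}"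
  by (rule finite_subset[of _ "Pow (carrier R)"]) (use finite_carrier in \<open>auto simp: invol_ideal_def\<close>)

text \<open>As \<open>f\<close> is not in the maximal \<open>I\<close>, the sum of \<open>I\<close>
  and \<open>R f R\<close> is the whole ring; primeness of \<open>e\<close> then puts
  \<open>e\<close> into \<open>R f R\<close>.\<close>

lemma primitive_mem_principal:
  assumes I: "max_invol_ideal I" and e: "primitive e" "e \<notin> I" and f: "primitive f" "f \<notin> I"
  shows "e \<in> principal f"
proof -
  have iI: "invol_ideal I" using I by (simp add: max_invol_ideal_def)
  note p = principal_ideal[OF primitiveD(1,3)[OF f(1)]]
  note sub = subset_ideal_sum[OF iI p(1)]
  have "I <+>\<^bsub>R\<^esub> principal f = carrier R"
    using I invol_ideal_sum[OF iI p(1)] sub p(2) f(2) unfolding max_invol_ideal_def by (metis subsetD)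
  then show ?thesis using primitive_mem_sum[OF e(1) iI p(1)] e primitiveD(1)[OF e(1)] by simp
qed

text \<open>Two distinct maximal *-ideals add up to the ring, so by primeness one of them contains
  \<open>e\<close>.\<close>

lemma max_invol_ideal_unique:
  assumes I: "max_invol_ideal I" and J: "max_invol_ideal J" and e: "primitive e" "e \<notin> I" "e \<notin> J"
  shows "I = J"
proof (rule ccontr)
  assume neq: "I \<noteq> J"
  have iI: "invol_ideal I" and iJ: "invol_ideal J" using I J by (simp_all add: max_invol_ideal_def)
  note sub = subset_ideal_sum[OF iI iJ]
  have "I <+>\<^bsub>R\<^esub> J = carrier R"
    using I J neq invol_ideal_sum[OF iI iJ] sub unfolding max_invol_ideal_def by metis
  then show False using primitive_mem_sum[OF e(1) iI iJ] e primitiveD(1)[OF e(1)] by simp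
qed

text \<open>A *-ideal maximal among those missing \<open>e\<close> is maximal: a larger proper one \<open>N\<close> contains \<open>e\<close>
  and misses some \<open>f\<close> in the frame, so \<open>e \<in> RfR\<close>, whence \<open>f \<in> ReR \<subseteq> N\<close>.\<close>
lemma ex_max_invol_ideal:
  assumes E: "frame E" and "e \<in> E"
  obtains I where "max_invol_ideal I" "e \<notin> I"
proof -
  have e: "primitive e" using assms by (auto simp: frame_def)
  let ?S = "{I. invol_ideal I \<and> e \<notin> I}"
  have "finite ?S" using finite_ideals by (rule rev_finite_subset) auto
  moreover have "{\<zero>} \<in> ?S" using primitiveD(4)[OF e] by (auto intro!: invol_idealI)
  ultimately obtain M where M: "invol_ideal M" "e \<notin> M" "\<And>N. invol_ideal N \<Longrightarrow> e \<notin> N \<Longrightarrow> M \<subseteq> N \<Longrightarrow> M = N"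
    using finite_has_maximal[of ?S] by blast
  have "N = M" if N: "invol_ideal N" "N \<noteq> carrier R" "M \<subseteq> N" for N
  proof (rule ccontr)
    assume "N \<noteq> M"
    then have eN: "e \<in> N" using M N by blast
    obtain f where f: "f \<in> E" "f \<notin> N" using frame_not_subset_ideal[OF E N(1,2)] .
    have pf: "primitive f" using E f by (auto simp: frame_def)
    note p = principal_ideal[OF primitiveD(1,3)[OF pf]]
    note sub = subset_ideal_sum[OF M(1) p(1)]
    \<comment> \<open>The sum contains \<open>f\<close>, which is not in \<open>N\<close> and hence
      not in \<open>M\<close>; so it is strictly larger than \<open>M\<close> and cannot miss
      \<open>e\<close>.\<close>
    have "e \<in> M <+>\<^bsub>R\<^esub> principal f"
      using M(3)[OF invol_ideal_sum[OF M(1) p(1)]] sub p(2) f(2) N(3) by blast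
    then have "e \<in> principal f" using primitive_mem_sum[OF e M(1) p(1)] M(2) by blast
    then obtain x where "linked x e f" using ex_linked[OF e pf] by blast
    then show False using linked_mem N(1) eN f(2) by blast
  qed
  then have "max_invol_ideal M"
    using M primitiveD(1)[OF e] unfolding max_invol_ideal_def by blast
  then show thesis using that M(2) by blast
qed

text \<open>Because the frame sums to \<open>1\<close>, an element of \<open>I\<close> is the sum of
  its components \<open>e r\<close>; orthogonality lets these be prescribed independently.\<close>

lemma card_ideal_eq_prod_peirce:
  assumes E: "frame E" and I: "invol_ideal I"
  shows "card I = (\<Prod>e\<in>E. card (peirce e I))"
proof -
  note ID = invol_idealD[OF I]
  have fin: "finite E" and prim: "\<And>e. e \<in> E \<Longrightarrow> primitive e"
    and orth: "\<And>e f. e \<in> E \<Longrightarrow> f \<in> E \<Longrightarrow> e \<noteq> f \<Longrightarrow> e \<otimes> f = \<zero>" and one: "(\<Oplus>e\<in>E. e) = \<one>"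
    using E by (auto simp: frame_def)
  have Ec: "e \<in> carrier R" "e \<otimes> e = e" if "e \<in> E" for e using primitiveD[OF prim[OF that]] by auto
  have "bij_betw (\<lambda>r. \<lambda>e\<in>E. e \<otimes> r) I (PiE E (\<lambda>e. peirce e I))"
    unfolding bij_betw_def
  proof (intro conjI inj_onI subset_antisym)
    have dec: "(\<Oplus>e\<in>E. e \<otimes> r) = r" if "r \<in> I" for r
      using finsum_ldistr[OF fin ID(1)[OF that], of "\<lambda>e. e"] Ec one ID(1)[OF that] by auto
    fix r s assume rs: "r \<in> I" "s \<in> I" "(\<lambda>e\<in>E. e \<otimes> r) = (\<lambda>e\<in>E. e \<otimes> s)"
    have "(\<Oplus>e\<in>E. e \<otimes> r) = (\<Oplus>e\<in>E. e \<otimes> s)"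
    proof (rule finsum_cong')
      fix e assume "e \<in> E"
      then show "e \<otimes> r = e \<otimes> s" using rs(3) by (metis restrict_apply')
    qed (use Ec ID(1) rs in auto)
    then show "r = s" using dec rs by simp
  next
    show "(\<lambda>r. \<lambda>e\<in>E. e \<otimes> r) ` I \<subseteq> (\<Pi>\<^sub>E e\<in>E. peirce e I)"
      using ID(1,5) Ec by (auto simp: peirce_def m_assoc[symmetric])
    show "(\<Pi>\<^sub>E e\<in>E. peirce e I) \<subseteq> (\<lambda>r. \<lambda>e\<in>E. e \<otimes> r) ` I"
    proof
      fix g assume g: "g \<in> (\<Pi>\<^sub>E e\<in>E. peirce e I)"
      have gI: "g e \<in> I" "e \<otimes> g e = g e" if "e \<in> E" for e using g that by (auto simp: peirce_def)
      define r where "r = (\<Oplus>e\<in>E. g e)"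
      have r: "r \<in> I" unfolding r_def by (rule invol_ideal_finsum[OF I fin gI(1)])
      have "f \<otimes> r = g f" if f: "f \<in> E" for f
      proof -
        have "f \<otimes> r = (\<Oplus>e\<in>E. f \<otimes> g e)"
          unfolding r_def using finsum_rdistr[OF fin Ec(1)[OF f], of g] gI ID(1) by auto
        also have "\<dots> = (\<Oplus>e\<in>E. if f = e then g e else \<zero>)"
        proof (rule finsum_cong')
          fix e assume e: "e \<in> E"
          have "f \<otimes> g e = f \<otimes> e \<otimes> g e" using gI[OF e] Ec(1)[OF e] Ec(1)[OF f] ID(1)[OF gI(1)[OF e]] by (simp add: m_assoc)
          then show "f \<otimes> g e = (if f = e then g e else \<zero>)"
            using orth[OF f e] gI(2)[OF f] ID(1)[OF gI(1)[OF e]] by auto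
        qed (use ID gI in auto)
        also have "\<dots> = g f" using finsum_singleton[OF f fin, of g] gI ID(1) by auto
        finally show ?thesis .
      qed
      then have "g = (\<lambda>e\<in>E. e \<otimes> r)" using g by (auto simp: PiE_def extensional_def fun_eq_iff)
      then show "g \<in> (\<lambda>r. \<lambda>e\<in>E. e \<otimes> r) ` I" using r by blast
    qed
  qed
  then have "card I = card (PiE E (\<lambda>e. peirce e I))" by (rule bij_betw_same_card)
  then show ?thesis using card_PiE[OF fin] by simp
qed

text \<open>\<open>I\<close> only serves to link \<open>e\<close> and \<open>f\<close>, in both
  directions; the comparison is then made inside any *-ideal \<open>J\<close>, and is needed for
  \<open>I\<close> and for the whole ring.\<close>

lemma card_peirce_eq:
  assumes I: "max_invol_ideal I" and e: "primitive e" "e \<notin> I" and f: "primitive f" "f \<notin> I"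
    and J: "invol_ideal J"
  shows "card (peirce e J) = card (peirce f J)"
proof (rule antisym)
  obtain x where x: "linked x e f"
    using ex_linked[OF e(1) f(1) primitive_mem_principal[OF I e f]] .
  show "card (peirce f J) \<le> card (peirce e J)"
    using linked_card_le[OF x J] primitiveD(1)[OF e(1)] .
  have "linked (star x) f e" using linked_star[OF x] primitiveD[OF e(1)] primitiveD[OF f(1)] by simp
  from linked_card_le[OF this J] show "card (peirce e J) \<le> card (peirce f J)"
    using primitiveD(1)[OF f(1)] .
qed

text \<open>Members inside \<open>I\<close> have \<open>e R = e I\<close> and give the same factors
  to both products; the others have the sizes of \<open>e0\<close>. The reference \<open>e0\<close>
  need not belong to \<open>E\<close>, so two frames can share it.\<close>

lemma frame_card_ideal:
  assumes E: "frame E" and I: "max_invol_ideal I" and e0: "primitive e0" "e0 \<notin> I"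
  shows "card (carrier R) * card (peirce e0 I) ^ card {e \<in> E. e \<notin> I}
       = card I * card (peirce e0 (carrier R)) ^ card {e \<in> E. e \<notin> I}"
proof -
  have iI: "invol_ideal I" using I by (simp add: max_invol_ideal_def)
  have fin: "finite E" and prim: "\<And>e. e \<in> E \<Longrightarrow> primitive e"
    using E by (auto simp: frame_def)
  let ?A = "{e \<in> E. e \<notin> I}" and ?B = "{e \<in> E. e \<in> I}"
  have split: "card J = card (peirce e0 J) ^ card ?A * (\<Prod>e\<in>?B. card (peirce e J))" if J: "invol_ideal J" for J
  proof -
    have "(\<Prod>e\<in>E. card (peirce e J)) = (\<Prod>e\<in>?A \<union> ?B. card (peirce e J))"
      by (rule prod.cong) auto
    also have "\<dots> = (\<Prod>e\<in>?A. card (peirce e J)) * (\<Prod>e\<in>?B. card (peirce e J))"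
      by (rule prod.union_disjoint) (use fin in auto)
    also have "(\<Prod>e\<in>?A. card (peirce e J)) = (\<Prod>e\<in>?A. card (peirce e0 J))"
      by (rule prod.cong) (use card_peirce_eq[OF I _ _ e0 J] prim in auto)
    finally show ?thesis using card_ideal_eq_prod_peirce[OF E J] by simp
  qed
  have "(\<Prod>e\<in>?B. card (peirce e (carrier R))) = (\<Prod>e\<in>?B. card (peirce e I))"
  proof (rule prod.cong)
    fix e assume "e \<in> ?B"
    then have "y \<in> I" if "y \<in> peirce e (carrier R)" for y
      using that invol_idealD(6)[OF iI, of e y] by (auto simp: peirce_def)
    then have "peirce e (carrier R) = peirce e I"
      using invol_idealD(1)[OF iI] unfolding peirce_def by blast
    then show "card (peirce e (carrier R)) = card (peirce e I)" by simp
  qed simp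
  then show ?thesis using split[OF iI] split[OF invol_ideal_carrier] by (simp add: algebra_simps)
qed

lemma frame_card_max_ideal:
  assumes E: "frame E" and F: "frame F" and I: "max_invol_ideal I"
  shows "card {e \<in> E. e \<notin> I} = card {e \<in> F. e \<notin> I}"
proof -
  have iI: "invol_ideal I" "I \<noteq> carrier R" using I by (auto simp: max_invol_ideal_def)
  obtain e0 where e0: "e0 \<in> E" "e0 \<notin> I" using frame_not_subset_ideal[OF E iI] .
  have p: "primitive e0" using E e0 by (auto simp: frame_def)
  define a where "a = card (peirce e0 (carrier R))"
  define d where "d = card (peirce e0 I)"
  have fin: "finite (peirce e0 (carrier R))" "finite I"
    using finite_carrier invol_idealD(1)[OF iI(1)] by (auto simp: peirce_def intro: finite_subset[of _ "carrier R"])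
  \<comment> \<open>The strict inequality, witnessed by \<open>e0\<close> itself, is what makes the
    exponent in the counting identity unique.\<close>
  have "d < a" unfolding a_def d_def
  proof (rule psubset_card_mono[OF fin(1)])
    have "peirce e0 I \<subseteq> peirce e0 (carrier R)" using invol_idealD(1)[OF iI(1)] by (auto simp: peirce_def)
    moreover have "e0 \<in> peirce e0 (carrier R)" "e0 \<notin> peirce e0 I"
      using primitiveD[OF p] e0 by (auto simp: peirce_def)
    ultimately show "peirce e0 I \<subset> peirce e0 (carrier R)" by blast
  qed
  have pos: "card I > 0" using fin(2) invol_idealD(2)[OF iI(1)] card_gt_0_iff by blast
  have *: "\<not> m < n"
    if "card (carrier R) * d ^ n = card I * a ^ n" "card (carrier R) * d ^ m = card I * a ^ m" for m n
  proof
    assume "m < n"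
    then obtain k where k: "n = m + k" "k > 0" using less_imp_add_positive by blast
    have "card I * a ^ m * a ^ k = card I * a ^ m * d ^ k"
      using that unfolding k(1) power_add by (metis mult.assoc)
    then have "a ^ k = d ^ k" using pos \<open>d < a\<close> by simp
    then show False using \<open>d < a\<close> k(2) by (metis less_irrefl power_strict_mono zero_le)
  qed
  show ?thesis
    using *[OF frame_card_ideal[OF E I p e0(2), folded a_def d_def]
               frame_card_ideal[OF F I p e0(2), folded a_def d_def]]
          *[OF frame_card_ideal[OF F I p e0(2), folded a_def d_def]
               frame_card_ideal[OF E I p e0(2), folded a_def d_def]] by linarith
qed

text \<open>Every member of a frame misses exactly one maximal *-ideal.\<close>

lemma frame_card_sum:
  assumes E: "frame E"
  shows "card E = (\<Sum>I | max_invol_ideal I. card {e \<in> E. e \<notin> I})"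
proof -
  have fin: "finite E" and prim: "\<And>e. e \<in> E \<Longrightarrow> primitive e" using E by (auto simp: frame_def)
  have "E = (\<Union>I\<in>{I. max_invol_ideal I}. {e \<in> E. e \<notin> I})"
    using ex_max_invol_ideal[OF E] by blast
  moreover have "card (\<Union>I\<in>{I. max_invol_ideal I}. {e \<in> E. e \<notin> I})
      = (\<Sum>I | max_invol_ideal I. card {e \<in> E. e \<notin> I})"
  proof (rule card_UN_disjoint)
    show "finite {I. max_invol_ideal I}"
      using finite_ideals by (rule rev_finite_subset) (auto simp: max_invol_ideal_def)
    show "\<forall>I\<in>{I. max_invol_ideal I}. finite {e \<in> E. e \<notin> I}" using fin by simp
    show "\<forall>I\<in>{I. max_invol_ideal I}. \<forall>J\<in>{I. max_invol_ideal I}. I \<noteq> J \<longrightarrow>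
        {e \<in> E. e \<notin> I} \<inter> {e \<in> E. e \<notin> J} = {}"
      using prim max_invol_ideal_unique by blast
  qed
  ultimately show ?thesis by simp
qed

lemma frame_card_unique:
  assumes "frame E" "frame F"
  shows "card E = card F"
  unfolding frame_card_sum[OF assms(1)] frame_card_sum[OF assms(2)]
  by (rule sum.cong) (use frame_card_max_ideal[OF assms] in auto)

end

section \<open>The adjoint ring of an alternating form\<close>

text \<open>Vector spaces over the prime field appear as multiplicatively written abelian groups,
  whose homomorphisms are automatically linear. In the application \<open>W\<close> is the whole
  centre of \<open>P\<close>, which contains all values of the form.\<close>

locale alternating_form = V: comm_group V + W: comm_group W
  for V :: "('v, 'm) monoid_scheme" and W :: "('w, 'n) monoid_scheme" +
  fixes b :: "'v \<Rightarrow> 'v \<Rightarrow> 'w"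
  assumes b_closed [simp]: "u \<in> carrier V \<Longrightarrow> v \<in> carrier V \<Longrightarrow> b u v \<in> carrier W"
    and b_add_left: "u \<in> carrier V \<Longrightarrow> v \<in> carrier V \<Longrightarrow> w \<in> carrier V \<Longrightarrow>
      b (u \<otimes>\<^bsub>V\<^esub> v) w = b u w \<otimes>\<^bsub>W\<^esub> b v w"
    and b_add_right: "u \<in> carrier V \<Longrightarrow> v \<in> carrier V \<Longrightarrow> w \<in> carrier V \<Longrightarrow>
      b w (u \<otimes>\<^bsub>V\<^esub> v) = b w u \<otimes>\<^bsub>W\<^esub> b w v"
    and b_alt: "u \<in> carrier V \<Longrightarrow> b u u = \<one>\<^bsub>W\<^esub>"
    and b_nondegenerate: "u \<in> carrier V \<Longrightarrow> (\<And>v. v \<in> carrier V \<Longrightarrow> b u v = \<one>\<^bsub>W\<^esub>) \<Longrightarrow> u = \<one>\<^bsub>V\<^esub>"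
    and finite_carrier: "finite (carrier V)"
    and odd_exponent: "\<exists>n::nat. odd n \<and> (\<forall>v \<in> carrier V. v [^]\<^bsub>V\<^esub> n = \<one>\<^bsub>V\<^esub>)"
begin

lemma b_skew:
  assumes "u \<in> carrier V" "v \<in> carrier V"
  shows "b v u = inv\<^bsub>W\<^esub> (b u v)"
proof -
  have "b (u \<otimes>\<^bsub>V\<^esub> v) (u \<otimes>\<^bsub>V\<^esub> v) = b u v \<otimes>\<^bsub>W\<^esub> b v u"
    using assms b_alt[of u] b_alt[of v] W.m_comm[of "b v u" "b u v"]
    by (simp add: b_add_left b_add_right)
  then have "b u v \<otimes>\<^bsub>W\<^esub> b v u = \<one>\<^bsub>W\<^esub>" using assms b_alt[of "u \<otimes>\<^bsub>V\<^esub> v"] by simp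
  then have "b v u \<otimes>\<^bsub>W\<^esub> b u v = \<one>\<^bsub>W\<^esub>" using assms W.m_comm[of "b v u" "b u v"] by simp
  then show ?thesis using assms W.inv_equality by simp
qed

lemma b_sym_one:
  assumes "u \<in> carrier V" "v \<in> carrier V" "b u v = \<one>\<^bsub>W\<^esub>"
  shows "b v u = \<one>\<^bsub>W\<^esub>"
  using b_skew[OF assms(1,2)] assms(3) by simp

lemma b_one_left [simp]: "v \<in> carrier V \<Longrightarrow> b \<one>\<^bsub>V\<^esub> v = \<one>\<^bsub>W\<^esub>"
  using b_add_left[of "\<one>\<^bsub>V\<^esub>" "\<one>\<^bsub>V\<^esub>" v] by (simp add: W.l_cancel_one')

lemma b_one_right [simp]: "v \<in> carrier V \<Longrightarrow> b v \<one>\<^bsub>V\<^esub> = \<one>\<^bsub>W\<^esub>"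
  by (rule b_sym_one) auto

lemma b_inv_left: "u \<in> carrier V \<Longrightarrow> v \<in> carrier V \<Longrightarrow> b (inv\<^bsub>V\<^esub> u) v = inv\<^bsub>W\<^esub> (b u v)"
  using b_add_left[of "inv\<^bsub>V\<^esub> u" u v] W.inv_equality[of "b (inv\<^bsub>V\<^esub> u) v" "b u v"] by simp

lemma b_inv_right: "u \<in> carrier V \<Longrightarrow> v \<in> carrier V \<Longrightarrow> b v (inv\<^bsub>V\<^esub> u) = inv\<^bsub>W\<^esub> (b v u)"
  using b_add_right[of "inv\<^bsub>V\<^esub> u" u v] W.inv_equality[of "b v (inv\<^bsub>V\<^esub> u)" "b v u"] by simp

lemma nondegenerate_eq:
  assumes "u \<in> carrier V" "v \<in> carrier V" "\<And>w. w \<in> carrier V \<Longrightarrow> b w u = b w v"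
  shows "u = v"
proof -
  have "u \<otimes>\<^bsub>V\<^esub> inv\<^bsub>V\<^esub> v = \<one>\<^bsub>V\<^esub>"
  proof (rule b_nondegenerate)
    fix w assume w: "w \<in> carrier V"
    have "b w (u \<otimes>\<^bsub>V\<^esub> inv\<^bsub>V\<^esub> v) = \<one>\<^bsub>W\<^esub>"
      using assms w by (simp add: b_add_right b_inv_right)
    then show "b (u \<otimes>\<^bsub>V\<^esub> inv\<^bsub>V\<^esub> v) w = \<one>\<^bsub>W\<^esub>" using b_sym_one w assms by simp
  qed (use assms in auto)
  then show ?thesis using assms by (metis V.inv_closed V.inv_equality V.inv_inv)
qed

lemma orth_generate:
  assumes "u \<in> carrier V" "S \<subseteq> carrier V" "\<And>v. v \<in> S \<Longrightarrow> b u v = \<one>\<^bsub>W\<^esub>" "v \<in> generate V S"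
  shows "b u v = \<one>\<^bsub>W\<^esub>"
proof -
  have "subgroup {v \<in> carrier V. b u v = \<one>\<^bsub>W\<^esub>} V"
    by (rule V.subgroupI) (use assms(1) in \<open>auto simp: b_add_right b_inv_right\<close>)
  moreover have "S \<subseteq> {v \<in> carrier V. b u v = \<one>\<^bsub>W\<^esub>}" using assms by auto
  ultimately show ?thesis using V.generate_subgroup_incl assms(4) by blast
qed

definition endos :: "('v \<Rightarrow> 'v) set" where
  "endos = hom V V \<inter> extensional (carrier V)"

definition adjoint :: "('v \<Rightarrow> 'v) \<Rightarrow> ('v \<Rightarrow> 'v) \<Rightarrow> bool" where
  "adjoint f g \<longleftrightarrow> g \<in> endos \<and> (\<forall>u \<in> carrier V. \<forall>v \<in> carrier V. b (f u) v = b u (g v))"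

definition adjointable :: "('v \<Rightarrow> 'v) set" where
  "adjointable = {f \<in> endos. \<exists>g. adjoint f g}"

definition adj :: "('v \<Rightarrow> 'v) \<Rightarrow> ('v \<Rightarrow> 'v)" where
  "adj f = (THE g. adjoint f g)"

text \<open>Maps act on the right, so the product \<open>f g\<close> applies \<open>f\<close> first,
  in agreement with \<open>end_mult\<close>.\<close>

definition adj_ring :: "('v \<Rightarrow> 'v) ring" where
  "adj_ring = \<lparr>carrier = adjointable, monoid.mult = (\<lambda>f g. \<lambda>u\<in>carrier V. g (f u)),
     one = (\<lambda>u\<in>carrier V. u), ring.zero = (\<lambda>u\<in>carrier V. \<one>\<^bsub>V\<^esub>),
     ring.add = (\<lambda>f g. \<lambda>u\<in>carrier V. f u \<otimes>\<^bsub>V\<^esub> g u)\<rparr>"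

lemma adj_ring_simps:
  "carrier adj_ring = adjointable"
  "f \<otimes>\<^bsub>adj_ring\<^esub> g = (\<lambda>u\<in>carrier V. g (f u))"
  "\<one>\<^bsub>adj_ring\<^esub> = (\<lambda>u\<in>carrier V. u)"
  "\<zero>\<^bsub>adj_ring\<^esub> = (\<lambda>u\<in>carrier V. \<one>\<^bsub>V\<^esub>)"
  "f \<oplus>\<^bsub>adj_ring\<^esub> g = (\<lambda>u\<in>carrier V. f u \<otimes>\<^bsub>V\<^esub> g u)"
  by (simp_all add: adj_ring_def)

lemma endosD:
  assumes "f \<in> endos"
  shows "u \<in> carrier V \<Longrightarrow> f u \<in> carrier V"
    "u \<in> carrier V \<Longrightarrow> v \<in> carrier V \<Longrightarrow> f (u \<otimes>\<^bsub>V\<^esub> v) = f u \<otimes>\<^bsub>V\<^esub> f v"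
    "f \<in> extensional (carrier V)"
  using assms by (auto simp: endos_def hom_def)

lemma endos_group_hom: "f \<in> endos \<Longrightarrow> group_hom V V f"
  by (simp add: endos_def group_hom_def group_hom_axioms_def V.group_axioms)

lemma endosI:
  assumes "\<And>u. u \<in> carrier V \<Longrightarrow> f u \<in> carrier V"
    "\<And>u v. u \<in> carrier V \<Longrightarrow> v \<in> carrier V \<Longrightarrow> f (u \<otimes>\<^bsub>V\<^esub> v) = f u \<otimes>\<^bsub>V\<^esub> f v"
    "f \<in> extensional (carrier V)"
  shows "f \<in> endos"
  using assms by (auto simp: endos_def hom_def)

lemma endos_eqI:
  assumes "f \<in> endos" "g \<in> endos" "\<And>u. u \<in> carrier V \<Longrightarrow> f u = g u"
  shows "f = g"
  using assms(1,2) by (intro extensionalityI[OF endosD(3) endosD(3)] assms(3))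

text \<open>Nondegeneracy separates vectors by their products with all others; this is what gives
  the \<open>THE\<close> in \<open>adj\<close> its meaning.\<close>

lemma adjoint_unique:
  assumes "adjoint f g" "adjoint f h"
  shows "g = h"
proof (rule endos_eqI)
  show "g \<in> endos" "h \<in> endos" using assms by (auto simp: adjoint_def)
  fix v assume v: "v \<in> carrier V"
  show "g v = h v"
  proof (rule nondegenerate_eq)
    show "g v \<in> carrier V" "h v \<in> carrier V"
      using assms v endosD(1) by (auto simp: adjoint_def)
    show "b w (g v) = b w (h v)" if "w \<in> carrier V" for w
      using assms v that unfolding adjoint_def by metis
  qed
qed

lemma adj_eqI: "adjoint f g \<Longrightarrow> adj f = g"
  unfolding adj_def using adjoint_unique by blast

text \<open>Both sides are turned around by skew symmetry and the two signs cancel. Hence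
  \<open>adj\<close> is an involution.\<close>

lemma adjoint_sym:
  assumes "f \<in> endos" "adjoint f g"
  shows "adjoint g f"
proof -
  have g: "g \<in> endos" "\<And>u v. u \<in> carrier V \<Longrightarrow> v \<in> carrier V \<Longrightarrow> b (f u) v = b u (g v)"
    using assms(2) by (auto simp: adjoint_def)
  have "b (g u) v = b u (f v)" if "u \<in> carrier V" "v \<in> carrier V" for u v
    using b_skew[of v "g u"] b_skew[of "f v" u] g(2)[of v u] that
      endosD(1)[OF assms(1)] endosD(1)[OF g(1)] by simp
  then show ?thesis using assms(1) by (simp add: adjoint_def)
qed

lemma adjointableI:
  assumes "f \<in> endos" "adjoint f g"
  shows "f \<in> adjointable" "adj f = g" "g \<in> adjointable"
  using assms adjoint_sym[OF assms] adj_eqI by (auto simp: adjointable_def adjoint_def)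

lemma adjointableD:
  assumes "f \<in> adjointable"
  shows "f \<in> endos" "adjoint f (adj f)" "adj f \<in> adjointable" "adj (adj f) = f"
proof -
  obtain g where g: "f \<in> endos" "adjoint f g" using assms by (auto simp: adjointable_def)
  have "adj f = g" using adj_eqI g(2) .
  then show "f \<in> endos" "adjoint f (adj f)" "adj f \<in> adjointable" "adj (adj f) = f"
    using g adjointableI[OF g] adj_eqI[OF adjoint_sym[OF g]] by auto
qed

lemma adjoint_add:
  assumes "f \<in> endos" "adjoint f f'" "g \<in> endos" "adjoint g g'"
  shows "(\<lambda>u\<in>carrier V. f u \<otimes>\<^bsub>V\<^esub> g u) \<in> endos"
    "adjoint (\<lambda>u\<in>carrier V. f u \<otimes>\<^bsub>V\<^esub> g u) (\<lambda>u\<in>carrier V. f' u \<otimes>\<^bsub>V\<^esub> g' u)"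
proof -
  have add: "(\<lambda>u\<in>carrier V. f u \<otimes>\<^bsub>V\<^esub> g u) \<in> endos" if "f \<in> endos" "g \<in> endos" for f g
    by (rule endosI) (use endosD[OF that(1)] endosD[OF that(2)] in \<open>auto simp: V.m_ac\<close>)
  show "(\<lambda>u\<in>carrier V. f u \<otimes>\<^bsub>V\<^esub> g u) \<in> endos" using add assms by blast
  have f': "f' \<in> endos" "g' \<in> endos" using assms by (auto simp: adjoint_def)
  show "adjoint (\<lambda>u\<in>carrier V. f u \<otimes>\<^bsub>V\<^esub> g u) (\<lambda>u\<in>carrier V. f' u \<otimes>\<^bsub>V\<^esub> g' u)"
    unfolding adjoint_def
  proof (intro conjI add[OF f'] ballI)
    fix u v assume "u \<in> carrier V" "v \<in> carrier V"
    then show "b ((\<lambda>u\<in>carrier V. f u \<otimes>\<^bsub>V\<^esub> g u) u) v = b u ((\<lambda>u\<in>carrier V. f' u \<otimes>\<^bsub>V\<^esub> g' u) v)"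
      using assms(2,4) endosD(1)[OF f'(1)] endosD(1)[OF f'(2)] endosD(1)[OF assms(1)] endosD(1)[OF assms(3)]
      by (simp add: adjoint_def b_add_left b_add_right)
  qed
qed

lemma adjoint_comp:
  assumes "f \<in> endos" "adjoint f f'" "g \<in> endos" "adjoint g g'"
  shows "(\<lambda>u\<in>carrier V. g (f u)) \<in> endos"
    "adjoint (\<lambda>u\<in>carrier V. g (f u)) (\<lambda>u\<in>carrier V. f' (g' u))"
proof -
  have comp: "(\<lambda>u\<in>carrier V. g (f u)) \<in> endos" if "f \<in> endos" "g \<in> endos" for f g
    by (rule endosI) (use endosD[OF that(1)] endosD[OF that(2)] in auto)
  show "(\<lambda>u\<in>carrier V. g (f u)) \<in> endos" using comp assms by blast
  have f': "f' \<in> endos" "g' \<in> endos" using assms by (auto simp: adjoint_def)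
  show "adjoint (\<lambda>u\<in>carrier V. g (f u)) (\<lambda>u\<in>carrier V. f' (g' u))"
    unfolding adjoint_def
  proof (intro conjI comp[OF f'(2,1)] ballI)
    fix u v assume "u \<in> carrier V" "v \<in> carrier V"
    then show "b ((\<lambda>u\<in>carrier V. g (f u)) u) v = b u ((\<lambda>u\<in>carrier V. f' (g' u)) v)"
      using assms(2,4) endosD(1)[OF f'(1)] endosD(1)[OF f'(2)] endosD(1)[OF assms(1)] endosD(1)[OF assms(3)]
      by (simp add: adjoint_def)
  qed
qed

lemma adjoint_one:
  "(\<lambda>u\<in>carrier V. u) \<in> endos" "adjoint (\<lambda>u\<in>carrier V. u) (\<lambda>u\<in>carrier V. u)"
proof -
  show 1: "(\<lambda>u\<in>carrier V. u) \<in> endos" by (rule endosI) auto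
  show "adjoint (\<lambda>u\<in>carrier V. u) (\<lambda>u\<in>carrier V. u)" using 1 by (simp add: adjoint_def)
qed

lemma adjoint_zero:
  "(\<lambda>u\<in>carrier V. \<one>\<^bsub>V\<^esub>) \<in> endos" "adjoint (\<lambda>u\<in>carrier V. \<one>\<^bsub>V\<^esub>) (\<lambda>u\<in>carrier V. \<one>\<^bsub>V\<^esub>)"
proof -
  show 1: "(\<lambda>u\<in>carrier V. \<one>\<^bsub>V\<^esub>) \<in> endos" by (rule endosI) auto
  show "adjoint (\<lambda>u\<in>carrier V. \<one>\<^bsub>V\<^esub>) (\<lambda>u\<in>carrier V. \<one>\<^bsub>V\<^esub>)" using 1 by (simp add: adjoint_def)
qed

lemma adjoint_inv:
  assumes "f \<in> endos" "adjoint f f'"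
  shows "(\<lambda>u\<in>carrier V. inv\<^bsub>V\<^esub> (f u)) \<in> endos"
    "adjoint (\<lambda>u\<in>carrier V. inv\<^bsub>V\<^esub> (f u)) (\<lambda>u\<in>carrier V. inv\<^bsub>V\<^esub> (f' u))"
proof -
  have inv: "(\<lambda>u\<in>carrier V. inv\<^bsub>V\<^esub> (f u)) \<in> endos" if "f \<in> endos" for f
    by (rule endosI) (use endosD[OF that] in \<open>auto simp: V.inv_mult\<close>)
  show "(\<lambda>u\<in>carrier V. inv\<^bsub>V\<^esub> (f u)) \<in> endos" using inv assms by blast
  have f': "f' \<in> endos" using assms by (auto simp: adjoint_def)
  show "adjoint (\<lambda>u\<in>carrier V. inv\<^bsub>V\<^esub> (f u)) (\<lambda>u\<in>carrier V. inv\<^bsub>V\<^esub> (f' u))"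
    unfolding adjoint_def
  proof (intro conjI inv[OF f'] ballI)
    fix u v assume "u \<in> carrier V" "v \<in> carrier V"
    then show "b ((\<lambda>u\<in>carrier V. inv\<^bsub>V\<^esub> (f u)) u) v = b u ((\<lambda>u\<in>carrier V. inv\<^bsub>V\<^esub> (f' u)) v)"
      using assms(2) endosD(1)[OF f'] endosD(1)[OF assms(1)]
      by (simp add: adjoint_def b_inv_left b_inv_right)
  qed
qed

lemma adj_ring_closed:
  assumes "f \<in> adjointable" "g \<in> adjointable"
  shows "f \<oplus>\<^bsub>adj_ring\<^esub> g \<in> adjointable" "f \<otimes>\<^bsub>adj_ring\<^esub> g \<in> adjointable"
    "adj (f \<oplus>\<^bsub>adj_ring\<^esub> g) = adj f \<oplus>\<^bsub>adj_ring\<^esub> adj g"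
    "adj (f \<otimes>\<^bsub>adj_ring\<^esub> g) = adj g \<otimes>\<^bsub>adj_ring\<^esub> adj f"
  using adjointableI[OF adjoint_add[OF adjointableD(1,2)[OF assms(1)] adjointableD(1,2)[OF assms(2)]]]
    adjointableI[OF adjoint_comp[OF adjointableD(1,2)[OF assms(1)] adjointableD(1,2)[OF assms(2)]]]
  by (simp_all add: adj_ring_simps)

lemma adj_ring_const: "\<zero>\<^bsub>adj_ring\<^esub> \<in> adjointable" "\<one>\<^bsub>adj_ring\<^esub> \<in> adjointable"
  using adjointableI(1)[OF adjoint_zero] adjointableI(1)[OF adjoint_one] by (simp_all add: adj_ring_simps)

lemma adjointable_ext: "f \<in> adjointable \<Longrightarrow> (\<lambda>u\<in>carrier V. f u) = f"
  using adjointableD(1) endosD(3) extensional_restrict by blast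

lemma adj_ring_l_neg:
  assumes "f \<in> adjointable"
  shows "(\<lambda>u\<in>carrier V. inv\<^bsub>V\<^esub> (f u)) \<in> adjointable"
    "(\<lambda>u\<in>carrier V. inv\<^bsub>V\<^esub> (f u)) \<oplus>\<^bsub>adj_ring\<^esub> f = \<zero>\<^bsub>adj_ring\<^esub>"
proof -
  show "(\<lambda>u\<in>carrier V. inv\<^bsub>V\<^esub> (f u)) \<in> adjointable"
    using adjointableI(1)[OF adjoint_inv[OF adjointableD(1,2)[OF assms]]] .
  show "(\<lambda>u\<in>carrier V. inv\<^bsub>V\<^esub> (f u)) \<oplus>\<^bsub>adj_ring\<^esub> f = \<zero>\<^bsub>adj_ring\<^esub>"
    unfolding adj_ring_simps
    by (rule restrict_ext) (use endosD(1)[OF adjointableD(1)[OF assms]] in simp)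
qed

lemma ring_adj_ring: "ring adj_ring"
proof (rule ringI)
  note ad = adjointableD(1)[THEN endosD(1)] adjointableD(1)[THEN endosD(2)]
  show "abelian_group adj_ring"
  proof (rule abelian_groupI)
    fix f assume "f \<in> carrier adj_ring"
    then show "\<exists>g\<in>carrier adj_ring. g \<oplus>\<^bsub>adj_ring\<^esub> f = \<zero>\<^bsub>adj_ring\<^esub>"
      using adj_ring_l_neg[of f] unfolding adj_ring_simps(1) by blast
  next
    fix f assume "f \<in> carrier adj_ring"
    then show "\<zero>\<^bsub>adj_ring\<^esub> \<oplus>\<^bsub>adj_ring\<^esub> f = f"
      using adjointable_ext[of f] ad(1)[of f] by (simp add: adj_ring_simps cong: restrict_cong)
  next
    fix f g h assume "f \<in> carrier adj_ring" "g \<in> carrier adj_ring" "h \<in> carrier adj_ring"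
    then show "f \<oplus>\<^bsub>adj_ring\<^esub> g \<oplus>\<^bsub>adj_ring\<^esub> h = f \<oplus>\<^bsub>adj_ring\<^esub> (g \<oplus>\<^bsub>adj_ring\<^esub> h)"
      unfolding adj_ring_simps by (intro restrict_ext) (simp add: ad V.m_assoc)
  next
    fix f g assume "f \<in> carrier adj_ring" "g \<in> carrier adj_ring"
    then show "f \<oplus>\<^bsub>adj_ring\<^esub> g = g \<oplus>\<^bsub>adj_ring\<^esub> f"
      unfolding adj_ring_simps by (intro restrict_ext) (simp add: ad V.m_comm)
  qed (use adj_ring_closed adj_ring_const in \<open>simp_all add: adj_ring_simps(1)\<close>)
  show "monoid adj_ring"
  proof (rule monoidI)
    fix f assume "f \<in> carrier adj_ring"
    then show "\<one>\<^bsub>adj_ring\<^esub> \<otimes>\<^bsub>adj_ring\<^esub> f = f" "f \<otimes>\<^bsub>adj_ring\<^esub> \<one>\<^bsub>adj_ring\<^esub> = f"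
      using adjointable_ext[of f] ad(1)[of f] by (simp_all add: adj_ring_simps cong: restrict_cong)
  next
    fix f g h assume "f \<in> carrier adj_ring" "g \<in> carrier adj_ring" "h \<in> carrier adj_ring"
    then show "f \<otimes>\<^bsub>adj_ring\<^esub> g \<otimes>\<^bsub>adj_ring\<^esub> h = f \<otimes>\<^bsub>adj_ring\<^esub> (g \<otimes>\<^bsub>adj_ring\<^esub> h)"
      unfolding adj_ring_simps by (intro restrict_ext) (simp add: ad)
  qed (use adj_ring_closed adj_ring_const in \<open>simp_all add: adj_ring_simps(1)\<close>)
  fix f g h assume "f \<in> carrier adj_ring" "g \<in> carrier adj_ring" "h \<in> carrier adj_ring"
  then show "(f \<oplus>\<^bsub>adj_ring\<^esub> g) \<otimes>\<^bsub>adj_ring\<^esub> h = f \<otimes>\<^bsub>adj_ring\<^esub> h \<oplus>\<^bsub>adj_ring\<^esub> g \<otimes>\<^bsub>adj_ring\<^esub> h"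
    "h \<otimes>\<^bsub>adj_ring\<^esub> (f \<oplus>\<^bsub>adj_ring\<^esub> g) = h \<otimes>\<^bsub>adj_ring\<^esub> f \<oplus>\<^bsub>adj_ring\<^esub> h \<otimes>\<^bsub>adj_ring\<^esub> g"
    unfolding adj_ring_simps by (intro restrict_ext; simp add: ad)+
qed

lemma star_ring_adj_ring: "star_ring adj_ring adj"
proof (intro star_ring.intro ring_adj_ring star_ring_axioms.intro)
  interpret R: ring adj_ring by (rule ring_adj_ring)
  have "adjointable \<subseteq> (\<Pi>\<^sub>E u\<in>carrier V. carrier V)"
    using adjointableD(1) endosD(1,3) by (auto simp: PiE_def)
  then show "finite (carrier adj_ring)"
    unfolding adj_ring_simps using finite_PiE[OF finite_carrier] finite_carrier finite_subset by metis
  obtain n :: nat where n: "odd n" "\<And>v. v \<in> carrier V \<Longrightarrow> v [^]\<^bsub>V\<^esub> n = \<one>\<^bsub>V\<^esub>"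
    using odd_exponent by blast
  \<comment> \<open>Integer multiples in the ring are pointwise powers in \<open>V\<close>, so the
    odd exponent of \<open>V\<close> annihilates the ring.\<close>
  have "[k] \<cdot>\<^bsub>adj_ring\<^esub> f = (\<lambda>u\<in>carrier V. f u [^]\<^bsub>V\<^esub> k)" if "f \<in> adjointable" for f and k :: nat
  proof (induction k)
    case (Suc k)
    have "[Suc k] \<cdot>\<^bsub>adj_ring\<^esub> f = [k] \<cdot>\<^bsub>adj_ring\<^esub> f \<oplus>\<^bsub>adj_ring\<^esub> f" by simp
    then show ?case unfolding Suc adj_ring_simps by (auto simp: restrict_def)
  qed (simp add: adj_ring_simps)
  then have "[n] \<cdot>\<^bsub>adj_ring\<^esub> f = \<zero>\<^bsub>adj_ring\<^esub>" if "f \<in> adjointable" for f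
    using that n(2) endosD(1)[OF adjointableD(1)[OF that]] unfolding adj_ring_simps
    by (simp cong: restrict_cong)
  then show "\<exists>n::nat. odd n \<and> (\<forall>f\<in>carrier adj_ring. [n] \<cdot>\<^bsub>adj_ring\<^esub> f = \<zero>\<^bsub>adj_ring\<^esub>)"
    using n(1) unfolding adj_ring_simps(1) by blast
qed (use adj_ring_closed adjointableD in \<open>simp_all add: adj_ring_simps(1)\<close>)

end

sublocale alternating_form \<subseteq> A: star_ring adj_ring adj
  by (rule star_ring_adj_ring)

section \<open>Orthogonal decompositions\<close>

text \<open>An indexed family lets group members label their images before these are known to be
  distinct; injectivity comes out in \<open>proj_inj\<close>. Indecomposability is phrased with
  orthogonal factors covering \<open>U i\<close>, the form that central indecomposability of a group
  member yields.\<close>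

locale orthogonal_decomposition = alternating_form V W b
  for V :: "('v, 'm) monoid_scheme" and W :: "('w, 'n) monoid_scheme" and b +
  fixes K :: "'i set" and U :: "'i \<Rightarrow> 'v set"
  assumes finite_K: "finite K"
    and U_subgroup: "i \<in> K \<Longrightarrow> subgroup (U i) V"
    and U_orth: "i \<in> K \<Longrightarrow> j \<in> K \<Longrightarrow> i \<noteq> j \<Longrightarrow> u \<in> U i \<Longrightarrow> v \<in> U j \<Longrightarrow> b u v = \<one>\<^bsub>W\<^esub>"
    and U_generate: "generate V (\<Union>i\<in>K. U i) = carrier V"
    and U_nontrivial: "i \<in> K \<Longrightarrow> U i \<noteq> {\<one>\<^bsub>V\<^esub>}"
    and U_indecomposable: "i \<in> K \<Longrightarrow> subgroup A V \<Longrightarrow> subgroup B V \<Longrightarrow> A \<subseteq> U i \<Longrightarrow> B \<subseteq> U i \<Longrightarrow>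
      (\<And>u v. u \<in> A \<Longrightarrow> v \<in> B \<Longrightarrow> b u v = \<one>\<^bsub>W\<^esub>) \<Longrightarrow> U i \<subseteq> A <#>\<^bsub>V\<^esub> B \<Longrightarrow> A = U i \<or> B = U i"
begin

definition Y :: "'i \<Rightarrow> 'v set" where
  "Y i = generate V (\<Union>j\<in>K - {i}. U j)"

definition proj :: "'i \<Rightarrow> 'v \<Rightarrow> 'v" where
  "proj i = (\<lambda>u\<in>carrier V. THE w. w \<in> U i \<and> (\<exists>v\<in>Y i. u = w \<otimes>\<^bsub>V\<^esub> v))"

lemma U_carrier: "i \<in> K \<Longrightarrow> u \<in> U i \<Longrightarrow> u \<in> carrier V"
  using U_subgroup subgroup.subset by blast

lemma Y_subgroup: "subgroup (Y i) V"
  unfolding Y_def by (rule V.generate_is_subgroup) (use U_carrier in blast)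

lemma Y_carrier: "u \<in> Y i \<Longrightarrow> u \<in> carrier V"
  using Y_subgroup subgroup.subset by blast

lemma U_subset_Y: "j \<in> K \<Longrightarrow> j \<noteq> i \<Longrightarrow> u \<in> U j \<Longrightarrow> u \<in> Y i"
  unfolding Y_def by (rule generate.incl) blast

lemma U_Y_orth:
  assumes "i \<in> K" "u \<in> U i" "v \<in> Y i"
  shows "b u v = \<one>\<^bsub>W\<^esub>"
  by (rule orth_generate[OF _ _ _ assms(3)[unfolded Y_def]])
    (use assms(1,2) U_carrier U_orth[OF assms(1) _ _ assms(2)] in auto)

lemma U_mult_Y:
  assumes "i \<in> K"
  shows "U i <#>\<^bsub>V\<^esub> Y i = carrier V"
proof
  show "U i <#>\<^bsub>V\<^esub> Y i \<subseteq> carrier V"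
    using U_carrier[OF assms] Y_carrier by (auto simp: set_mult_def)
  have sub: "subgroup (U i <#>\<^bsub>V\<^esub> Y i) V"
    using V.mult_subgroups U_subgroup assms Y_subgroup by blast
  have "(\<Union>j\<in>K. U j) \<subseteq> U i <#>\<^bsub>V\<^esub> Y i"
  proof clarify
    fix j u assume ju: "j \<in> K" "u \<in> U j"
    have c: "u \<in> carrier V" using U_carrier ju by blast
    show "u \<in> U i <#>\<^bsub>V\<^esub> Y i"
    proof (cases "j = i")
      case True
      have "u = u \<otimes>\<^bsub>V\<^esub> \<one>\<^bsub>V\<^esub>" using c by simp
      then show ?thesis using True ju subgroup.one_closed[OF Y_subgroup] unfolding set_mult_def by blast
    next
      case False
      have "u = \<one>\<^bsub>V\<^esub> \<otimes>\<^bsub>V\<^esub> u" using c by simp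
      then show ?thesis using U_subset_Y[OF ju(1) False ju(2)] subgroup.one_closed[OF U_subgroup[OF assms]]
        unfolding set_mult_def by blast
    qed
  qed
  then show "carrier V \<subseteq> U i <#>\<^bsub>V\<^esub> Y i" using V.generate_subgroup_incl[OF _ sub, of "\<Union>i\<in>K. U i"] U_generate by simp
qed

lemma U_Y_decompose:
  assumes "i \<in> K" "u \<in> carrier V"
  obtains w v where "w \<in> U i" "v \<in> Y i" "u = w \<otimes>\<^bsub>V\<^esub> v"
  using U_mult_Y[OF assms(1)] assms(2) unfolding set_mult_def by blast

text \<open>A common element is orthogonal to \<open>Y i\<close> and to \<open>U i\<close>, hence to
  everything. So directness of the decomposition is a consequence of nondegeneracy.\<close>

lemma U_Int_Y:
  assumes "i \<in> K" "u \<in> U i" "u \<in> Y i"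
  shows "u = \<one>\<^bsub>V\<^esub>"
proof (rule b_nondegenerate)
  show u: "u \<in> carrier V" using U_carrier assms by blast
  fix z assume "z \<in> carrier V"
  then obtain w v where wv: "w \<in> U i" "v \<in> Y i" "z = w \<otimes>\<^bsub>V\<^esub> v" using U_Y_decompose assms(1) by blast
  note c = U_carrier[OF assms(1) wv(1)] Y_carrier[OF wv(2)]
  show "b u z = \<one>\<^bsub>W\<^esub>"
    using U_Y_orth[OF assms(1,2) wv(2)] b_sym_one[OF c(1) u U_Y_orth[OF assms(1) wv(1) assms(3)]] c u wv(3)
    by (simp add: b_add_right)
qed

text \<open>Two decompositions of one vector differ by an element of \<open>U i\<close> that also
  lies in \<open>Y i\<close>, so the description in \<open>proj\<close> has a unique
  solution.\<close>

lemma proj_eq: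
  assumes "i \<in> K" "w \<in> U i" "v \<in> Y i"
  shows "proj i (w \<otimes>\<^bsub>V\<^esub> v) = w"
proof -
  have c: "w \<in> carrier V" "v \<in> carrier V" using U_carrier Y_carrier assms by auto
  have "w' = w" if w': "w' \<in> U i" "v' \<in> Y i" "w \<otimes>\<^bsub>V\<^esub> v = w' \<otimes>\<^bsub>V\<^esub> v'" for w' v'
  proof -
    have c': "w' \<in> carrier V" "v' \<in> carrier V" using U_carrier Y_carrier assms w' by auto
    have w'_eq: "w' = (w \<otimes>\<^bsub>V\<^esub> v) \<otimes>\<^bsub>V\<^esub> inv\<^bsub>V\<^esub> v'" using w'(3) c' by (simp add: V.m_assoc)
    have "(w \<otimes>\<^bsub>V\<^esub> v) \<otimes>\<^bsub>V\<^esub> x \<otimes>\<^bsub>V\<^esub> y = (w \<otimes>\<^bsub>V\<^esub> y) \<otimes>\<^bsub>V\<^esub> (v \<otimes>\<^bsub>V\<^esub> x)"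
      if "x \<in> carrier V" "y \<in> carrier V" for x y
      using c that by (simp add: V.m_ac)
    from this[of "inv\<^bsub>V\<^esub> v'" "inv\<^bsub>V\<^esub> w"]
    have *: "w' \<otimes>\<^bsub>V\<^esub> inv\<^bsub>V\<^esub> w = v \<otimes>\<^bsub>V\<^esub> inv\<^bsub>V\<^esub> v'"
      unfolding w'_eq using c c' by simp
    have "w' \<otimes>\<^bsub>V\<^esub> inv\<^bsub>V\<^esub> w \<in> U i"
      using U_subgroup[OF assms(1)] w' assms by (simp add: subgroup.m_closed subgroup.m_inv_closed)
    moreover have "w' \<otimes>\<^bsub>V\<^esub> inv\<^bsub>V\<^esub> w \<in> Y i"
      unfolding * using Y_subgroup w' assms by (simp add: subgroup.m_closed subgroup.m_inv_closed)
    ultimately have "w' \<otimes>\<^bsub>V\<^esub> inv\<^bsub>V\<^esub> w = \<one>\<^bsub>V\<^esub>" using U_Int_Y assms(1) by blast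
    then show "w' = w" using c c' V.inv_equality[of w' "inv\<^bsub>V\<^esub> w"] by simp
  qed
  then have "(THE w'. w' \<in> U i \<and> (\<exists>v'\<in>Y i. w \<otimes>\<^bsub>V\<^esub> v = w' \<otimes>\<^bsub>V\<^esub> v')) = w"
    using assms by (intro the_equality) auto
  then show ?thesis using c by (simp add: proj_def)
qed

lemma proj_U:
  assumes "i \<in> K" "w \<in> U i" shows "proj i w = w"
  using proj_eq[OF assms subgroup.one_closed[OF Y_subgroup]] U_carrier[OF assms] by simp

lemma proj_Y:
  assumes "i \<in> K" "v \<in> Y i" shows "proj i v = \<one>\<^bsub>V\<^esub>"
  using proj_eq[OF assms(1) subgroup.one_closed[OF U_subgroup[OF assms(1)]] assms(2)] Y_carrier[OF assms(2)]
  by simp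

lemma proj_in_U: "i \<in> K \<Longrightarrow> u \<in> carrier V \<Longrightarrow> proj i u \<in> U i"
  using U_Y_decompose[of i u] proj_eq[of i] by metis

lemma proj_endos:
  assumes i: "i \<in> K" shows "proj i \<in> endos"
proof (rule endosI)
  show "proj i u \<in> carrier V" if "u \<in> carrier V" for u using U_carrier proj_in_U i that by blast
  show "proj i \<in> extensional (carrier V)" by (simp add: proj_def)
  fix u u' assume u: "u \<in> carrier V" "u' \<in> carrier V"
  obtain w v where wv: "w \<in> U i" "v \<in> Y i" "u = w \<otimes>\<^bsub>V\<^esub> v" using U_Y_decompose[OF i u(1)] .
  obtain w' v' where wv': "w' \<in> U i" "v' \<in> Y i" "u' = w' \<otimes>\<^bsub>V\<^esub> v'" using U_Y_decompose[OF i u(2)] .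
  have c: "w \<in> carrier V" "w' \<in> carrier V" "v \<in> carrier V" "v' \<in> carrier V"
    using U_carrier[OF i] Y_carrier wv wv' by auto
  have "u \<otimes>\<^bsub>V\<^esub> u' = (w \<otimes>\<^bsub>V\<^esub> w') \<otimes>\<^bsub>V\<^esub> (v \<otimes>\<^bsub>V\<^esub> v')" using c wv(3) wv'(3) by (simp add: V.m_ac)
  then have "proj i (u \<otimes>\<^bsub>V\<^esub> u') = w \<otimes>\<^bsub>V\<^esub> w'"
    using proj_eq[OF i subgroup.m_closed[OF U_subgroup[OF i] wv(1) wv'(1)]
        subgroup.m_closed[OF Y_subgroup wv(2) wv'(2)]] by simp
  then show "proj i (u \<otimes>\<^bsub>V\<^esub> u') = proj i u \<otimes>\<^bsub>V\<^esub> proj i u'"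
    using proj_eq[OF i wv(1,2)] proj_eq[OF i wv'(1,2)] wv(3) wv'(3) by simp
qed

text \<open>Orthogonality of \<open>U i\<close> and \<open>Y i\<close> reduces both sides to the
  product of the \<open>U i\<close> components.\<close>

lemma proj_adjoint:
  assumes i: "i \<in> K" shows "adjoint (proj i) (proj i)"
  unfolding adjoint_def
proof (intro conjI ballI proj_endos[OF i])
  fix u u' assume u: "u \<in> carrier V" "u' \<in> carrier V"
  obtain w v where wv: "w \<in> U i" "v \<in> Y i" "u = w \<otimes>\<^bsub>V\<^esub> v" using U_Y_decompose[OF i u(1)] .
  obtain w' v' where wv': "w' \<in> U i" "v' \<in> Y i" "u' = w' \<otimes>\<^bsub>V\<^esub> v'" using U_Y_decompose[OF i u(2)] .
  have c: "w \<in> carrier V" "w' \<in> carrier V" "v \<in> carrier V" "v' \<in> carrier V"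
    using U_carrier[OF i] Y_carrier wv wv' by auto
  have "b (proj i u) u' = b w w'"
    using proj_eq[OF i wv(1,2)] wv(3) wv'(3) c U_Y_orth[OF i wv(1) wv'(2)] by (simp add: b_add_right)
  moreover have "b u (proj i u') = b w w'"
    using proj_eq[OF i wv'(1,2)] wv(3) wv'(3) c b_sym_one[OF _ _ U_Y_orth[OF i wv'(1) wv(2)]]
    by (simp add: b_add_left)
  ultimately show "b (proj i u) u' = b u (proj i u')" by simp
qed

lemma proj_adjointable: "i \<in> K \<Longrightarrow> proj i \<in> adjointable" "i \<in> K \<Longrightarrow> adj (proj i) = proj i"
  using adjointableI[OF proj_endos proj_adjoint] by auto

lemma proj_mult:
  assumes "i \<in> K" "j \<in> K"
  shows "proj i \<otimes>\<^bsub>adj_ring\<^esub> proj j = (if i = j then proj i else \<zero>\<^bsub>adj_ring\<^esub>)"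
proof (rule endos_eqI)
  have a: "proj i \<otimes>\<^bsub>adj_ring\<^esub> proj j \<in> adjointable" "(if i = j then proj i else \<zero>\<^bsub>adj_ring\<^esub>) \<in> adjointable"
    using adj_ring_closed(2) proj_adjointable(1) adj_ring_const(1) assms by auto
  show "proj i \<otimes>\<^bsub>adj_ring\<^esub> proj j \<in> endos" "(if i = j then proj i else \<zero>\<^bsub>adj_ring\<^esub>) \<in> endos"
    using a[THEN adjointableD(1)] .
  fix u assume u: "u \<in> carrier V"
  show "(proj i \<otimes>\<^bsub>adj_ring\<^esub> proj j) u = (if i = j then proj i else \<zero>\<^bsub>adj_ring\<^esub>) u"
    using u proj_in_U[OF assms(1) u] proj_U proj_Y[OF assms(2) U_subset_Y[OF assms(1)]] assms
    by (auto simp: adj_ring_simps)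
qed

lemma proj_nonzero:
  assumes "i \<in> K" shows "proj i \<noteq> \<zero>\<^bsub>adj_ring\<^esub>"
proof
  assume *: "proj i = \<zero>\<^bsub>adj_ring\<^esub>"
  have "w = \<one>\<^bsub>V\<^esub>" if "w \<in> U i" for w
    using proj_U[OF assms that] U_carrier[OF assms that] unfolding * by (simp add: adj_ring_simps)
  then have "U i = {\<one>\<^bsub>V\<^esub>}" using subgroup.one_closed[OF U_subgroup[OF assms]] by blast
  then show False using U_nontrivial assms by blast
qed

lemma proj_inj: "inj_on proj K"
proof (rule inj_onI)
  fix i j assume ij: "i \<in> K" "j \<in> K" "proj i = proj j"
  show "i = j"
  proof (rule ccontr)
    assume "i \<noteq> j"
    then have "proj i \<otimes>\<^bsub>adj_ring\<^esub> proj j = \<zero>\<^bsub>adj_ring\<^esub>" using proj_mult[OF ij(1,2)] by simp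
    then have "proj i = \<zero>\<^bsub>adj_ring\<^esub>"
      using proj_mult[OF ij(1,1)] unfolding ij(3)[symmetric] by simp
    then show False using proj_nonzero ij by blast
  qed
qed

lemma finsum_apply:
  assumes "finite J" "\<And>i. i \<in> J \<Longrightarrow> f i \<in> adjointable" "u \<in> carrier V"
  shows "(\<Oplus>\<^bsub>adj_ring\<^esub>i\<in>J. f i) u = (\<Otimes>\<^bsub>V\<^esub>i\<in>J. f i u)"
  using assms(1,2)
proof (induction J rule: finite_induct)
  case empty then show ?case using assms(3) by (simp add: adj_ring_simps)
next
  case (insert i J)
  have "f \<in> J \<rightarrow> carrier adj_ring" "f i \<in> carrier adj_ring" using insert by (auto simp: adj_ring_simps(1))
  moreover have "(\<lambda>i. f i u) \<in> J \<rightarrow> carrier V" "f i u \<in> carrier V"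
    using insert.prems endosD(1)[OF adjointableD(1) assms(3)] by auto
  ultimately show ?case using insert assms(3) by (simp add: adj_ring_simps(5))
qed

text \<open>The fixed points of the sum form a subgroup that contains every \<open>U j\<close>,
  hence all of \<open>V\<close>.\<close>

lemma sum_proj: "(\<Oplus>\<^bsub>adj_ring\<^esub>i\<in>K. proj i) = \<one>\<^bsub>adj_ring\<^esub>" (is "?s = _")
proof -
  have sum: "?s \<in> adjointable"
    using A.finsum_closed[of proj K] proj_adjointable(1) by (auto simp: adj_ring_simps(1))
  note sD = endosD[OF adjointableD(1)[OF sum]]
  interpret s: group_hom V V ?s using endos_group_hom[OF adjointableD(1)[OF sum]] .
  have "subgroup {u \<in> carrier V. ?s u = u} V"
    by (rule V.subgroupI) (auto intro!: exI[of _ "\<one>\<^bsub>V\<^esub>"] simp: s.hom_inv)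
  moreover have "(\<Union>i\<in>K. U i) \<subseteq> {u \<in> carrier V. ?s u = u}"
  proof clarify
    fix j u assume ju: "j \<in> K" "u \<in> U j"
    have c: "u \<in> carrier V" using U_carrier ju by blast
    have "?s u = (\<Otimes>\<^bsub>V\<^esub>i\<in>K. proj i u)" using finsum_apply[OF finite_K proj_adjointable(1) c] by simp
    also have "\<dots> = (\<Otimes>\<^bsub>V\<^esub>i\<in>K. if j = i then u else \<one>\<^bsub>V\<^esub>)"
    proof (rule V.finprod_cong')
      fix i assume i: "i \<in> K"
      show "proj i u = (if j = i then u else \<one>\<^bsub>V\<^esub>)"
        using proj_U[OF ju] proj_Y[OF i U_subset_Y[OF ju(1) _ ju(2)]] by auto
    qed (use c in auto)
    also have "\<dots> = u" using V.finprod_singleton[OF ju(1) finite_K, of "\<lambda>_. u"] c by simp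
    finally show "u \<in> carrier V \<and> ?s u = u" using c by simp
  qed
  ultimately have *: "carrier V \<subseteq> {u \<in> carrier V. ?s u = u}"
    using V.generate_subgroup_incl U_generate by metis
  show ?thesis
  proof (rule endos_eqI)
    show "?s \<in> endos" "\<one>\<^bsub>adj_ring\<^esub> \<in> endos" using sum adj_ring_const(2) adjointableD(1) by auto
    show "?s u = \<one>\<^bsub>adj_ring\<^esub> u" if "u \<in> carrier V" for u using * that by (auto simp: adj_ring_simps(3))
  qed
qed

text \<open>A self-adjoint idempotent \<open>d\<close> below \<open>proj i\<close> splits
  \<open>U i\<close> into its image and its kernel, which are orthogonal since
  \<open>b (d u) v = b u (d v)\<close>. Indecomposability makes one of them all of
  \<open>U i\<close>.\<close>

lemma proj_primitive:
  assumes i: "i \<in> K"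
  shows "A.primitive (proj i)"
proof -
  have "d = \<zero>\<^bsub>adj_ring\<^esub> \<or> d = proj i"
    if d: "d \<in> adjointable" and *: "d \<otimes>\<^bsub>adj_ring\<^esub> d = d" "adj d = d"
      "proj i \<otimes>\<^bsub>adj_ring\<^esub> d = d" "d \<otimes>\<^bsub>adj_ring\<^esub> proj i = d" for d
  proof -
    note dE = adjointableD(1)[OF d]
    note dD = endosD[OF dE]
    have dd: "d (d u) = d u" and ed: "d (proj i u) = d u" and de: "proj i (d u) = d u"
      if "u \<in> carrier V" for u
      using *(1,3,4)[THEN fun_cong, of u] that by (simp_all add: adj_ring_simps(2))
    have self: "b (d u) v = b u (d v)" if "u \<in> carrier V" "v \<in> carrier V" for u v
      using adjointableD(2)[OF d] *(2) that by (simp add: adjoint_def)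
    interpret d: group_hom V V d using endos_group_hom[OF dE] .
    have dU: "d u \<in> U i" if "u \<in> carrier V" for u using de[OF that] proj_in_U[OF i dD(1)[OF that]] by simp
    note Us = U_subgroup[OF i] and Uc = U_carrier[OF i]
    define B where "B = {w \<in> U i. d w = \<one>\<^bsub>V\<^esub>}"
    have "d ` U i = U i \<or> B = U i"
    proof (rule U_indecomposable[OF i])
      show "subgroup (d ` U i) V" using d.subgroup_img_is_subgroup[OF Us] .
      show "subgroup B V"
        unfolding B_def
        by (rule V.subgroupI)
          (use Uc subgroup.one_closed[OF Us] subgroup.m_closed[OF Us] subgroup.m_inv_closed[OF Us] in
            \<open>auto simp: d.hom_inv intro!: exI[of _ "\<one>\<^bsub>V\<^esub>"]\<close>)
      show "d ` U i \<subseteq> U i" using dU Uc by blast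
      show "B \<subseteq> U i" by (auto simp: B_def)
      show "b u v = \<one>\<^bsub>W\<^esub>" if "u \<in> d ` U i" "v \<in> B" for u v
        using that Uc self by (auto simp: B_def)
      show "U i \<subseteq> d ` U i <#>\<^bsub>V\<^esub> B"
      proof
        fix w assume w: "w \<in> U i"
        have c: "w \<in> carrier V" "d w \<in> carrier V" using Uc w dD(1) by auto
        have "w \<otimes>\<^bsub>V\<^esub> inv\<^bsub>V\<^esub> (d w) \<in> B"
          using subgroup.m_closed[OF Us w subgroup.m_inv_closed[OF Us dU[OF c(1)]]] c dd
          by (simp add: B_def d.hom_inv)
        \<comment> \<open>The idempotent splitting of \<open>w\<close> into an image part and a
          kernel part, written multiplicatively.\<close>
        moreover have "w = d w \<otimes>\<^bsub>V\<^esub> (w \<otimes>\<^bsub>V\<^esub> inv\<^bsub>V\<^esub> (d w))"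
          using c by (simp add: V.m_lcomm)
        ultimately show "w \<in> d ` U i <#>\<^bsub>V\<^esub> B" unfolding set_mult_def using w by blast
      qed
    qed
    then show ?thesis
    proof
      assume im: "d ` U i = U i"
      have dw: "d w = w" if "w \<in> U i" for w
      proof -
        have "w \<in> d ` U i" using im that by simp
        then obtain u where "u \<in> U i" "w = d u" by blast
        then show ?thesis using dd Uc by simp
      qed
      then have "d u = proj i u" if "u \<in> carrier V" for u using ed[OF that] dw[OF proj_in_U[OF i that]] by simp
      then have "d = proj i" by (rule endos_eqI[OF dE proj_endos[OF i]])
      then show ?thesis ..
    next
      assume B: "B = U i"
      have "d u = \<zero>\<^bsub>adj_ring\<^esub> u" if u: "u \<in> carrier V" for u
      proof -
        have "proj i u \<in> B" unfolding B using proj_in_U[OF i u] .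
        then show ?thesis using ed[OF u] u by (simp add: B_def adj_ring_simps(4))
      qed
      then have "d = \<zero>\<^bsub>adj_ring\<^esub>" by (rule endos_eqI[OF dE adjointableD(1)[OF adj_ring_const(1)]])
      then show ?thesis ..
    qed
  qed
  then show ?thesis
    unfolding A.primitive_def adj_ring_simps(1)
    using proj_adjointable[OF i] proj_nonzero[OF i] proj_mult[OF i i] by simp
qed

lemma frame_proj: "A.frame (proj ` K)"
  unfolding A.frame_def
proof (intro conjI ballI impI)
  show "finite (proj ` K)" using finite_K by simp
  show "A.primitive e" if "e \<in> proj ` K" for e using that proj_primitive by blast
  show "e \<otimes>\<^bsub>adj_ring\<^esub> f = \<zero>\<^bsub>adj_ring\<^esub>" if "e \<in> proj ` K" "f \<in> proj ` K" "e \<noteq> f" for e f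
    using that proj_mult by auto
  have "(\<Oplus>\<^bsub>adj_ring\<^esub>e\<in>proj ` K. e) = (\<Oplus>\<^bsub>adj_ring\<^esub>i\<in>K. proj i)"
    by (rule A.finsum_reindex) (use proj_adjointable(1) proj_inj in \<open>auto simp: adj_ring_simps(1)\<close>)
  then show "(\<Oplus>\<^bsub>adj_ring\<^esub>e\<in>proj ` K. e) = \<one>\<^bsub>adj_ring\<^esub>" using sum_proj by simp
qed

lemma card_frame_proj: "card (proj ` K) = card K"
  using card_image[OF proj_inj] .

text \<open>Covering is the existence of a maximal *-ideal missing a given member, disjointness is
  its uniqueness, and no block is empty because a frame lies in no proper *-ideal. Nonempty blocks
  also give injectivity.\<close>

lemma partition_by_max_ideals:
  defines "KI \<equiv> \<lambda>I. {i \<in> K. proj i \<notin> I}"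
  shows "partition_on K (KI ` {I. A.max_invol_ideal I}) \<and> inj_on KI {I. A.max_invol_ideal I}"
proof
  let ?M = "{I. A.max_invol_ideal I}"
  have ex: "\<exists>i \<in> K. proj i \<notin> I" if "I \<in> ?M" for I
  proof -
    have "A.invol_ideal I" "I \<noteq> carrier adj_ring" using that by (auto simp: A.max_invol_ideal_def)
    then obtain e where "e \<in> proj ` K" "e \<notin> I" by (rule A.frame_not_subset_ideal[OF frame_proj])
    then show ?thesis by blast
  qed
  have uniq: "I = J" if "I \<in> ?M" "J \<in> ?M" "i \<in> K" "proj i \<notin> I" "proj i \<notin> J" for I J i
    using A.max_invol_ideal_unique[OF _ _ proj_primitive[OF that(3)] that(4,5)] that(1,2) by simp
  show "partition_on K (KI ` ?M)"
  proof (rule partition_onI)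
    show "\<Union> (KI ` ?M) = K"
    proof
      show "K \<subseteq> \<Union> (KI ` ?M)"
      proof
        fix i assume i: "i \<in> K"
        obtain I where "A.max_invol_ideal I" "proj i \<notin> I"
          using A.ex_max_invol_ideal[OF frame_proj imageI[OF i]] .
        then show "i \<in> \<Union> (KI ` ?M)" using i by (auto simp: KI_def)
      qed
    qed (auto simp: KI_def)
    show "{} \<notin> KI ` ?M" using ex by (fastforce simp: KI_def)
    show "disjnt p q" if "p \<in> KI ` ?M" "q \<in> KI ` ?M" "p \<noteq> q" for p q
      using that uniq by (auto simp: KI_def disjnt_def)
  qed
  show "inj_on KI ?M"
  proof (rule inj_onI)
    fix I J assume IJ: "I \<in> ?M" "J \<in> ?M" "KI I = KI J"
    obtain i where "i \<in> K" "proj i \<notin> I" using ex[OF IJ(1)] by blast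
    moreover from this have "proj i \<notin> J" using IJ(3) by (auto simp: KI_def)
    ultimately show "I = J" using uniq IJ by blast
  qed
qed

end

section \<open>Groups of class two and odd prime exponent\<close>

context group begin

lemma commuting_set_mult:
  assumes A: "subgroup A G" and B: "subgroup B G"
    and comm: "\<And>a b. a \<in> A \<Longrightarrow> b \<in> B \<Longrightarrow> a \<otimes> b = b \<otimes> a"
  shows "subgroup (A <#> B) G" "generate G (A \<union> B) = A <#> B"
proof -
  have Ac: "a \<in> carrier G" if "a \<in> A" for a using that subgroup.subset[OF A] by blast
  have Bc: "b \<in> carrier G" if "b \<in> B" for b using that subgroup.subset[OF B] by blast
  show sub: "subgroup (A <#> B) G"
  proof (rule subgroupI)
    show "A <#> B \<subseteq> carrier G" using Ac Bc by (auto simp: set_mult_def)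
    show "A <#> B \<noteq> {}"
      using subgroup.one_closed[OF A] subgroup.one_closed[OF B] by (auto simp: set_mult_def)
    fix x assume "x \<in> A <#> B"
    then obtain a b where x: "a \<in> A" "b \<in> B" "x = a \<otimes> b" by (auto simp: set_mult_def)
    have i: "inv a \<in> A" "inv b \<in> B" using subgroup.m_inv_closed[OF A x(1)] subgroup.m_inv_closed[OF B x(2)] .
    have "inv x = inv a \<otimes> inv b" using x Ac Bc comm[OF i] by (simp add: inv_mult_group)
    then show "inv x \<in> A <#> B" using i unfolding set_mult_def by blast
    fix y assume "y \<in> A <#> B"
    then obtain c d where y: "c \<in> A" "d \<in> B" "y = c \<otimes> d" by (auto simp: set_mult_def)
    have "x \<otimes> y = a \<otimes> (b \<otimes> c) \<otimes> d" using x y Ac Bc by (simp add: m_assoc)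
    also have "\<dots> = (a \<otimes> c) \<otimes> (b \<otimes> d)"
      unfolding comm[OF y(1) x(2), symmetric] using x(1,2) y(1,2) Ac Bc by (simp add: m_assoc)
    finally show "x \<otimes> y \<in> A <#> B"
      using subgroup.m_closed[OF A x(1) y(1)] subgroup.m_closed[OF B x(2) y(2)]
      unfolding set_mult_def by blast
  qed
  show "generate G (A \<union> B) = A <#> B"
  proof
    have "a \<in> A <#> B" if "a \<in> A" for a
      using that Ac subgroup.one_closed[OF B] unfolding set_mult_def by force
    moreover have "b \<in> A <#> B" if "b \<in> B" for b
      using that Bc subgroup.one_closed[OF A] unfolding set_mult_def by force
    ultimately show "generate G (A \<union> B) \<subseteq> A <#> B"
      by (intro generate_subgroup_incl sub) blast
    have "a \<otimes> b \<in> generate G (A \<union> B)" if "a \<in> A" "b \<in> B" for a b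
      by (rule generate.eng; rule generate.incl) (use that in auto)
    then show "A <#> B \<subseteq> generate G (A \<union> B)" by (auto simp: set_mult_def)
  qed
qed

lemma card_set_mult_trivial_Int:
  assumes A: "subgroup A G" and B: "subgroup B G" and "A \<inter> B \<subseteq> {\<one>}"
  shows "card (A <#> B) = card A * card B"
proof -
  have Ac: "a \<in> carrier G" if "a \<in> A" for a using that subgroup.subset[OF A] by blast
  have Bc: "b \<in> carrier G" if "b \<in> B" for b using that subgroup.subset[OF B] by blast
  have "inj_on (\<lambda>(a, b). a \<otimes> b) (A \<times> B)"
  proof (rule inj_onI, clarify)
    fix a b a' b' assume ab: "a \<in> A" "b \<in> B" "a' \<in> A" "b' \<in> B" "a \<otimes> b = a' \<otimes> b'"
    note c = Ac[OF ab(1)] Bc[OF ab(2)] Ac[OF ab(3)] Bc[OF ab(4)]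
    have "inv a' \<otimes> a = inv a' \<otimes> (a \<otimes> b) \<otimes> inv b" using c by (simp add: m_assoc)
    also have "\<dots> = b' \<otimes> inv b" unfolding ab(5) using c by (simp add: m_assoc[symmetric])
    finally have *: "inv a' \<otimes> a = b' \<otimes> inv b" .
    have "inv a' \<otimes> a \<in> A" using ab A by (simp add: subgroup.m_closed subgroup.m_inv_closed)
    moreover have "inv a' \<otimes> a \<in> B" unfolding * using ab B by (simp add: subgroup.m_closed subgroup.m_inv_closed)
    ultimately have 1: "inv a' \<otimes> a = \<one>" using assms(3) by blast
    have "a = a' \<otimes> (inv a' \<otimes> a)" using c by (simp add: m_assoc[symmetric])
    then have "a = a'" unfolding 1 using c by simp
    then show "a = a' \<and> b = b'" using c ab(5) by simp
  qed
  then have "card ((\<lambda>(a, b). a \<otimes> b) ` (A \<times> B)) = card (A \<times> B)" by (rule card_image)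
  moreover have "(\<lambda>(a, b). a \<otimes> b) ` (A \<times> B) = A <#> B" by (auto simp: set_mult_def)
  ultimately show ?thesis by (simp add: card_cartesian_product)
qed

lemma commute_generate:
  assumes "S \<subseteq> carrier G" "x \<in> carrier G" "\<And>s. s \<in> S \<Longrightarrow> x \<otimes> s = s \<otimes> x" "g \<in> generate G S"
  shows "x \<otimes> g = g \<otimes> x"
proof -
  have "subgroup {g \<in> carrier G. x \<otimes> g = g \<otimes> x} G"
  proof (rule subgroupI)
    fix a assume a: "a \<in> {g \<in> carrier G. x \<otimes> g = g \<otimes> x}"
    have ac: "a \<in> carrier G" using a by simp
    have "inv a \<otimes> (x \<otimes> a) \<otimes> inv a = inv a \<otimes> (a \<otimes> x) \<otimes> inv a" using a by simp
    moreover have "inv a \<otimes> (x \<otimes> a) \<otimes> inv a = inv a \<otimes> x" using ac assms(2) by (simp add: m_assoc)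
    moreover have "inv a \<otimes> (a \<otimes> x) \<otimes> inv a = x \<otimes> inv a" using ac assms(2) by (simp add: m_assoc[symmetric])
    ultimately show "inv a \<in> {g \<in> carrier G. x \<otimes> g = g \<otimes> x}" using a by simp
    fix c assume c: "c \<in> {g \<in> carrier G. x \<otimes> g = g \<otimes> x}"
    have cc: "c \<in> carrier G" using c by simp
    have "x \<otimes> (a \<otimes> c) = (x \<otimes> a) \<otimes> c" using ac cc assms(2) by (simp add: m_assoc)
    also have "\<dots> = (a \<otimes> x) \<otimes> c" using a by simp
    also have "\<dots> = a \<otimes> (x \<otimes> c)" using ac cc assms(2) by (simp add: m_assoc)
    also have "\<dots> = a \<otimes> (c \<otimes> x)" using c by simp
    also have "\<dots> = (a \<otimes> c) \<otimes> x" using ac cc assms(2) by (simp add: m_assoc)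
    finally show "a \<otimes> c \<in> {g \<in> carrier G. x \<otimes> g = g \<otimes> x}" using a c by simp
  qed (use assms(2) in \<open>auto intro!: exI[of _ \<one>]\<close>)
  moreover have "S \<subseteq> {g \<in> carrier G. x \<otimes> g = g \<otimes> x}" using assms by auto
  ultimately show ?thesis using generate_subgroup_incl assms(4) by blast
qed

lemma grp_center_subgroup: "subgroup (grp_center G) G"
proof -
  have "grp_center G = {z \<in> carrier G. \<forall>x \<in> carrier G. x \<otimes> z = z \<otimes> x}" by (auto simp: grp_center_def)
  moreover have "subgroup \<dots> G"
  proof (rule subgroupI)
    fix a assume a: "a \<in> {z \<in> carrier G. \<forall>x \<in> carrier G. x \<otimes> z = z \<otimes> x}"
    have "x \<otimes> inv a = inv a \<otimes> x" if "x \<in> carrier G" for x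
    proof (rule commute_generate[of "{a}"])
      show "inv a \<in> generate G {a}" by (rule generate.inv) simp
    qed (use a that in blast)+
    moreover have "inv a \<in> carrier G" using a by blast
    ultimately show "inv a \<in> {z \<in> carrier G. \<forall>x \<in> carrier G. x \<otimes> z = z \<otimes> x}" by blast
    fix c assume c: "c \<in> {z \<in> carrier G. \<forall>x \<in> carrier G. x \<otimes> z = z \<otimes> x}"
    have "x \<otimes> (a \<otimes> c) = a \<otimes> c \<otimes> x" if "x \<in> carrier G" for x
    proof (rule commute_generate[of "{a, c}"])
      show "a \<otimes> c \<in> generate G {a, c}" by (rule generate.eng; rule generate.incl; simp)
    qed (use a c that in blast)+
    moreover have "a \<otimes> c \<in> carrier G" using a c by blast
    ultimately show "a \<otimes> c \<in> {z \<in> carrier G. \<forall>x \<in> carrier G. x \<otimes> z = z \<otimes> x}" by blast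
  qed (auto intro!: exI[of _ \<one>])
  ultimately show ?thesis by simp
qed

lemma centerD:
  assumes "z \<in> grp_center G"
  shows "z \<in> carrier G" "x \<in> carrier G \<Longrightarrow> z \<otimes> x = x \<otimes> z"
  using assms by (auto simp: grp_center_def)

lemma comm_closed [simp]: "x \<in> carrier G \<Longrightarrow> y \<in> carrier G \<Longrightarrow> comm G x y \<in> carrier G"
  by (simp add: comm_def)

lemma mult_comm_eq:
  assumes "x \<in> carrier G" "y \<in> carrier G"
  shows "x \<otimes> y = y \<otimes> x \<otimes> comm G x y"
proof -
  have "y \<otimes> x \<otimes> comm G x y = y \<otimes> (x \<otimes> inv x) \<otimes> inv y \<otimes> x \<otimes> y"
    unfolding comm_def using assms by (simp only: m_assoc inv_closed m_closed)
  then show ?thesis using assms by simp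
qed

lemma comm_eqI:
  assumes "x \<in> carrier G" "y \<in> carrier G" "c \<in> carrier G" "x \<otimes> y = y \<otimes> x \<otimes> c"
  shows "comm G x y = c"
  using mult_comm_eq[OF assms(1,2)] assms l_cancel[of "y \<otimes> x" "comm G x y" c] by simp

lemma comm_in_derived:
  assumes "subgroup H G" "x \<in> H" "y \<in> H"
  shows "comm G x y \<in> derived G H"
proof -
  have c: "x \<in> carrier G" "y \<in> carrier G" using assms(2,3) subgroup.subset[OF assms(1)] by auto
  have i: "inv x \<in> H" "inv y \<in> H" using subgroup.m_inv_closed[OF assms(1)] assms(2,3) by auto
  have "comm G x y = inv x \<otimes> inv y \<otimes> inv (inv x) \<otimes> inv (inv y)" using c by (simp add: comm_def)
  then show ?thesis unfolding derived_def using i by (intro generate.incl) blast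
qed

lemma derived_subset_iff:
  assumes H: "H \<subseteq> carrier G" and S: "subgroup S G"
    and "\<And>x y. x \<in> H \<Longrightarrow> y \<in> H \<Longrightarrow> comm G (inv x) (inv y) \<in> S"
  shows "derived G H \<subseteq> S"
  unfolding derived_def
proof (rule generate_subgroup_incl[OF _ S])
  have "x \<otimes> y \<otimes> inv x \<otimes> inv y = comm G (inv x) (inv y)" if "x \<in> H" "y \<in> H" for x y
    using that H by (simp add: comm_def subset_iff)
  then show "derived_set G H \<subseteq> S" using assms(3) by auto
qed

lemma comm_center_right:
  assumes "x \<in> carrier G" "y \<in> carrier G" "z \<in> grp_center G"
  shows "comm G x (y \<otimes> z) = comm G x y" "comm G (x \<otimes> z) y = comm G x y"
proof -
  note z = centerD[OF assms(3)]
  define c where "c = comm G x y"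
  have c: "c \<in> carrier G" "x \<otimes> y = y \<otimes> x \<otimes> c"
    unfolding c_def using assms(1,2) by (simp, rule mult_comm_eq)
  note cl = assms(1,2) z(1) c(1)
  have "x \<otimes> (y \<otimes> z) = z \<otimes> (x \<otimes> y)" using z(2)[of "x \<otimes> y"] cl by (simp add: m_assoc)
  also have "\<dots> = (z \<otimes> y) \<otimes> x \<otimes> c" unfolding c(2) using cl by (simp add: m_assoc)
  finally have "x \<otimes> (y \<otimes> z) = y \<otimes> z \<otimes> x \<otimes> c" unfolding z(2)[OF assms(2)] .
  then show "comm G x (y \<otimes> z) = comm G x y"
    unfolding c_def[symmetric] using cl by (intro comm_eqI) auto
  have "(x \<otimes> z) \<otimes> y = z \<otimes> (x \<otimes> y)"
    unfolding z(2)[OF assms(1), symmetric] using cl by (simp add: m_assoc)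
  also have "\<dots> = (z \<otimes> y) \<otimes> x \<otimes> c" unfolding c(2) using cl by (simp add: m_assoc)
  also have "\<dots> = y \<otimes> (z \<otimes> x) \<otimes> c" unfolding z(2)[OF assms(2)] using cl by (simp add: m_assoc)
  finally have "(x \<otimes> z) \<otimes> y = y \<otimes> (x \<otimes> z) \<otimes> c" unfolding z(2)[OF assms(1)] .
  then show "comm G (x \<otimes> z) y = comm G x y"
    unfolding c_def[symmetric] using cl by (intro comm_eqI) auto
qed

lemma comm_one_iff:
  assumes "x \<in> carrier G" "y \<in> carrier G"
  shows "comm G x y = \<one> \<longleftrightarrow> x \<otimes> y = y \<otimes> x"
proof
  assume "comm G x y = \<one>"
  then show "x \<otimes> y = y \<otimes> x" using mult_comm_eq[OF assms] assms by simp
qed (use comm_eqI[OF assms one_closed] assms in simp)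

text \<open>If both factors were proper, no proper subfamily of \<open>{A, B}\<close> would generate
  \<open>H\<close>, so the pair would be a central decomposition other than
  \<open>{H}\<close>.\<close>

lemma indecomposable_factor:
  assumes H: "subgroup H G" and indec: "centrally_indecomposable (subgrp G H)"
    and A: "subgroup A G" "A \<subseteq> H" and B: "subgroup B G" "B \<subseteq> H"
    and comm: "\<And>a b. a \<in> A \<Longrightarrow> b \<in> B \<Longrightarrow> a \<otimes> b = b \<otimes> a" and gen: "generate G (A \<union> B) = H"
  shows "A = H \<or> B = H"
proof (rule ccontr)
  assume *: "\<not> (A = H \<or> B = H)"
  have cons: "generate (subgrp G H) S = generate G S" if "S \<subseteq> H" for S
    using generate_consistent[OF that H] .
  have gA: "generate G A = A" and gB: "generate G B = B"
    using generate_subgroup_incl[OF subset_refl A(1)] generate_subgroup_incl[OF subset_refl B(1)]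
    by (auto intro: generate.incl)
  have "central_decomp (subgrp G H) {A, B}"
    unfolding central_decomp_def
  proof (intro conjI ballI allI impI)
    show "subgroup S (subgrp G H)" if "S \<in> {A, B}" for S
      using that A B H subgroup_incl by blast
    show "h \<otimes>\<^bsub>subgrp G H\<^esub> k = k \<otimes>\<^bsub>subgrp G H\<^esub> h"
      if "S \<in> {A, B}" "T \<in> {A, B}" "S \<noteq> T" "h \<in> S" "k \<in> T" for S T h k
      using that comm by auto
    show "generate (subgrp G H) (\<Union>{A, B}) = carrier (subgrp G H)"
      using cons[of "A \<union> B"] gen A(2) B(2) by simp
    fix \<H>' assume "\<H>' \<subset> {A, B}"
    then have "\<H>' = {} \<or> \<H>' = {A} \<or> \<H>' = {B}" by blast
    moreover have "generate G {} \<subseteq> A" using generate_subgroup_incl[OF _ A(1)] by blast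
    ultimately show "generate (subgrp G H) (\<Union>\<H>') \<noteq> carrier (subgrp G H)"
      using cons[of "\<Union>\<H>'"] A(2) B(2) gA gB * by auto
  qed
  then have "{A, B} = {H}" using indec unfolding centrally_indecomposable_def by fastforce
  then show False using * by blast
qed

end

section \<open>Groups of class at most two: bilinear commutators and splitting off central
  elements\<close>

locale odd_exponent_class2_group = group P for P (structure) +
  fixes p :: nat
  assumes p_prime: "Factorial_Ring.prime p" and p_odd: "odd p"
    and finite_P: "finite (carrier P)"
    and derived_central: "derived P (carrier P) \<subseteq> grp_center P"
    and exponent_p: "x \<in> carrier P \<Longrightarrow> x [^] p = \<one>"
begin

lemma comm_central:
  assumes "x \<in> carrier P" "y \<in> carrier P" shows "comm P x y \<in> grp_center P"
  using comm_in_derived[OF subgroup_self] assms derived_central by blast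

lemma comm_mult_left:
  assumes "x \<in> carrier P" "y \<in> carrier P" "z \<in> carrier P"
  shows "comm P (x \<otimes> y) z = comm P x z \<otimes> comm P y z"
proof (rule comm_eqI)
  define c where "c = comm P x z"
  define d where "d = comm P y z"
  have c: "c \<in> carrier P" "x \<otimes> z = z \<otimes> x \<otimes> c" "\<And>u. u \<in> carrier P \<Longrightarrow> c \<otimes> u = u \<otimes> c"
    unfolding c_def
    using comm_closed[OF assms(1,3)] mult_comm_eq[OF assms(1,3)] centerD(2)[OF comm_central[OF assms(1,3)]] .
  have d: "d \<in> carrier P" "y \<otimes> z = z \<otimes> y \<otimes> d"
    unfolding d_def using comm_closed[OF assms(2,3)] mult_comm_eq[OF assms(2,3)] .
  have "x \<otimes> y \<otimes> z = x \<otimes> (z \<otimes> y \<otimes> d)" using assms d by (simp add: m_assoc)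
  also have "\<dots> = (x \<otimes> z) \<otimes> (y \<otimes> d)" using assms d(1) by (simp add: m_assoc)
  also have "\<dots> = z \<otimes> x \<otimes> (c \<otimes> y) \<otimes> d" unfolding c(2) using assms c(1) d(1) by (simp add: m_assoc)
  also have "\<dots> = z \<otimes> x \<otimes> (y \<otimes> c) \<otimes> d" using c(3)[OF assms(2)] by simp
  also have "\<dots> = z \<otimes> (x \<otimes> y) \<otimes> (c \<otimes> d)" using assms c(1) d(1) by (simp add: m_assoc)
  finally show "x \<otimes> y \<otimes> z = z \<otimes> (x \<otimes> y) \<otimes> (comm P x z \<otimes> comm P y z)" by (simp add: c_def d_def)
qed (use assms in auto)

lemma comm_mult_right:
  assumes "x \<in> carrier P" "y \<in> carrier P" "z \<in> carrier P"
  shows "comm P z (x \<otimes> y) = comm P z x \<otimes> comm P z y"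
proof (rule comm_eqI)
  define c where "c = comm P z x"
  define d where "d = comm P z y"
  have c: "c \<in> carrier P" "z \<otimes> x = x \<otimes> z \<otimes> c" "\<And>u. u \<in> carrier P \<Longrightarrow> c \<otimes> u = u \<otimes> c"
    unfolding c_def
    using comm_closed[OF assms(3,1)] mult_comm_eq[OF assms(3,1)] centerD(2)[OF comm_central[OF assms(3,1)]] .
  have d: "d \<in> carrier P" "z \<otimes> y = y \<otimes> z \<otimes> d"
    unfolding d_def using comm_closed[OF assms(3,2)] mult_comm_eq[OF assms(3,2)] .
  have "z \<otimes> (x \<otimes> y) = (z \<otimes> x) \<otimes> y" using assms by (simp add: m_assoc)
  also have "\<dots> = x \<otimes> z \<otimes> (c \<otimes> y)" unfolding c(2) using assms c(1) by (simp add: m_assoc)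
  also have "\<dots> = x \<otimes> z \<otimes> (y \<otimes> c)" using c(3)[OF assms(2)] by simp
  also have "\<dots> = x \<otimes> (z \<otimes> y) \<otimes> c" using assms c(1) by (simp add: m_assoc)
  also have "\<dots> = x \<otimes> y \<otimes> z \<otimes> (d \<otimes> c)" unfolding d(2) using assms c(1) d(1) by (simp add: m_assoc)
  also have "\<dots> = x \<otimes> y \<otimes> z \<otimes> (c \<otimes> d)" using c(3)[OF d(1)] by simp
  finally show "z \<otimes> (x \<otimes> y) = x \<otimes> y \<otimes> z \<otimes> (comm P z x \<otimes> comm P z y)" by (simp add: c_def d_def)
qed (use assms in auto)

text \<open>Inverses are the powers with exponent \<open>p - 1\<close>, which is positive.\<close>

lemma subgroup_if_closed:
  assumes "S \<subseteq> carrier P" "S \<noteq> {}" "\<And>x y. x \<in> S \<Longrightarrow> y \<in> S \<Longrightarrow> x \<otimes> y \<in> S"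
  shows "subgroup S P"
proof (rule subgroupI)
  fix x assume x: "x \<in> S"
  then have c: "x \<in> carrier P" using assms(1) by blast
  have "x [^] Suc k \<in> S" for k :: nat
    by (induction k) (use x c assms(3) in auto)
  moreover obtain k where k: "p = Suc (Suc k)"
    using le_Suc_ex[OF prime_ge_2_nat[OF p_prime]] by auto
  moreover have "inv x = x [^] Suc k"
    using exponent_p[OF c] c by (intro inv_equality) (auto simp: k)
  ultimately show "inv x \<in> S" by simp
qed (use assms in auto)

text \<open>\<open>M\<close> is maximal among the subgroups between \<open>H'\<close> and \<open>H\<close> that miss \<open>z\<close>.\<close>
lemma ex_complement:
  assumes H: "subgroup H P" and z: "z \<in> H" "z \<in> grp_center P" "z \<notin> derived P H"
  obtains M where "subgroup M P" "M \<subseteq> H" "z \<notin> M" "H \<subseteq> M <#> generate P {z}"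
proof -
  have Hc: "x \<in> carrier P" if "x \<in> H" for x using that subgroup.subset[OF H] by blast
  note zc = centerD[OF z(2)]
  let ?S = "{M. subgroup M P \<and> derived P H \<subseteq> M \<and> M \<subseteq> H \<and> z \<notin> M}"
  have "finite ?S" by (rule finite_subset[of _ "Pow (carrier P)"]) (use finite_P Hc in auto)
  moreover have "derived P H \<in> ?S"
    using z(3) derived_is_subgroup[OF subgroup.subset[OF H]] derived_incl[OF _ H] by auto
  ultimately have "\<exists>M\<in>?S. \<forall>N\<in>?S. M \<subseteq> N \<longrightarrow> M = N"
    by (intro finite_has_maximal) auto
  then obtain M where M: "M \<in> ?S" and maximal: "\<forall>N\<in>?S. M \<subseteq> N \<longrightarrow> M = N" by (rule bexE)
  have Ms: "subgroup M P" and Md: "derived P H \<subseteq> M" and MH: "M \<subseteq> H" and zM: "z \<notin> M" using M by simp_all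
  have Zs: "subgroup (generate P {z}) P" using zc by (intro generate_is_subgroup) auto
  have Zg: "g \<otimes> w = w \<otimes> g" if "g \<in> carrier P" "w \<in> generate P {z}" for g w
    by (rule commute_generate[of "{z}"]) (use that zc in auto)
  have L: "subgroup (M <#> generate P {z}) P"
    by (rule commuting_set_mult(1)[OF Ms Zs]) (use Zg MH Hc in blast)
  have memL: "m \<in> M <#> generate P {z}" if "m \<in> M" for m
    using that MH Hc subgroup.one_closed[OF Zs] unfolding set_mult_def by force
  have zL: "z \<in> M <#> generate P {z}"
    using zc subgroup.one_closed[OF Ms] generate.incl[of z "{z}" P] unfolding set_mult_def by force
  have "x \<in> M <#> generate P {z}" if x: "x \<in> H" "x \<notin> M" for x
  proof -
    note xc = Hc[OF x(1)]
    \<comment> \<open>\<open>N\<close> is \<open>M\<close> extended by the powers of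
      \<open>x\<close>. Reordering products costs commutators in \<open>H'\<close>, which is why the
      subgroups in \<open>?S\<close> are required to contain \<open>H'\<close>.\<close>
    define N where "N = {m \<otimes> x [^] k | m k. m \<in> M \<and> k \<in> (UNIV :: nat set)}"
    have xk: "x [^] k \<in> H" for k :: nat
      by (induction k) (use subgroup.one_closed[OF H] subgroup.m_closed[OF H] x in auto)
    have NH: "N \<subseteq> H" using subgroup.m_closed[OF H] MH xk by (auto simp: N_def)
    have Ns: "subgroup N P"
    proof (rule subgroup_if_closed)
      show "N \<subseteq> carrier P" using NH Hc by blast
      show "N \<noteq> {}" using subgroup.one_closed[OF Ms] by (auto simp: N_def)
      fix u v assume "u \<in> N" "v \<in> N"
      then obtain m n and k j :: nat where uv: "m \<in> M" "n \<in> M" "u = m \<otimes> x [^] k" "v = n \<otimes> x [^] j"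
        by (auto simp: N_def)
      define c where "c = comm P (x [^] k) n"
      have nH: "n \<in> H" using uv MH by blast
      have mc: "m \<in> carrier P" "n \<in> carrier P" using uv MH Hc by auto
      have cM: "c \<in> M" unfolding c_def using comm_in_derived[OF H xk nH] Md by blast
      have cc: "c \<in> carrier P" using cM MH Hc by blast
      have comm: "x [^] k \<otimes> n = n \<otimes> x [^] k \<otimes> c" unfolding c_def by (rule mult_comm_eq) (use xc mc in auto)
      have ccomm: "x [^] k \<otimes> c = c \<otimes> x [^] k"
        using centerD(2)[OF comm_central[of "x [^] k" n], folded c_def] xc mc by simp
      have "u \<otimes> v = m \<otimes> (x [^] k \<otimes> n) \<otimes> x [^] j" using uv mc xc by (simp add: m_assoc)
      also have "\<dots> = m \<otimes> n \<otimes> (x [^] k \<otimes> c) \<otimes> x [^] j" unfolding comm using mc xc cc by (simp add: m_assoc)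
      also have "\<dots> = (m \<otimes> n \<otimes> c) \<otimes> (x [^] k \<otimes> x [^] j)" unfolding ccomm using mc xc cc by (simp add: m_assoc)
      also have "\<dots> = (m \<otimes> n \<otimes> c) \<otimes> x [^] (k + j)" using xc by (simp add: nat_pow_mult)
      finally show "u \<otimes> v \<in> N" using uv cM subgroup.m_closed[OF Ms] unfolding N_def by blast
    qed
    have MN: "M \<subseteq> N"
    proof
      fix m assume "m \<in> M"
      moreover from this have "m = m \<otimes> x [^] (0::nat)" using MH Hc by auto
      ultimately show "m \<in> N" unfolding N_def by blast
    qed
    have "x = \<one> \<otimes> x [^] (1::nat)" using xc by simp
    then have xN: "x \<in> N" using subgroup.one_closed[OF Ms] unfolding N_def by blast
    have "z \<in> N"
    proof (rule ccontr)
      assume "z \<notin> N"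
      then have "N \<in> ?S" using Ns NH order_trans[OF Md MN] by simp
      then have "M = N" using maximal MN by simp
      then show False using xN x(2) by simp
    qed
    then obtain m and k :: nat where mk: "m \<in> M" "z = m \<otimes> x [^] k" by (auto simp: N_def)
    have mc: "m \<in> carrier P" using mk MH Hc by blast
    have xk_eq: "x [^] k = inv m \<otimes> z" using mk mc xc by (simp add: m_assoc[symmetric])
    \<comment> \<open>Maximality of \<open>M\<close> has put \<open>z = m x^k\<close> into
      \<open>N\<close>; if \<open>p\<close> divided \<open>k\<close>, then \<open>z = m\<close>
      would lie in \<open>M\<close>.\<close>
    have "\<not> p dvd k"
    proof
      assume "p dvd k"
      then obtain t where "k = p * t" by (elim dvdE)
      then have "x [^] k = \<one>" using xc exponent_p nat_pow_pow[of x p t] by simp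
      then show False using mk mc zM by simp
    qed
    then have "coprime p k" using p_prime prime_imp_coprime_nat by blast
    then have "gcd k p = 1" by (simp add: coprime_iff_gcd_eq_1 gcd.commute)
    moreover have "k \<noteq> 0" using \<open>\<not> p dvd k\<close> by (metis dvd_0_right)
    \<comment> \<open>With \<open>l\<close> an inverse of \<open>k\<close> modulo \<open>p\<close>,
      the element \<open>x\<close> is a power of \<open>x^k\<close>, and
      \<open>x^k = inv m z\<close> lies in the product of \<open>M\<close> and the group generated
      by \<open>z\<close>.\<close>
    ultimately obtain l t where lt: "k * l = p * t + 1" using bezout_nat[of k p] by auto
    have "(x [^] k) [^] l = x [^] (p * t) \<otimes> x" using xc lt by (simp add: nat_pow_pow)
    also have "\<dots> = x" using xc exponent_p nat_pow_pow[of x p t] by simp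
    finally have x_eq: "(x [^] k) [^] l = x" .
    have "inv m \<otimes> z \<in> M <#> generate P {z}"
      using subgroup.m_closed[OF L] memL[OF subgroup.m_inv_closed[OF Ms mk(1)]] zL by blast
    then have "(x [^] k) [^] l \<in> M <#> generate P {z}"
      unfolding xk_eq by (induction l) (use subgroup.one_closed[OF L] subgroup.m_closed[OF L] in auto)
    then show ?thesis unfolding x_eq .
  qed
  then have "H \<subseteq> M <#> generate P {z}" using memL by blast
  then show thesis using that Ms MH zM by blast
qed

text \<open>\<open>H\<close> is the commuting product of \<open>M\<close> and the group generated by
  \<open>z\<close>; as \<open>M\<close> misses \<open>z\<close>, the other factor must be
  \<open>H\<close>.\<close>

lemma indecomposable_central_element:
  assumes H: "subgroup H P" and indec: "centrally_indecomposable (subgrp P H)"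
    and z: "z \<in> H" "z \<in> grp_center P" "z \<notin> derived P H"
  shows "H = generate P {z}"
proof -
  obtain M where M: "subgroup M P" "M \<subseteq> H" "z \<notin> M" "H \<subseteq> M <#> generate P {z}"
    using ex_complement[OF assms(1,3-5)] .
  note zc = centerD[OF z(2)]
  have Zs: "subgroup (generate P {z}) P" using zc by (intro generate_is_subgroup) auto
  have ZH: "generate P {z} \<subseteq> H" using generate_subgroup_incl[OF _ H] z(1) by simp
  have comm: "m \<otimes> w = w \<otimes> m" if "m \<in> M" "w \<in> generate P {z}" for m w
    by (rule commute_generate[of "{z}"]) (use that zc subgroup.subset[OF M(1)] in auto)
  have "generate P (M \<union> generate P {z}) = M <#> generate P {z}"
    using commuting_set_mult(2)[OF M(1) Zs comm] by blast
  moreover have "M <#> generate P {z} \<subseteq> H"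
    using M(2) ZH subgroup.m_closed[OF H] by (auto simp: set_mult_def)
  ultimately have "generate P (M \<union> generate P {z}) = H" using M(4) by blast
  then have "M = H \<or> generate P {z} = H"
    using indecomposable_factor[OF H indec M(1,2) Zs ZH] comm by blast
  then show ?thesis using M(3) z(1) by blast
qed

end

section \<open>Fully refined central decompositions\<close>

locale fully_refined_decomposition = odd_exponent_class2_group P p for P (structure) and p +
  fixes \<H> :: "'a set set"
  assumes refined: "fully_refined P \<H>"
begin

abbreviation "\<C> \<equiv> central_part P \<H>"
abbreviation "\<K> \<equiv> \<H> - \<C>"
abbreviation "Z \<equiv> grp_center P"
abbreviation "D \<equiv> derived P (carrier P)"

definition Q :: "'a set" where "Q = generate P (\<Union>\<K>)"

lemma member_subgroup: "H \<in> \<H> \<Longrightarrow> subgroup H P"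
  and members_commute: "H \<in> \<H> \<Longrightarrow> K \<in> \<H> \<Longrightarrow> H \<noteq> K \<Longrightarrow> h \<in> H \<Longrightarrow> k \<in> K \<Longrightarrow> h \<otimes> k = k \<otimes> h"
  and generate_members: "generate P (\<Union>\<H>) = carrier P"
  and minimal: "\<H>' \<subset> \<H> \<Longrightarrow> generate P (\<Union>\<H>') \<noteq> carrier P"
  and member_indecomposable: "H \<in> \<H> \<Longrightarrow> centrally_indecomposable (subgrp P H)"
  using refined unfolding fully_refined_def central_decomp_def by simp_all

lemma member_carrier: "H \<in> \<H> \<Longrightarrow> h \<in> H \<Longrightarrow> h \<in> carrier P"
  using subgroup.subset[OF member_subgroup] by blast

lemma Union_carrier: "\<S> \<subseteq> \<H> \<Longrightarrow> \<Union>\<S> \<subseteq> carrier P"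
  using member_carrier by blast

lemma finite_members: "finite \<H>"
  by (rule finite_subset[of _ "Pow (carrier P)"]) (use member_carrier finite_P in auto)

lemma Z_subgroup: "subgroup Z P"
  by (rule grp_center_subgroup)

lemma D_subgroup: "subgroup D P"
  by (rule derived_is_subgroup) simp

lemma Q_subgroup: "subgroup Q P"
  unfolding Q_def by (rule generate_is_subgroup[OF Union_carrier]) blast

lemma Q_carrier: "q \<in> Q \<Longrightarrow> q \<in> carrier P"
  using subgroup.subset[OF Q_subgroup] by blast

lemma derived_member_subset: "H \<in> \<H> \<Longrightarrow> derived P H \<subseteq> D"
  by (rule mono_derived[OF subgroup.subset[OF member_subgroup]])

text \<open>A central element of \<open>H\<close> outside \<open>P'\<close>, a fortiori outside
  \<open>H'\<close>, would generate \<open>H\<close> and make \<open>H\<close> central.\<close>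

lemma noncentral_member_Int_center:
  assumes "H \<in> \<K>" "z \<in> H" "z \<in> Z"
  shows "z \<in> D"
proof (rule ccontr)
  assume "z \<notin> D"
  then have "z \<notin> derived P H" using derived_member_subset assms(1) by blast
  then have "H = generate P {z}"
    using indecomposable_central_element[of H z] member_subgroup member_indecomposable assms by blast
  then have "H \<subseteq> Z" using generate_subgroup_incl[of "{z}" Z] Z_subgroup assms(3) by simp
  then show False using assms(1) by (simp add: central_part_def)
qed

text \<open>A central member is abelian, so its derived subgroup is trivial and any nontrivial
  element generates it.\<close>

lemma central_member_cyclic:
  assumes "C \<in> \<C>" "z \<in> C" "z \<noteq> \<one>"
  shows "C = generate P {z}"
proof -
  have C: "C \<in> \<H>" "C \<subseteq> Z" using assms(1) by (auto simp: central_part_def)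
  have "derived P C \<subseteq> {\<one>}"
  proof (rule derived_subset_iff)
    fix x y assume xy: "x \<in> C" "y \<in> C"
    then have c: "x \<in> carrier P" "y \<in> carrier P" using member_carrier C by auto
    have "inv x \<in> Z" using C(2) xy(1) subgroup.m_inv_closed[OF Z_subgroup] by blast
    then have "inv x \<otimes> inv y = inv y \<otimes> inv x" using c by (intro centerD(2)) auto
    then show "comm P (inv x) (inv y) \<in> {\<one>}" using comm_one_iff[of "inv x" "inv y"] c by simp
  qed (use member_carrier C triv_subgroup in auto)
  then show ?thesis
    using indecomposable_central_element[OF member_subgroup[OF C(1)] member_indecomposable[OF C(1)] assms(2)]
      C(2) assms(2,3) by blast
qed

text \<open>A trivial member could be dropped without changing the generated group, against
  minimality.\<close>

lemma member_nontrivial: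
  assumes "H \<in> \<H>" shows "H \<noteq> {\<one>}"
proof
  assume H: "H = {\<one>}"
  have sub: "subgroup (generate P (\<Union>(\<H> - {H}))) P"
    by (rule generate_is_subgroup[OF Union_carrier]) blast
  have "\<Union>\<H> \<subseteq> generate P (\<Union>(\<H> - {H}))"
  proof
    fix x assume "x \<in> \<Union>\<H>"
    then have "x = \<one> \<or> x \<in> \<Union>(\<H> - {H})" using H by blast
    then show "x \<in> generate P (\<Union>(\<H> - {H}))" by (auto intro: generate.one generate.incl)
  qed
  then have "carrier P \<subseteq> generate P (\<Union>(\<H> - {H}))"
    using generate_subgroup_incl[OF _ sub] generate_members by blast
  then have "generate P (\<Union>(\<H> - {H})) = carrier P" using subgroup.subset[OF sub] by blast
  then show False using minimal[of "\<H> - {H}"] assms by blast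
qed

lemma central_member_card:
  assumes "C \<in> \<C>" shows "card C = p"
proof -
  have C: "C \<in> \<H>" using assms by (simp add: central_part_def)
  have "\<one> \<in> C" using subgroup.one_closed[OF member_subgroup[OF C]] .
  then obtain z where z: "z \<in> C" "z \<noteq> \<one>" using member_nontrivial[OF C] by blast
  have zc: "z \<in> carrier P" using member_carrier[OF C z(1)] .
  have "ord z dvd p" using pow_eq_id[OF zc] exponent_p[OF zc] by simp
  moreover have "ord z \<noteq> 1" using ord_eq_1[OF zc] z(2) by simp
  ultimately have "ord z = p" using p_prime prime_nat_iff by blast
  then show ?thesis using central_member_cyclic[OF assms z] generate_pow_card[OF zc] by simp
qed

lemma carrier_eq_Q_mult_Z:
  assumes "g \<in> carrier P"
  obtains q c where "q \<in> Q" "c \<in> generate P (\<Union>\<C>)" "c \<in> Z" "g = q \<otimes> c"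
proof -
  have Cs: "subgroup (generate P (\<Union>\<C>)) P"
    by (rule generate_is_subgroup[OF Union_carrier]) (auto simp: central_part_def)
  have CZ: "generate P (\<Union>\<C>) \<subseteq> Z"
    by (rule generate_subgroup_incl[OF _ Z_subgroup]) (auto simp: central_part_def)
  have sub: "subgroup (Q <#> generate P (\<Union>\<C>)) P"
  proof (rule commuting_set_mult(1)[OF Q_subgroup Cs])
    fix q c assume "q \<in> Q" "c \<in> generate P (\<Union>\<C>)"
    then show "q \<otimes> c = c \<otimes> q" using centerD(2)[of c q] CZ Q_carrier by auto
  qed
  have "h \<in> Q <#> generate P (\<Union>\<C>)" if H: "H \<in> \<H>" "h \<in> H" for h H
  proof (cases "H \<in> \<C>")
    case True
    then have "h \<in> generate P (\<Union>\<C>)" using H by (intro generate.incl) blast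
    moreover have "h = \<one> \<otimes> h" using member_carrier H by simp
    ultimately show ?thesis using subgroup.one_closed[OF Q_subgroup] unfolding set_mult_def by blast
  next
    case False
    then have "h \<in> Q" using H unfolding Q_def by (intro generate.incl) blast
    moreover have "h = h \<otimes> \<one>" using member_carrier H by simp
    ultimately show ?thesis using subgroup.one_closed[OF Cs] unfolding set_mult_def by blast
  qed
  then have "carrier P \<subseteq> Q <#> generate P (\<Union>\<C>)"
    using generate_subgroup_incl[OF _ sub, of "\<Union>\<H>"] generate_members by blast
  then obtain q c where "q \<in> Q" "c \<in> generate P (\<Union>\<C>)" "g = q \<otimes> c"
    using assms unfolding set_mult_def by blast
  then show thesis using that CZ by blast
qed

text \<open>Every element of \<open>P\<close> is an element of \<open>Q\<close> times a central one,
  and central factors disappear from commutators.\<close>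

lemma derived_Q: "derived P Q = D"
proof
  show "derived P Q \<subseteq> D" using mono_derived[of Q "carrier P"] Q_carrier by blast
  show "D \<subseteq> derived P Q"
  proof (rule derived_subset_iff)
    show "subgroup (derived P Q) P" using derived_is_subgroup Q_carrier by blast
    fix x y assume "x \<in> carrier P" "y \<in> carrier P"
    then have c: "inv x \<in> carrier P" "inv y \<in> carrier P" by auto
    obtain q z where q: "q \<in> Q" "z \<in> Z" "inv x = q \<otimes> z" using carrier_eq_Q_mult_Z[OF c(1)] by metis
    obtain q' z' where q': "q' \<in> Q" "z' \<in> Z" "inv y = q' \<otimes> z'" using carrier_eq_Q_mult_Z[OF c(2)] by metis
    have "comm P (inv x) (inv y) = comm P q q'"
      unfolding q(3) q'(3) using q q' Q_carrier centerD(1) by (simp add: comm_center_right)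
    then show "comm P (inv x) (inv y) \<in> derived P Q"
      using comm_in_derived[OF Q_subgroup q(1) q'(1)] by simp
  qed simp
qed

lemma D_subset_Q: "D \<subseteq> Q"
  unfolding derived_Q[symmetric] by (rule derived_incl[OF subset_refl Q_subgroup])

text \<open>Split a central \<open>q = h r\<close> with \<open>h\<close> in one member and
  \<open>r\<close> in the product of the others. Then \<open>h\<close> commutes with the other
  members and, because \<open>q\<close> and \<open>r\<close> do, with its own; so \<open>h\<close>
  is central and in \<open>P'\<close>, and the induction applies to \<open>r\<close>.\<close>

lemma central_product_Int_center:
  assumes "finite \<S>" "\<S> \<subseteq> \<K>" "q \<in> generate P (\<Union>\<S>)" "q \<in> Z"
  shows "q \<in> D"
  using assms
proof (induction \<S> arbitrary: q rule: finite_induct)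
  case empty
  have "q \<in> {\<one>}" using generate_subgroup_incl[OF _ triv_subgroup, of "{}"] empty by auto
  then show ?case using subgroup.one_closed[OF D_subgroup] by simp
next
  case (insert H \<S>)
  have H: "H \<in> \<K>" "H \<in> \<H>" and S: "\<S> \<subseteq> \<H>" using insert.prems by auto
  have Ss: "subgroup (generate P (\<Union>\<S>)) P" by (rule generate_is_subgroup[OF Union_carrier[OF S]])
  have comm: "h \<otimes> r = r \<otimes> h" if "h \<in> H" "r \<in> generate P (\<Union>\<S>)" for h r
  proof (rule commute_generate[OF Union_carrier[OF S] _ _ that(2)])
    show "h \<in> carrier P" using member_carrier H that by blast
    fix s assume "s \<in> \<Union>\<S>"
    then obtain K where K: "K \<in> \<S>" "s \<in> K" by blast
    then have "H \<noteq> K" using insert.hyps(2) by blast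
    then show "h \<otimes> s = s \<otimes> h" using members_commute[OF H(2) _ _ that(1) K(2)] K(1) S by blast
  qed
  have "\<Union>(insert H \<S>) = H \<union> \<Union>\<S>" by simp
  also have "generate P (H \<union> \<Union>\<S>) \<subseteq> generate P (H \<union> generate P (\<Union>\<S>))"
    by (rule mono_generate) (auto intro: generate.incl)
  also have "\<dots> = H <#> generate P (\<Union>\<S>)"
    by (rule commuting_set_mult(2)[OF member_subgroup[OF H(2)] Ss]) (rule comm)
  finally obtain h r where hr: "h \<in> H" "r \<in> generate P (\<Union>\<S>)" "q = h \<otimes> r"
    using insert.prems(2) unfolding set_mult_def by blast
  have c: "h \<in> carrier P" "r \<in> carrier P"
    using member_carrier[OF H(2) hr(1)] subgroup.subset[OF Ss] hr(2) by auto
  have "h \<in> Z"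
  proof -
    have "h \<otimes> g = g \<otimes> h" if g: "g \<in> \<Union>\<H>" for g
    proof -
      obtain K where K: "K \<in> \<H>" "g \<in> K" using g by blast
      have gc: "g \<in> carrier P" using member_carrier K by blast
      show ?thesis
      proof (cases "K = H")
        case False
        then show ?thesis using members_commute[OF H(2) K(1) _ hr(1) K(2)] by simp
      next
        case True
        then have gr: "g \<otimes> r = r \<otimes> g" using comm K(2) hr(2) by blast
        have "h \<otimes> g \<otimes> r = q \<otimes> g" using gr c gc hr(3) by (simp add: m_assoc)
        also have "\<dots> = g \<otimes> h \<otimes> r"
          unfolding centerD(2)[OF insert.prems(3) gc] using c gc hr(3) by (simp add: m_assoc)
        finally show ?thesis using c gc by simp
      qed
    qed
    then have "h \<otimes> g = g \<otimes> h" if "g \<in> carrier P" for g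
      by (rule commute_generate[OF Union_carrier[OF subset_refl] c(1)]) (use that generate_members in auto)
    then show ?thesis using c(1) by (simp add: grp_center_def)
  qed
  moreover have "r = inv h \<otimes> q" using c hr(3) by (simp add: m_assoc[symmetric])
  ultimately have "r \<in> Z"
    using insert.prems(3) subgroup.m_closed[OF Z_subgroup] subgroup.m_inv_closed[OF Z_subgroup] by simp
  then have "r \<in> D" using insert.IH insert.prems(1) hr(2) by simp
  moreover have "h \<in> D" using noncentral_member_Int_center[OF H(1) hr(1) \<open>h \<in> Z\<close>] .
  ultimately show ?case unfolding hr(3) using subgroup.m_closed[OF D_subgroup] by blast
qed

lemma Q_Int_center: "q \<in> Q \<Longrightarrow> q \<in> Z \<Longrightarrow> q \<in> D"
  unfolding Q_def using central_product_Int_center[of \<K>] finite_members by simp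

text \<open>Each new central member \<open>C\<close> contributes a factor \<open>p\<close>, because
  it meets the group built so far trivially. Otherwise a nontrivial common element, a generator of
  \<open>C\<close>, would put \<open>C\<close> inside the group generated by the other
  members.\<close>

lemma card_generate_derived_central:
  assumes "finite \<S>" "\<S> \<subseteq> \<C>"
  shows "card (generate P (D \<union> \<Union>\<S>)) = card D * p ^ card \<S>"
  using assms
proof (induction \<S> rule: finite_induct)
  case empty
  have "generate P D = D"
    using generate_subgroup_incl[OF subset_refl D_subgroup] by (auto intro: generate.incl)
  then show ?case by simp
next
  case (insert C \<S>)
  have C: "C \<in> \<C>" "C \<in> \<H>" "C \<subseteq> Z" and S: "\<S> \<subseteq> \<C>" "\<S> \<subseteq> \<H>"
    using insert.prems by (auto simp: central_part_def)
  define L where "L = generate P (D \<union> \<Union>\<S>)"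
  have DS: "D \<union> \<Union>\<S> \<subseteq> carrier P" using subgroup.subset[OF D_subgroup] Union_carrier[OF S(2)] by blast
  have L: "subgroup L P" unfolding L_def by (rule generate_is_subgroup[OF DS])
  note Cs = member_subgroup[OF C(2)]
  have comm: "l \<otimes> c = c \<otimes> l" if "l \<in> L" "c \<in> C" for l c
    by (rule centerD(2)[symmetric]) (use that C(3) subgroup.subset[OF L] in auto)
  have "generate P (D \<union> \<Union>(insert C \<S>)) = generate P (L \<union> C)"
  proof (rule antisym)
    show "generate P (D \<union> \<Union>(insert C \<S>)) \<subseteq> generate P (L \<union> C)"
      by (rule mono_generate) (auto simp: L_def intro: generate.incl)
    have sub: "subgroup (generate P (D \<union> \<Union>(insert C \<S>))) P"
      using DS subgroup.subset[OF Cs] by (intro generate_is_subgroup) auto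
    have "L \<subseteq> generate P (D \<union> \<Union>(insert C \<S>))" unfolding L_def by (rule mono_generate) auto
    moreover have "C \<subseteq> generate P (D \<union> \<Union>(insert C \<S>))" by (auto intro: generate.incl)
    ultimately show "generate P (L \<union> C) \<subseteq> generate P (D \<union> \<Union>(insert C \<S>))"
      by (intro generate_subgroup_incl[OF _ sub]) simp
  qed
  also have "\<dots> = L <#> C" by (rule commuting_set_mult(2)[OF L Cs comm])
  finally have gen: "generate P (D \<union> \<Union>(insert C \<S>)) = L <#> C" .
  have "L \<inter> C \<subseteq> {\<one>}"
  proof (rule ccontr)
    assume "\<not> L \<inter> C \<subseteq> {\<one>}"
    then obtain z where z: "z \<in> L" "z \<in> C" "z \<noteq> \<one>" by blast
    define M where "M = generate P (\<Union>(\<H> - {C}))"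
    have M: "subgroup M P" unfolding M_def by (rule generate_is_subgroup[OF Union_carrier]) blast
    \<comment> \<open>\<open>P'\<close> survives the removal of \<open>C\<close>, since it lies in
      \<open>Q\<close> and \<open>C\<close> is not among the generators of \<open>Q\<close>.\<close>
    have "Q \<subseteq> M" unfolding Q_def M_def by (rule mono_generate) (use C(1) in blast)
    then have "D \<subseteq> M" using D_subset_Q by blast
    moreover have "\<Union>\<S> \<subseteq> M"
    proof
      fix x assume "x \<in> \<Union>\<S>"
      then have "x \<in> \<Union>(\<H> - {C})" using S(2) insert.hyps(2) by blast
      then show "x \<in> M" unfolding M_def by (rule generate.incl)
    qed
    ultimately have "L \<subseteq> M" unfolding L_def by (intro generate_subgroup_incl[OF _ M]) simp
    have "C \<subseteq> M"
      unfolding central_member_cyclic[OF C(1) z(2,3)]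
      by (rule generate_subgroup_incl[OF _ M]) (use z(1) \<open>L \<subseteq> M\<close> in blast)
    moreover have "K \<subseteq> M" if "K \<in> \<H>" "K \<noteq> C" for K
      unfolding M_def using that by (auto intro!: generate.incl)
    ultimately have "\<Union>\<H> \<subseteq> M" by blast
    then have "carrier P \<subseteq> M" using generate_subgroup_incl[OF _ M] generate_members by metis
    then have "M = carrier P" using subgroup.subset[OF M] by blast
    then show False using minimal[of "\<H> - {C}"] C(2) unfolding M_def by blast
  qed
  then have "card (L <#> C) = card L * p"
    using card_set_mult_trivial_Int[OF L Cs] central_member_card[OF C(1)] by simp
  then show ?case
    unfolding gen using insert.IH[OF S(1)] insert.hyps by (simp add: L_def)
qed

text \<open>Writing a central \<open>z\<close> as \<open>q c\<close>, the factor \<open>q\<close> is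
  central in \<open>P\<close> and in \<open>Q\<close>, hence in \<open>P'\<close>; so
  \<open>P'\<close> and the central members generate the centre.\<close>

lemma card_center: "card Z = card D * p ^ card \<C>"
proof -
  have "generate P (D \<union> \<Union>\<C>) = Z"
  proof
    show "generate P (D \<union> \<Union>\<C>) \<subseteq> Z"
      by (rule generate_subgroup_incl[OF _ Z_subgroup]) (use derived_central in \<open>auto simp: central_part_def\<close>)
    have sub: "subgroup (generate P (D \<union> \<Union>\<C>)) P"
      by (rule generate_is_subgroup)
        (use subgroup.subset[OF D_subgroup] Union_carrier[of \<C>] in \<open>auto simp: central_part_def\<close>)
    show "Z \<subseteq> generate P (D \<union> \<Union>\<C>)"
    proof
      fix z assume z: "z \<in> Z"
      obtain q c where q: "q \<in> Q" "c \<in> generate P (\<Union>\<C>)" "c \<in> Z" "z = q \<otimes> c"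
        using carrier_eq_Q_mult_Z[OF centerD(1)[OF z]] .
      have "q = z \<otimes> inv c" using q Q_carrier centerD(1)[OF q(3)] by (simp add: m_assoc)
      then have "q \<in> Z"
        using z q(3) subgroup.m_closed[OF Z_subgroup] subgroup.m_inv_closed[OF Z_subgroup] by simp
      then have "q \<in> generate P (D \<union> \<Union>\<C>)" using Q_Int_center[OF q(1)] by (auto intro: generate.incl)
      moreover have "c \<in> generate P (D \<union> \<Union>\<C>)"
        using mono_generate[of "\<Union>\<C>" "D \<union> \<Union>\<C>"] q(2) by blast
      ultimately show "z \<in> generate P (D \<union> \<Union>\<C>)" unfolding q(4) using subgroup.m_closed[OF sub] by blast
    qed
  qed
  moreover have "finite \<C>" using finite_members by (rule rev_finite_subset) (auto simp: central_part_def)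
  ultimately show ?thesis using card_generate_derived_central[of \<C>] by simp
qed

end

context odd_exponent_class2_group begin

lemma card_central_part_eq:
  assumes "fully_refined P \<H>" "fully_refined P \<H>'"
  shows "card (central_part P \<H>) = card (central_part P \<H>')"
proof -
  interpret F: fully_refined_decomposition P p \<H> by unfold_locales (rule assms(1))
  interpret F': fully_refined_decomposition P p \<H>' by unfold_locales (rule assms(2))
  have "finite (derived P (carrier P))" "derived P (carrier P) \<noteq> {}"
    using finite_subset[OF subgroup.subset[OF F.D_subgroup] finite_P] subgroup.one_closed[OF F.D_subgroup] by auto
  then have "card (derived P (carrier P)) > 0" by (simp add: card_gt_0_iff)
  then have "p ^ card (central_part P \<H>) = p ^ card (central_part P \<H>')"
    using F.card_center F'.card_center by simp
  then show ?thesis using prime_gt_1_nat[OF p_prime] by simp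
qed

end

section \<open>The commutator form\<close>

context fully_refined_decomposition begin

abbreviation "V \<equiv> Vq P Q"

lemma Qder_eq: "Qder P Q = D"
  unfolding Qder_def using derived_consistent[OF subset_refl Q_subgroup] derived_Q by simp

lemma V_eq: "V = subgrp P Q Mod D"
  by (simp add: Vq_def Qder_eq)

lemma coset_subgrp: "D #>\<^bsub>subgrp P Q\<^esub> x = D #> x"
  by (simp add: r_coset_def)

lemma V_carrier: "carrier V = (\<lambda>x. D #> x) ` Q"
  unfolding V_eq carrier_FactGroup by (simp add: coset_subgrp)

lemma V_comm_group: "comm_group V"
  using derived_quot_of_subgroup_is_comm_group[OF Q_subgroup] by (simp add: V_eq derived_Q)

lemma V_mult:
  assumes "x \<in> Q" "y \<in> Q"
  shows "(D #> x) \<otimes>\<^bsub>V\<^esub> (D #> y) = D #> (x \<otimes> y)"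
proof -
  interpret N: normal D "subgrp P Q"
    using derived_subgroup_is_normal[OF Q_subgroup] by (simp add: derived_Q)
  show ?thesis using N.rcos_sum[of x y] assms by (simp add: V_eq coset_subgrp)
qed

lemma V_one: "\<one>\<^bsub>V\<^esub> = D"
  by (simp add: V_eq)

lemma D_center: "d \<in> D \<Longrightarrow> d \<in> Z"
  using derived_central by blast

text \<open>Representatives of a coset of \<open>P'\<close> differ by central elements, so the
  choices made by \<open>SOME\<close> do not affect the commutator.\<close>

lemma Bi_coset:
  assumes "x \<in> Q" "y \<in> Q"
  shows "Bi P Q (D #> x) (D #> y) = comm P x y"
proof -
  have rep: "\<exists>d \<in> Z. (SOME u. u \<in> D #> x) = x \<otimes> d" if "x \<in> Q" for x
  proof -
    have "x \<in> D #> x" using rcos_self[OF Q_carrier[OF that] D_subgroup] .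
    then have "(SOME u. u \<in> D #> x) \<in> D #> x" by (rule someI)
    then obtain d where "d \<in> D" "(SOME u. u \<in> D #> x) = d \<otimes> x" by (auto simp: r_coset_def)
    then show ?thesis using D_center centerD(2)[OF D_center Q_carrier[OF that]] by auto
  qed
  obtain d e where "d \<in> Z" "(SOME u. u \<in> D #> x) = x \<otimes> d" "e \<in> Z" "(SOME u. u \<in> D #> y) = y \<otimes> e"
    using rep assms by blast
  then show ?thesis
    unfolding Bi_def using assms Q_carrier centerD(1) by (simp add: comm_center_right)
qed

text \<open>The canonical identification of \<open>P / Z(P)\<close> with \<open>Q / Q'\<close>, as a homomorphism on \<open>P\<close>.\<close>
definition \<phi> :: "'a \<Rightarrow> 'a set" where
  "\<phi> g = D #> (SOME q. q \<in> Q \<and> (\<exists>z \<in> Z. g = q \<otimes> z))"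

text \<open>If \<open>q z = s z'\<close>, then \<open>s inv q = z' inv z\<close> up to inversion of
  the central factors lies in both \<open>Q\<close> and the centre, hence in \<open>P'\<close>; so
  the coset is independent of the chosen \<open>q\<close>.\<close>

lemma \<phi>_eq:
  assumes q: "q \<in> Q" and z: "z \<in> Z"
  shows "\<phi> (q \<otimes> z) = D #> q"
proof -
  define s where "s = (SOME s. s \<in> Q \<and> (\<exists>z' \<in> Z. q \<otimes> z = s \<otimes> z'))"
  have "s \<in> Q \<and> (\<exists>z' \<in> Z. q \<otimes> z = s \<otimes> z')" unfolding s_def by (rule someI[of _ q]) (use q z in blast)
  then obtain z' where s: "s \<in> Q" "z' \<in> Z" "q \<otimes> z = s \<otimes> z'" by blast
  note c = Q_carrier[OF q] Q_carrier[OF s(1)] centerD(1)[OF z] centerD(1)[OF s(2)]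
  have d_eq: "s \<otimes> inv q = z \<otimes> inv z'"
  proof -
    have "s = (q \<otimes> z) \<otimes> inv z'" unfolding s(3) using c by (simp add: m_assoc)
    also have "\<dots> = (z \<otimes> inv z') \<otimes> q"
    proof -
      have "z \<otimes> inv z' \<in> Z"
        using subgroup.m_closed[OF Z_subgroup z subgroup.m_inv_closed[OF Z_subgroup s(2)]] .
      from centerD(2)[OF this c(1)] show ?thesis using c by (simp add: m_assoc)
    qed
    finally show ?thesis using c by (simp add: m_assoc)
  qed
  have "s \<otimes> inv q \<in> Q" using subgroup.m_closed[OF Q_subgroup s(1) subgroup.m_inv_closed[OF Q_subgroup q]] .
  moreover have "s \<otimes> inv q \<in> Z" unfolding d_eq
    using subgroup.m_closed[OF Z_subgroup z subgroup.m_inv_closed[OF Z_subgroup s(2)]] .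
  ultimately have "s \<otimes> inv q \<in> D" by (rule Q_Int_center)
  moreover have "s = (s \<otimes> inv q) \<otimes> q" using c by (simp add: m_assoc)
  ultimately have "s \<in> D #> q" unfolding r_coset_def by blast
  then have "D #> q = D #> s" using repr_independence[OF _ c(1) D_subgroup] by blast
  then show ?thesis by (simp add: \<phi>_def s_def)
qed

lemma \<phi>_Q: "q \<in> Q \<Longrightarrow> \<phi> q = D #> q"
  using \<phi>_eq[OF _ subgroup.one_closed[OF Z_subgroup], of q] Q_carrier by simp

lemma decompose:
  assumes "g \<in> carrier P"
  obtains q z where "q \<in> Q" "z \<in> Z" "g = q \<otimes> z" "\<phi> g = D #> q"
  using carrier_eq_Q_mult_Z[OF assms] \<phi>_eq by metis

lemma \<phi>_closed: "g \<in> carrier P \<Longrightarrow> \<phi> g \<in> carrier V"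
  using decompose V_carrier by (metis image_eqI)

lemma \<phi>_mult:
  assumes "g \<in> carrier P" "h \<in> carrier P"
  shows "\<phi> (g \<otimes> h) = \<phi> g \<otimes>\<^bsub>V\<^esub> \<phi> h"
proof -
  obtain q z where q: "q \<in> Q" "z \<in> Z" "g = q \<otimes> z" "\<phi> g = D #> q" using decompose[OF assms(1)] .
  obtain r w where r: "r \<in> Q" "w \<in> Z" "h = r \<otimes> w" "\<phi> h = D #> r" using decompose[OF assms(2)] .
  note c = Q_carrier[OF q(1)] Q_carrier[OF r(1)] centerD(1)[OF q(2)] centerD(1)[OF r(2)]
  have "g \<otimes> h = q \<otimes> (z \<otimes> r) \<otimes> w" unfolding q(3) r(3) using c by (simp add: m_assoc)
  also have "\<dots> = (q \<otimes> r) \<otimes> (z \<otimes> w)" unfolding centerD(2)[OF q(2) c(2)] using c by (simp add: m_assoc)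
  finally have "\<phi> (g \<otimes> h) = D #> (q \<otimes> r)"
    using \<phi>_eq[OF subgroup.m_closed[OF Q_subgroup q(1) r(1)] subgroup.m_closed[OF Z_subgroup q(2) r(2)]] by simp
  then show ?thesis using V_mult[OF q(1) r(1)] q(4) r(4) by simp
qed

lemma \<phi>_group_hom: "group_hom P V \<phi>"
proof -
  interpret V: comm_group V by (rule V_comm_group)
  show ?thesis
    by (intro group_hom.intro group_hom_axioms.intro group_axioms V.group_axioms)
      (auto simp: hom_def \<phi>_closed \<phi>_mult)
qed

lemma \<phi>_surj: "\<phi> ` carrier P = carrier V"
proof
  show "\<phi> ` carrier P \<subseteq> carrier V" using \<phi>_closed by blast
  have "D #> q \<in> \<phi> ` carrier P" if "q \<in> Q" for q
    unfolding \<phi>_Q[OF that, symmetric] using Q_carrier[OF that] by (rule imageI)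
  then show "carrier V \<subseteq> \<phi> ` carrier P" unfolding V_carrier by blast
qed

text \<open>The kernel is the full centre of \<open>P\<close>, which does not mention the
  decomposition; other decompositions can therefore be carried into the same
  \<open>V\<close>.\<close>

lemma \<phi>_kernel:
  assumes "g \<in> carrier P"
  shows "\<phi> g = \<one>\<^bsub>V\<^esub> \<longleftrightarrow> g \<in> Z"
proof
  obtain q z where q: "q \<in> Q" "z \<in> Z" "g = q \<otimes> z" "\<phi> g = D #> q" using decompose[OF assms] .
  assume "\<phi> g = \<one>\<^bsub>V\<^esub>"
  then have "q \<in> D" using rcos_self[OF Q_carrier[OF q(1)] D_subgroup] q(4) V_one by simp
  then show "g \<in> Z" unfolding q(3) using D_center q(2) subgroup.m_closed[OF Z_subgroup] by blast
next
  assume "g \<in> Z"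
  then have "\<phi> (\<one> \<otimes> g) = D #> \<one>" using \<phi>_eq[OF subgroup.one_closed[OF Q_subgroup]] by blast
  then show "\<phi> g = \<one>\<^bsub>V\<^esub>"
    using assms V_one coset_mult_one[OF subgroup.subset[OF D_subgroup]] by simp
qed

lemma Bi_\<phi>:
  assumes "g \<in> carrier P" "h \<in> carrier P"
  shows "Bi P Q (\<phi> g) (\<phi> h) = comm P g h"
proof -
  obtain q z where q: "q \<in> Q" "z \<in> Z" "g = q \<otimes> z" "\<phi> g = D #> q" using decompose[OF assms(1)] .
  obtain r w where r: "r \<in> Q" "w \<in> Z" "h = r \<otimes> w" "\<phi> h = D #> r" using decompose[OF assms(2)] .
  show ?thesis
    unfolding q(4) r(4) Bi_coset[OF q(1) r(1)] unfolding q(3) r(3)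
    using q(1,2) r(1,2) Q_carrier centerD(1) by (simp add: comm_center_right)
qed

text \<open>Everything is read off on \<open>P\<close>: the form is the commutator there, and its
  radical is the centre, which is the kernel of \<open>\<phi>\<close>.\<close>

lemma alternating_form_Bi: "alternating_form V (subgrp P Z) (Bi P Q)"
proof -
  interpret V: comm_group V by (rule V_comm_group)
  interpret \<phi>: group_hom P V \<phi> by (rule \<phi>_group_hom)
  have W: "comm_group (subgrp P Z)"
  proof (rule group.group_comm_groupI)
    show "group (subgrp P Z)" by (rule subgroup.subgroup_is_group[OF Z_subgroup is_group])
  qed (use centerD in auto)
  have rep: "\<exists>g \<in> carrier P. u = \<phi> g" if "u \<in> carrier V" for u using that \<phi>_surj by blast
  show ?thesis
  proof (intro alternating_form.intro V_comm_group W alternating_form_axioms.intro)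
    fix u v assume "u \<in> carrier V" "v \<in> carrier V"
    then obtain g h where g: "g \<in> carrier P" "u = \<phi> g" "h \<in> carrier P" "v = \<phi> h" using rep by blast
    then show "Bi P Q u v \<in> carrier (subgrp P Z)" by (simp add: Bi_\<phi> comm_central)
    fix w assume "w \<in> carrier V"
    then obtain k where k: "k \<in> carrier P" "w = \<phi> k" using rep by blast
    show "Bi P Q (u \<otimes>\<^bsub>V\<^esub> v) w = Bi P Q u w \<otimes>\<^bsub>subgrp P Z\<^esub> Bi P Q v w"
      using g k by (simp add: Bi_\<phi> comm_mult_left flip: \<phi>.hom_mult)
    show "Bi P Q w (u \<otimes>\<^bsub>V\<^esub> v) = Bi P Q w u \<otimes>\<^bsub>subgrp P Z\<^esub> Bi P Q w v"
      using g k by (simp add: Bi_\<phi> comm_mult_right flip: \<phi>.hom_mult)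
  next
    fix u assume "u \<in> carrier V"
    then obtain g where g: "g \<in> carrier P" "u = \<phi> g" using rep by blast
    then show "Bi P Q u u = \<one>\<^bsub>subgrp P Z\<^esub>" using comm_one_iff[of g g] by (simp add: Bi_\<phi>)
    assume *: "\<And>v. v \<in> carrier V \<Longrightarrow> Bi P Q u v = \<one>\<^bsub>subgrp P Z\<^esub>"
    have "g \<otimes> h = h \<otimes> g" if "h \<in> carrier P" for h
      using *[OF \<phi>_closed[OF that]] that g comm_one_iff[of g h] by (simp add: Bi_\<phi>)
    then have "g \<in> Z" using g(1) by (simp add: grp_center_def)
    then show "u = \<one>\<^bsub>V\<^esub>" using \<phi>_kernel g by blast
  next
    show "finite (carrier V)" unfolding \<phi>_surj[symmetric] using finite_P by simp
    have "v [^]\<^bsub>V\<^esub> p = \<one>\<^bsub>V\<^esub>" if "v \<in> carrier V" for v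
    proof -
      obtain g where g: "g \<in> carrier P" "v = \<phi> g" using rep \<open>v \<in> carrier V\<close> by blast
      then show ?thesis using \<phi>.hom_nat_pow[of g p] exponent_p by simp
    qed
    then show "\<exists>n::nat. odd n \<and> (\<forall>v\<in>carrier V. v [^]\<^bsub>V\<^esub> n = \<one>\<^bsub>V\<^esub>)" using p_odd by blast
  qed
qed

text \<open>\<open>V\<close>, the form and \<open>\<phi>\<close> belong to the fixed
  \<open>\<H>\<close>, while \<open>\<H>'\<close> is arbitrary. This places the frames of all
  decompositions in one ring, which the uniqueness of the counts requires.\<close>

lemma orthogonal_decomposition_of_fully_refined:
  assumes "fully_refined P \<H>'"
  shows "orthogonal_decomposition V (subgrp P Z) (Bi P Q) (\<H>' - central_part P \<H>') (\<lambda>H. \<phi> ` H)"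
proof -
  interpret F: fully_refined_decomposition P p \<H>' by unfold_locales (rule assms)
  interpret V: comm_group V by (rule V_comm_group)
  interpret \<phi>: group_hom P V \<phi> by (rule \<phi>_group_hom)
  show ?thesis
  proof (intro orthogonal_decomposition.intro alternating_form_Bi orthogonal_decomposition_axioms.intro)
    show "finite (\<H>' - central_part P \<H>')" using F.finite_members by simp
    have sub: "F.\<K> \<subseteq> \<H>'" by blast
    show "generate V (\<Union>H\<in>F.\<K>. \<phi> ` H) = carrier V"
    proof -
      have "generate V (\<phi> ` (\<Union>F.\<K>)) = \<phi> ` F.Q"
        unfolding F.Q_def using \<phi>.generate_img[OF F.Union_carrier[OF sub]] .
      also have "\<dots> = \<phi> ` carrier P"
      proof
        show "\<phi> ` carrier P \<subseteq> \<phi> ` F.Q"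
        proof clarify
          fix g assume "g \<in> carrier P"
          \<comment> \<open>\<open>\<H>'\<close> has its own \<open>F.Q\<close>, but together with
            the centre it still gives \<open>P\<close>, so its image under \<open>\<phi>\<close> is
            all of \<open>V\<close>.\<close>
          then obtain q c where q: "q \<in> F.Q" "c \<in> Z" "g = q \<otimes> c" using F.carrier_eq_Q_mult_Z by metis
          then have "\<phi> g = \<phi> q" using \<phi>_kernel[of c] F.Q_carrier centerD(1)[OF q(2)] by simp
          then show "\<phi> g \<in> \<phi> ` F.Q" using q(1) by blast
        qed
      qed (use F.Q_carrier in blast)
      finally show ?thesis by (simp add: \<phi>_surj image_Union)
    qed
  next
    fix H assume H: "H \<in> F.\<K>"
    then have HH: "H \<in> \<H>'" by blast
    note Hs = F.member_subgroup[OF HH] and Hc = F.member_carrier[OF HH]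
    show "subgroup (\<phi> ` H) V" using \<phi>.subgroup_img_is_subgroup[OF Hs] .
    show "\<phi> ` H \<noteq> {\<one>\<^bsub>V\<^esub>}"
    proof
      assume *: "\<phi> ` H = {\<one>\<^bsub>V\<^esub>}"
      have "h \<in> Z" if h: "h \<in> H" for h
      proof -
        have "\<phi> h = \<one>\<^bsub>V\<^esub>" using imageI[OF h, of \<phi>] unfolding * by simp
        then show ?thesis using \<phi>_kernel[OF Hc[OF h]] by simp
      qed
      then have "H \<subseteq> Z" by blast
      then show False using H by (simp add: central_part_def)
    qed
    fix K u v assume "K \<in> F.\<K>" "H \<noteq> K" "u \<in> \<phi> ` H" "v \<in> \<phi> ` K"
    then obtain h k where hk: "h \<in> H" "u = \<phi> h" "k \<in> K" "v = \<phi> k" "K \<in> \<H>'" by blast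
    have "h \<otimes> k = k \<otimes> h" by (rule F.members_commute[OF HH hk(5) \<open>H \<noteq> K\<close> hk(1,3)])
    then show "Bi P Q u v = \<one>\<^bsub>subgrp P Z\<^esub>"
      using hk Hc F.member_carrier[OF hk(5)] comm_one_iff[of h k] by (simp add: Bi_\<phi>)
  next
    fix H A B assume H: "H \<in> F.\<K>" and A: "subgroup A V" "A \<subseteq> \<phi> ` H" and B: "subgroup B V" "B \<subseteq> \<phi> ` H"
      and orth: "\<And>u v. u \<in> A \<Longrightarrow> v \<in> B \<Longrightarrow> Bi P Q u v = \<one>\<^bsub>subgrp P Z\<^esub>" and AB: "\<phi> ` H \<subseteq> A <#>\<^bsub>V\<^esub> B"
    then have HH: "H \<in> \<H>'" by blast
    note Hs = F.member_subgroup[OF HH] and Hc = F.member_carrier[OF HH]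
    \<comment> \<open>Orthogonal factors of the image are lifted to their full preimages in
      \<open>H\<close>, which commute elementwise since the form is the commutator.\<close>
    define pre where "pre S = {h \<in> H. \<phi> h \<in> S}" for S
    have pre: "subgroup (pre S) P" if "subgroup S V" for S
    proof (rule subgroupI)
      show "pre S \<subseteq> carrier P" using Hc by (auto simp: pre_def)
      show "pre S \<noteq> {}"
        using subgroup.one_closed[OF Hs] subgroup.one_closed[OF that] \<phi>.hom_one by (auto simp: pre_def)
      fix x assume x: "x \<in> pre S"
      then show "inv x \<in> pre S"
        using subgroup.m_inv_closed[OF Hs] subgroup.m_inv_closed[OF that] Hc by (auto simp: pre_def)
      fix y assume "y \<in> pre S"
      then show "x \<otimes> y \<in> pre S"
        using x subgroup.m_closed[OF Hs] subgroup.m_closed[OF that] Hc by (auto simp: pre_def)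
    qed
    have comm: "a \<otimes> c = c \<otimes> a" if "a \<in> pre A" "c \<in> pre B" for a c
      using that orth[of "\<phi> a" "\<phi> c"] Hc comm_one_iff[of a c] by (simp add: pre_def Bi_\<phi>)
    have gen: "generate P (pre A \<union> pre B) = H"
    proof
      show "generate P (pre A \<union> pre B) \<subseteq> H"
        by (rule generate_subgroup_incl[OF _ Hs]) (auto simp: pre_def)
      show "H \<subseteq> generate P (pre A \<union> pre B)"
      proof
        fix h assume h: "h \<in> H"
        then obtain u v where "u \<in> A" "v \<in> B" "\<phi> h = u \<otimes>\<^bsub>V\<^esub> v"
          using AB unfolding set_mult_def by blast
        then obtain a c where ac: "a \<in> pre A" "c \<in> pre B" "\<phi> h = \<phi> a \<otimes>\<^bsub>V\<^esub> \<phi> c"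
          using A(2) B(2) unfolding pre_def by blast
        have acH: "a \<in> H" "c \<in> H" using ac by (auto simp: pre_def)
        note cr = Hc[OF h] Hc[OF acH(1)] Hc[OF acH(2)]
        \<comment> \<open>The lifts \<open>a\<close> and \<open>c\<close> reproduce \<open>h\<close>
          only modulo the centre. Taking \<open>h inv c\<close> in place of \<open>a\<close> absorbs
          this error inside \<open>H\<close>, and the full preimage contains it.\<close>
        define z where "z = h \<otimes> inv c"
        have zH: "z \<in> H"
          unfolding z_def using subgroup.m_closed[OF Hs h subgroup.m_inv_closed[OF Hs acH(2)]] .
        have "\<phi> z = \<phi> a" unfolding z_def using cr ac(3) by (simp add: V.m_assoc)
        then have "z \<in> pre A" using zH ac(1) by (simp add: pre_def)
        then have "z \<otimes> c \<in> generate P (pre A \<union> pre B)"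
          using ac(2) by (intro generate.eng generate.incl) auto
        then show "h \<in> generate P (pre A \<union> pre B)" using cr by (simp add: z_def m_assoc)
      qed
    qed
    have "pre A = H \<or> pre B = H"
      by (rule indecomposable_factor[OF Hs F.member_indecomposable[OF HH] pre[OF A(1)] _ pre[OF B(1)] _ comm gen])
        (auto simp: pre_def)
    then show "A = \<phi> ` H \<or> B = \<phi> ` H"
      using A(2) B(2) unfolding pre_def by blast
  qed
qed

lemma img_V_eq: "H \<in> \<K> \<Longrightarrow> img_V P Q H = \<phi> ` H"
proof -
  assume "H \<in> \<K>"
  then have "H \<subseteq> Q" unfolding Q_def by (auto intro: generate.incl)
  then have "\<phi> h = D #> h" if "h \<in> H" for h using \<phi>_Q that by blast
  then show ?thesis unfolding img_V_def Qder_eq coset_subgrp by simp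
qed

end

theorem theorem4p32:
  fixes P :: "('a, 'b) monoid_scheme" and p :: nat and \<H> :: "'a set set"
  assumes "Factorial_Ring.prime p" and "odd p"
    and "group P" and "p_group P p" and "class_two P" and "has_exponent P p"
    and "fully_refined P \<H>"
  defines "\<K> \<equiv> \<H> - central_part P \<H>"
  defines "Q \<equiv> generate P (\<Union>\<K>)"
  defines "KI \<equiv> (\<lambda>I. {H \<in> \<K>. proj_e P Q \<K> H \<notin> I})"
  shows "\<H> = central_part P \<H> \<union> \<K> \<and> central_part P \<H> \<inter> \<K> = {}
       \<and> partition_on \<K> (KI ` {I. max_star_ideal P Q I})
       \<and> inj_on KI {I. max_star_ideal P Q I}
       \<and> (\<forall>\<H>'. fully_refined P \<H>' \<longrightarrow>
            card (central_part P \<H>') = card (central_part P \<H>)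
          \<and> card (\<H>' - central_part P \<H>') = card \<K>
          \<and> card \<H>' = card \<H>)"
proof -
  interpret group P by (rule assms(3))
  interpret odd_exponent_class2_group P p
    by unfold_locales
      (use assms(1,2,4-6) in \<open>auto simp: p_group_def class_two_def has_exponent_def\<close>)
  interpret F: fully_refined_decomposition P p \<H> by unfold_locales (rule assms(7))
  have FQ: "F.Q = Q" by (simp add: F.Q_def Q_def \<K>_def)
  interpret O: orthogonal_decomposition "Vq P Q" "subgrp P (grp_center P)" "Bi P Q" \<K> "\<lambda>H. F.\<phi> ` H"
    using F.orthogonal_decomposition_of_fully_refined[OF assms(7)] unfolding FQ \<K>_def[symmetric] .
  have endV: "EndV P Q = O.endos" by (simp add: EndV_def O.endos_def)
  have adjoint: "is_adjoint P Q f g \<longleftrightarrow> O.adjoint f g" for f g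
    by (simp add: is_adjoint_def O.adjoint_def endV)
  have Adj: "Adj P Q = carrier O.adj_ring"
    by (simp add: Adj_def O.adj_ring_simps(1) O.adjointable_def endV adjoint)
  have star: "adj_star P Q = O.adj"
    by (simp add: fun_eq_iff adj_star_def O.adj_def adjoint)
  have ops: "end_zero P Q = \<zero>\<^bsub>O.adj_ring\<^esub>" "end_add P Q f g = f \<oplus>\<^bsub>O.adj_ring\<^esub> g"
    "end_mult P Q f g = f \<otimes>\<^bsub>O.adj_ring\<^esub> g" for f g
    by (simp_all add: end_zero_def end_add_def end_mult_def O.adj_ring_simps)
  \<comment> \<open>Agreement on the carrier is enough, because the ideals compared below are
    contained in it.\<close>
  have neg: "end_neg P Q f = \<ominus>\<^bsub>O.adj_ring\<^esub> f" if "f \<in> carrier O.adj_ring" for f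
    using O.A.minus_equality[of "end_neg P Q f" f] O.adj_ring_l_neg[of f] that
    by (simp add: end_neg_def O.adj_ring_simps(1))
  have ideal: "star_ideal P Q I \<longleftrightarrow> O.A.invol_ideal I" for I
    unfolding star_ideal_def O.A.invol_ideal_def Adj star ops
    by (intro conj_cong refl ball_cong) (use neg in auto)
  have max_ideal: "max_star_ideal P Q I \<longleftrightarrow> O.A.max_invol_ideal I" for I
    by (simp add: max_star_ideal_def O.A.max_invol_ideal_def ideal Adj)
  have img: "img_V P Q H = F.\<phi> ` H" if "H \<in> \<K>" for H
    using F.img_V_eq[of H] that by (simp add: FQ \<K>_def)
  have proj: "proj_e P Q \<K> H = O.proj H" if "H \<in> \<K>" for H
    using img that by (simp add: proj_e_def O.proj_def O.Y_def)
  have KI: "KI = (\<lambda>I. {H \<in> \<K>. O.proj H \<notin> I})"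
    using proj by (auto simp: KI_def)
  have disj: "\<H> = central_part P \<H> \<union> \<K>" "central_part P \<H> \<inter> \<K> = {}"
    by (auto simp: \<K>_def central_part_def)
  have counts: "card (central_part P \<H>') = card (central_part P \<H>)
      \<and> card (\<H>' - central_part P \<H>') = card \<K> \<and> card \<H>' = card \<H>"
    if refined: "fully_refined P \<H>'" for \<H>'
  proof -
    interpret F': fully_refined_decomposition P p \<H>' by unfold_locales (rule refined)
    \<comment> \<open>Only the index set differs from \<open>O\<close>; the space and the form are
      the same, so both frames live in the same adjoint ring.\<close>
    interpret O': orthogonal_decomposition "Vq P Q" "subgrp P (grp_center P)" "Bi P Q"
        "\<H>' - central_part P \<H>'" "\<lambda>H. F.\<phi> ` H"
      using F.orthogonal_decomposition_of_fully_refined[OF refined] unfolding FQ .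
    have c: "card (central_part P \<H>') = card (central_part P \<H>)"
      by (rule card_central_part_eq[OF refined assms(7)])
    have k: "card (\<H>' - central_part P \<H>') = card \<K>"
      using O.A.frame_card_unique[OF O'.frame_proj O.frame_proj] O.card_frame_proj O'.card_frame_proj by simp
    have "card \<S> = card (central_part P \<S>) + card (\<S> - central_part P \<S>)" if "finite \<S>" for \<S>
      using that card_Diff_subset[of "central_part P \<S>" \<S>] card_mono[of \<S> "central_part P \<S>"]
      by (auto simp: central_part_def)
    from this[OF F.finite_members] this[OF F'.finite_members] show ?thesis
      using c k by (simp add: \<K>_def)
  qed
  show ?thesis
    unfolding KI max_ideal
    by (intro conjI allI impI disj conjunct1[OF O.partition_by_max_ideals]
        conjunct2[OF O.partition_by_max_ideals] counts[THEN conjunct1]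
        counts[THEN conjunct2, THEN conjunct1] counts[THEN conjunct2, THEN conjunct2])
qed

end
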